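(* Let $u$ be the solution of the Poisson problem $$-\Delta u=f\ \text{ in }\Omega,\qquad u=g\ \text{ on }\partial\Omega,$$ and for $\delta>0$ let $u_\delta$ be the solution of the nonlocal model $$\frac{1}{\delta^2}\int_{\Omega}R_\delta(x,y)(u_\delta(x)-u_\delta(y))\,dy+\frac{2}{\delta}\int_{\partial\Omega}\bar R_\delta(x,y)(u_\delta(x)-g(y))\,dS_y=\int_\Omega \bar R_\delta(x,y)f(y)\,dy,\qquad x\in\Omega.$$ Suppose $u\in C^4(\bar\Omega)$. Then there exists $C>0$ independent of $\delta$ such that for every $x\in\Omega$ $$|u(x)-u_\delta(x)|\le C\delta.$$
   Context: $\Omega\subset\mathbb{R}^n$ is a bounded connected open set with smooth ($C^\infty$) boundary; $dS_y$ is surface measure on $\partial\Omega$. The function $R:[0,\infty)\to[0,\infty)$ satisfies: $R\in C^1([0,1])$; $R(r)\ge 0$ and $R(r)=0$ for all $r>1$; there is $\gamma_0>0$ with $R(r)\ge\gamma_0$ for $0\le r\le \frac12$. Set $\bar R(r)=\int_r^{\infty}R(s)\,ds$. For $\delta>0$ put $$R_\delta(x,y)=\alpha_n\delta^{-n}R\left(\frac{|x-y|^2}{4\delta^2}\right),\qquad \bar R_\delta(x,y)=\alpha_n\delta^{-n}\bar R\left(\frac{|x-y|^2}{4\delta^2}\right),$$ where the constant $\alpha_n>0$ is chosen so that $\int_{\mathbb{R}^n}\bar R_\delta(x,y)\,dy=1$. The solution $u_\delta\in L^2(\Omega)$ of the nonlocal model satisfies the equation at every point $x\in\Omega$. The constant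 $C$ may depend on $\Omega$, $R$ and $u$. *)

theory Defs
  imports "HOL-Analysis.Analysis"
begin

section \<open>Partial derivatives and C^k functions\<close>

definition partial_deriv :: "'n \<Rightarrow> (real^'n \<Rightarrow> real) \<Rightarrow> real^'n \<Rightarrow> real" where
  "partial_deriv i f x = frechet_derivative f (at x) (axis i 1)"

definition iter_partial :: "'n list \<Rightarrow> (real^'n \<Rightarrow> real) \<Rightarrow> real^'n \<Rightarrow> real" where
  "iter_partial is f = foldr partial_deriv is f"

text \<open>Only meant for open \<open>U\<close>.  Differentiability is required explicitly because
  \<^const>\<open>frechet_derivative\<close> is a total function.\<close>

definition Ck_on :: "nat \<Rightarrow> (real^'n) set \<Rightarrow> (real^'n \<Rightarrow> real) \<Rightarrow> bool" where
  "Ck_on k U f \<longleftrightarrow>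
     (\<forall>is. length is < k \<longrightarrow> (\<forall>x\<in>U. iter_partial is f differentiable (at x))) \<and>
     (\<forall>is. length is \<le> k \<longrightarrow> continuous_on U (iter_partial is f))"

text \<open>The space of functions that are C^k up to the boundary of the open set \<open>U\<close>: every partial
  derivative of order at most \<open>k\<close> extends continuously from \<open>U\<close> to its closure; \<open>f\<close> itself
  carries its boundary values.\<close>

definition Ck_closure :: "nat \<Rightarrow> (real^'n) set \<Rightarrow> (real^'n \<Rightarrow> real) \<Rightarrow> bool" where
  "Ck_closure k U f \<longleftrightarrow>
     Ck_on k U f \<and> continuous_on (closure U) f \<and>
     (\<forall>is. length is \<le> k \<longrightarrow>
        (\<exists>h. continuous_on (closure U) h \<and> (\<forall>x\<in>U. h x = iter_partial is f x)))"

definition smooth :: "(real^'n \<Rightarrow> real) \<Rightarrow> bool" where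
  "smooth f \<longleftrightarrow> (\<forall>k. Ck_on k UNIV f)"

definition laplacian :: "(real^'n \<Rightarrow> real) \<Rightarrow> real^'n \<Rightarrow> real" where
  "laplacian f x = (\<Sum>i\<in>UNIV. partial_deriv i (partial_deriv i f) x)"


section \<open>Smooth boundary and surface measure\<close>

text \<open>Inside \<open>ball p r\<close>, the set \<open>\<Omega>\<close> is the side \<open>s x\<^sub>i > \<gamma>(x')\<close> of a smooth graph over the coordinate
  hyperplane \<open>x\<^sub>i = 0\<close>, where \<open>x'\<close> omits the \<open>i\<close>-th coordinate.  A function of \<open>x'\<close> is encoded as a
  function on the whole space that does not depend on the \<open>i\<close>-th coordinate.\<close>

definition graph_chart ::
    "(real^'n) set \<Rightarrow> real^'n \<Rightarrow> real \<Rightarrow> 'n \<Rightarrow> real \<Rightarrow> (real^'n \<Rightarrow> real) \<Rightarrow> bool" where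
  "graph_chart \<Omega> p r i s \<gamma> \<longleftrightarrow>
     r > 0 \<and> s \<in> {1, -1} \<and> smooth \<gamma> \<and> (\<forall>x t. \<gamma> (x + t *\<^sub>R axis i 1) = \<gamma> x) \<and>
     \<Omega> \<inter> ball p r = {x \<in> ball p r. s * (x $ i) > \<gamma> x}"

definition smooth_boundary :: "(real^'n) set \<Rightarrow> bool" where
  "smooth_boundary \<Omega> \<longleftrightarrow> (\<forall>p\<in>frontier \<Omega>. \<exists>r i s \<gamma>. graph_chart \<Omega> p r i s \<gamma>)"

text \<open>The (n-1)-dimensional Lebesgue measure on the coordinate hyperplane \<open>x\<^sub>i = 0\<close>
  (for n = 1, the unit mass at the origin).\<close>

definition hyperplane_lborel :: "'n \<Rightarrow> (real^'n::finite) measure" where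
  "hyperplane_lborel i =
     distr (\<Pi>\<^sub>M j\<in>UNIV - {i}. lborel) borel (\<lambda>c. \<chi> j. if j = i then 0 else c j)"

text \<open>\<open>S\<close> is the surface measure of the boundary of \<open>\<Omega>\<close>: it is concentrated on the boundary and
  in each graph chart \<open>x\<^sub>i = s \<gamma>(x')\<close> it is given by the area element
  \<open>sqrt (1 + |grad \<gamma>|^2) dx'\<close>.  For a bounded \<open>\<Omega>\<close> with smooth boundary these properties
  determine exactly one Borel measure; for n = 1 it is the counting measure on the boundary.\<close>

definition is_surface_measure :: "(real^'n::finite) set \<Rightarrow> (real^'n) measure \<Rightarrow> bool" where
  "is_surface_measure \<Omega> S \<longleftrightarrow>
     sets S = sets borel \<and> emeasure S (- frontier \<Omega>) = 0 \<and>
     (\<forall>p r i s \<gamma>. graph_chart \<Omega> p r i s \<gamma> \<longrightarrow>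
        (\<forall>A\<in>sets borel. A \<subseteq> ball p r \<longrightarrow>
           emeasure S A =
             (\<integral>\<^sup>+ z. indicator A (z + (s * \<gamma> z) *\<^sub>R axis i 1) *
                    ennreal (sqrt (1 + (\<Sum>j\<in>UNIV. (partial_deriv j \<gamma> z)\<^sup>2)))
              \<partial>hyperplane_lborel i)))"


section \<open>The nonlocal model\<close>

definition tail_integral :: "(real \<Rightarrow> real) \<Rightarrow> real \<Rightarrow> real" where
  "tail_integral R r = (LINT s:{r..}|lborel. R s)"

definition scaled_kernel ::
    "real \<Rightarrow> (real \<Rightarrow> real) \<Rightarrow> real \<Rightarrow> real^'n \<Rightarrow> real^'n::finite \<Rightarrow> real" where
  "scaled_kernel \<alpha> K \<delta> x y = \<alpha> / \<delta> ^ CARD('n) * K ((norm (x - y))\<^sup>2 / (4 * \<delta>\<^sup>2))"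

definition square_integrable_on :: "(real^'n::finite \<Rightarrow> real) \<Rightarrow> (real^'n) set \<Rightarrow> bool" where
  "square_integrable_on v \<Omega> \<longleftrightarrow>
     set_borel_measurable lebesgue \<Omega> v \<and> set_integrable lebesgue \<Omega> (\<lambda>y. (v y)\<^sup>2)"

definition nonlocal_solution ::
    "(real^'n::finite) set \<Rightarrow> (real^'n) measure \<Rightarrow> real \<Rightarrow> (real \<Rightarrow> real) \<Rightarrow>
     (real^'n \<Rightarrow> real) \<Rightarrow> (real^'n \<Rightarrow> real) \<Rightarrow> real \<Rightarrow> (real^'n \<Rightarrow> real) \<Rightarrow> bool" where
  "nonlocal_solution \<Omega> S \<alpha> R f g \<delta> v \<longleftrightarrow>
     square_integrable_on v \<Omega> \<and>
     (\<forall>x\<in>\<Omega>.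
        1 / \<delta>\<^sup>2 * (LINT y:\<Omega>|lebesgue. scaled_kernel \<alpha> R \<delta> x y * (v x - v y)) +
        2 / \<delta> * (LINT y:frontier \<Omega>|S. scaled_kernel \<alpha> (tail_integral R) \<delta> x y * (v x - g y)) =
        (LINT y:\<Omega>|lebesgue. scaled_kernel \<alpha> (tail_integral R) \<delta> x y * f y))"

end

theory Submission imports Defs begin

text \<open>Write \<open>B(x)\<close> for the boundary integral of the kernel \<open>R\<close>-bar around \<open>x\<close> and
  \<open>q(x)\<close> for the integral of \<open>R\<^sub>\<delta>(x,y) |x - y|\<^sup>2\<close> over the domain, divided by \<open>\<delta>\<^sup>2\<close>.  Integrating the
  derivatives of \<open>R\<close>-bar times a polynomial by parts bounds the first moment of \<open>R\<^sub>\<delta>\<close> by \<open>B\<close> and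
  identifies its second moments up to \<open>\<delta> B\<close>; with the Taylor expansion of \<open>u\<close> at \<open>x\<close> the truncation
  error is therefore at most a multiple of \<open>B(x) + \<delta> q(x)\<close>, up to and including the boundary layer.
  The barrier \<open>\<kappa> - |x|\<^sup>2\<close> with \<open>\<kappa>\<close> of order \<open>1 + \<delta>\<close> is mapped by the nonlocal operator to at
  least \<open>q + 2 B (1 + \<delta>) / \<delta>\<close>, so a multiple of \<open>min 1 \<delta>\<close> times the barrier dominates the error
  by the minimum principle.  Only an inequality is needed from the divergence theorem: the integral
  of a partial derivative over the domain is at most the integral of the absolute value over the
  boundary.  All bounds are uniform in \<open>\<delta>\<close>, so large \<open>\<delta>\<close> needs no separate argument.\<close>

section \<open>Slicing Lebesgue measure along a coordinate\<close>

text \<open>The obstacle is the layer of width 2\<delta> at the boundary: \<open>B\<close> can be of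
  order 1/\<delta> there, so the truncation error does not tend to zero. The rate survives because
  the penalty term multiplies \<open>B\<close> by a further 2/\<delta>: a barrier of amplitude of
  order \<delta> still controls the error in the layer. Further inside, \<open>B\<close> vanishes
  and only \<delta> \<open>q\<close> remains. The integrations by parts rest on one identity: the
  derivative of the scaled tail kernel in y_j is -(y - x)_j / (2 \<delta>^2) times the scaled kernel
  of \<open>R\<close>. The polynomials are 1 and (y - x)_i. The second ties the diagonal second
  moments to the mass of the tail kernel, which is why the Laplacian of u at x cancels against the
  integral of f. That mass is in turn bounded through \<open>q\<close> and \<open>B\<close>, so
  every error is measured in quantities that the barrier produces. The surface measure is given
  chart by chart through graphs over coordinate hyperplanes. Fluxes are therefore computed by Fubini
  along coordinate axes, and the area element is used only as an upper bound for the components of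
  the normal to the graph.\<close>

lemma measurable_slices:
  "(\<lambda>(c, t). (\<chi> j. if j = i then 0 else c j) + t *\<^sub>R (axis i 1 :: real^'n::finite))
     \<in> (\<Pi>\<^sub>M j\<in>UNIV - {i}. lborel) \<Otimes>\<^sub>M lborel \<rightarrow>\<^sub>M borel" (is "?f \<in> ?M \<rightarrow>\<^sub>M _")
proof (rule borel_measurable_euclidean_space[THEN iffD2], rule ballI)
  fix b :: "real^'n" assume "b \<in> Basis"
  then obtain k where b: "b = axis k 1" by (auto simp: Basis_vec_def)
  have "(\<lambda>x. ?f x \<bullet> b) = (\<lambda>x. if k = i then snd x else fst x k)"
    unfolding b inner_axis by (simp add: case_prod_beta axis_def fun_eq_iff)
  also have "\<dots> \<in> borel_measurable ?M"
    by (cases "k = i") (auto intro!: measurable_compose[OF measurable_fst] measurable_compose[OF measurable_component_singleton])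
  finally show "(\<lambda>x. ?f x \<bullet> b) \<in> borel_measurable ?M" .
qed

text \<open>Lebesgue measure is determined by its values on boxes, and the preimage of a box under
  the slicing map is a product of one interval per coordinate. For n = 1 the product over the empty
  index set is a unit mass at one point, so that case is included.\<close>

lemma lborel_eq_slices:
  "lborel = distr ((\<Pi>\<^sub>M j\<in>UNIV - {i::'n::finite}. lborel) \<Otimes>\<^sub>M lborel) borel
     (\<lambda>(c, t). (\<chi> j. if j = i then 0 else c j) + t *\<^sub>R (axis i 1 :: real^'n))"
proof (rule lborel_eqI)
  let ?I = "UNIV - {i::'n}"
  let ?f = "\<lambda>(c, t). (\<chi> j. if j = i then 0 else c j) + t *\<^sub>R (axis i 1 :: real^'n)"
  interpret product_sigma_finite "\<lambda>_::'n. lborel::real measure" by standard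
  interpret P: sigma_finite_measure "\<Pi>\<^sub>M j\<in>?I. lborel::real measure" by (rule sigma_finite) simp
  interpret P2: pair_sigma_finite "\<Pi>\<^sub>M j\<in>?I. lborel::real measure" "lborel::real measure" ..
  have f_nth: "?f x $ j = (if j = i then snd x else fst x j)" for x j
    by (simp add: case_prod_beta axis_def)
  note meas = measurable_slices[of i]
  fix l u :: "real^'n" assume lu: "\<And>b. b \<in> Basis \<Longrightarrow> l \<bullet> b \<le> u \<bullet> b"
  have lu': "l $ j \<le> u $ j" for j
    using lu[of "axis j 1"] by (simp add: inner_axis)
  have "?f -` box l u \<inter> space ((\<Pi>\<^sub>M j\<in>?I. lborel) \<Otimes>\<^sub>M lborel) =
      (\<Pi>\<^sub>E j\<in>?I. {l$j<..<u$j}) \<times> {l$i<..<u$i}" (is "?A = ?B")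
  proof (rule set_eqI)
    fix x
    show "x \<in> ?A \<longleftrightarrow> x \<in> ?B"
    proof -
      have "?f x \<in> box l u \<longleftrightarrow> (\<forall>j. l $ j < ?f x $ j \<and> ?f x $ j < u $ j)"
        unfolding mem_box_cart by simp
      then show ?thesis
        unfolding f_nth by (cases x) (auto simp: space_pair_measure space_PiM PiE_iff mem_box_cart split: if_splits)
    qed
  qed
  then have "emeasure (distr ((\<Pi>\<^sub>M j\<in>?I. lborel) \<Otimes>\<^sub>M lborel) borel ?f) (box l u) =
     emeasure ((\<Pi>\<^sub>M j\<in>?I. lborel) \<Otimes>\<^sub>M lborel) ?B"
    by (subst emeasure_distr[OF meas]) auto
  also have "\<dots> = (\<Prod>j\<in>?I. ennreal (u$j - l$j)) * ennreal (u$i - l$i)"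
    using lu' by (subst lborel.emeasure_pair_measure_Times) (auto simp: emeasure_PiM)
  also have "\<dots> = (\<Prod>j\<in>UNIV. ennreal (u$j - l$j))"
    by (subst prod.remove[of UNIV i]) (auto simp: mult.commute)
  also have "\<dots> = ennreal (\<Prod>j\<in>UNIV. u$j - l$j)"
    using lu' by (intro prod_ennreal) auto
  also have "(\<Prod>j\<in>UNIV. u$j - l$j) = (\<Prod>b\<in>Basis. (u - l) \<bullet> b)"
  proof -
    have "(\<Prod>b\<in>Basis. (u - l) \<bullet> b) = (\<Prod>b\<in>range (\<lambda>j. axis j 1). (u - l) \<bullet> b)"
      by (rule prod.cong) (auto simp: Basis_vec_def)
    also have "\<dots> = (\<Prod>j\<in>UNIV. u$j - l$j)"
      by (subst prod.reindex) (auto simp: inj_on_def axis_eq_axis inner_axis)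
    finally show ?thesis by simp
  qed
  finally show "emeasure (distr ((\<Pi>\<^sub>M j\<in>?I. lborel) \<Otimes>\<^sub>M lborel) borel ?f) (box l u) =
      ennreal (\<Prod>b\<in>Basis. (u - l) \<bullet> b)" .
qed simp

lemma measurable_embed_hyperplane:
  "(\<lambda>c. \<chi> j. if j = i then 0 else c j) \<in> (\<Pi>\<^sub>M j\<in>UNIV - {i::'n::finite}. lborel) \<rightarrow>\<^sub>M (borel :: (real^'n) measure)"
proof (rule borel_measurable_euclidean_space[THEN iffD2], rule ballI)
  fix b :: "real^'n" assume "b \<in> Basis"
  then obtain k where b: "b = axis k 1" by (auto simp: Basis_vec_def)
  have "(\<lambda>c. (\<chi> j. if j = i then 0 else c j) \<bullet> b) = (\<lambda>c. if k = i then 0 else c k)"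
    by (simp add: b inner_axis fun_eq_iff)
  also have "\<dots> \<in> borel_measurable (\<Pi>\<^sub>M j\<in>UNIV - {i}. lborel)"
    by (cases "k = i") (auto intro!: measurable_component_singleton[THEN measurable_compose])
  finally show "(\<lambda>c. (\<chi> j. if j = i then 0 else c j) \<bullet> b) \<in> borel_measurable (\<Pi>\<^sub>M j\<in>UNIV - {i}. lborel)" .
qed

lemma sets_hyperplane_lborel [simp, measurable_cong]: "sets (hyperplane_lborel i) = sets borel"
  by (simp add: hyperplane_lborel_def)

lemma space_hyperplane_lborel [simp]: "space (hyperplane_lborel i) = UNIV"
  by (simp add: hyperplane_lborel_def)

text \<open>The measure lives on the whole space but is carried by the hyperplane; this makes t the
  i-th coordinate of \<open>z + t *\<^sub>R axis i 1\<close> in slice integrals.\<close>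

lemma AE_hyperplane_lborel: "AE z in hyperplane_lborel i. z $ i = 0"
  unfolding hyperplane_lborel_def
  by (subst AE_distr_iff[OF measurable_embed_hyperplane]) auto

lemma nn_integral_slices:
  fixes F :: "real^'n::finite \<Rightarrow> ennreal"
  assumes [measurable]: "F \<in> borel_measurable borel"
  shows "(\<integral>\<^sup>+ y. F y \<partial>lborel) = (\<integral>\<^sup>+ z. (\<integral>\<^sup>+ t. F (z + t *\<^sub>R axis i 1) \<partial>lborel) \<partial>hyperplane_lborel i)"
proof -
  note [measurable] = measurable_embed_hyperplane[of i]
  have "(\<integral>\<^sup>+ y. F y \<partial>lborel) =
     (\<integral>\<^sup>+ x. F ((\<lambda>(c, t). (\<chi> j. if j = i then 0 else c j) + t *\<^sub>R axis i 1) x) \<partial>((\<Pi>\<^sub>M j\<in>UNIV - {i}. lborel) \<Otimes>\<^sub>M lborel))"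
    by (subst lborel_eq_slices[of i], rule nn_integral_distr[OF measurable_slices]) simp
  also have "\<dots> = (\<integral>\<^sup>+ c. \<integral>\<^sup>+ t. F ((\<chi> j. if j = i then 0 else c j) + t *\<^sub>R axis i 1) \<partial>lborel \<partial>(\<Pi>\<^sub>M j\<in>UNIV - {i}. lborel))"
    by (subst lborel.nn_integral_fst[symmetric]) (auto intro!: measurable_compose[OF measurable_slices])
  also have "\<dots> = (\<integral>\<^sup>+ z. (\<integral>\<^sup>+ t. F (z + t *\<^sub>R axis i 1) \<partial>lborel) \<partial>hyperplane_lborel i)"
    unfolding hyperplane_lborel_def by (subst nn_integral_distr) measurable
  finally show ?thesis .
qed

lemma integral_slices:
  fixes F :: "real^'n::finite \<Rightarrow> real"
  assumes F: "integrable lborel F"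
  shows "(LINT y|lborel. F y) = (LINT z|hyperplane_lborel i. (LINT t|lborel. F (z + t *\<^sub>R axis i 1)))"
proof -
  interpret product_sigma_finite "\<lambda>_::'n. lborel::real measure" by standard
  interpret P: sigma_finite_measure "\<Pi>\<^sub>M j\<in>UNIV - {i}. lborel::real measure" by (rule sigma_finite) simp
  interpret P2: pair_sigma_finite "\<Pi>\<^sub>M j\<in>UNIV - {i}. lborel::real measure" "lborel::real measure" ..
  note [measurable] = measurable_embed_hyperplane[of i]
  have [measurable]: "F \<in> borel_measurable borel" using F by (auto simp: integrable_iff_bounded)
  let ?f = "\<lambda>(c, t). (\<chi> j. if j = i then 0 else c j) + t *\<^sub>R (axis i 1 :: real^'n)"
  have f[measurable]: "?f \<in> (\<Pi>\<^sub>M j\<in>UNIV - {i}. lborel) \<Otimes>\<^sub>M lborel \<rightarrow>\<^sub>M borel" by (rule measurable_slices)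
  have "integrable ((\<Pi>\<^sub>M j\<in>UNIV - {i}. lborel) \<Otimes>\<^sub>M lborel) (\<lambda>x. F (?f x))"
    using F by (subst (asm) lborel_eq_slices[of i], subst (asm) integrable_distr_eq) auto
  then have int: "integrable ((\<Pi>\<^sub>M j\<in>UNIV - {i}. lborel) \<Otimes>\<^sub>M lborel) (\<lambda>(c, t). F ((\<chi> j. if j = i then 0 else c j) + t *\<^sub>R axis i 1))"
    by (simp add: case_prod_unfold)
  have "(LINT y|lborel. F y) = (LINT x|((\<Pi>\<^sub>M j\<in>UNIV - {i}. lborel) \<Otimes>\<^sub>M lborel). F (?f x))"
    by (subst lborel_eq_slices[of i], rule integral_distr[OF measurable_slices]) simp
  also have "\<dots> = (LINT c|(\<Pi>\<^sub>M j\<in>UNIV - {i}. lborel). LINT t|lborel. F ((\<chi> j. if j = i then 0 else c j) + t *\<^sub>R axis i 1))"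
    using P2.integral_fst[OF int] by (simp add: case_prod_unfold)
  also have "\<dots> = (LINT z|hyperplane_lborel i. (LINT t|lborel. F (z + t *\<^sub>R axis i 1)))"
    unfolding hyperplane_lborel_def by (subst integral_distr) measurable
  finally show ?thesis .
qed

section \<open>A divergence inequality for smooth domains\<close>

definition grad :: "(real^'n \<Rightarrow> real) \<Rightarrow> real^'n \<Rightarrow> real^'n" where
  "grad f x = (\<chi> k. partial_deriv k f x)"

lemma partial_deriv_eqI:
  "(f has_derivative f') (at x) \<Longrightarrow> partial_deriv k f x = f' (axis k 1)"
  using frechet_derivative_at unfolding partial_deriv_def by metis

lemma has_derivative_grad:
  assumes "f differentiable (at x)"
  shows "(f has_derivative (\<lambda>h. grad f x \<bullet> h)) (at x)"
proof -
  let ?f = "frechet_derivative f (at x)"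
  have d: "(f has_derivative ?f) (at x)" using assms frechet_derivative_works by blast
  then have lin: "linear ?f" by (rule has_derivative_linear)
  have "?f h = grad f x \<bullet> h" for h
  proof -
    have "?f h = ?f (\<Sum>k\<in>UNIV. (h$k) *\<^sub>R axis k 1)"
      using basis_expansion[of h] by (simp add: scalar_mult_eq_scaleR)
    also have "\<dots> = (\<Sum>k\<in>UNIV. (h$k) * ?f (axis k 1))"
      using lin by (simp add: linear_sum linear_scale)
    finally show ?thesis by (simp add: grad_def inner_vec_def partial_deriv_def mult.commute)
  qed
  then have "?f = (\<lambda>h. grad f x \<bullet> h)" by (rule ext)
  then show ?thesis using d by metis
qed

lemma smooth_imp_differentiable: "smooth f \<Longrightarrow> f differentiable (at x)"
  unfolding smooth_def Ck_on_def iter_partial_def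
  by (metis foldr_Nil id_apply list.size(3) zero_less_one UNIV_I)

lemma smooth_imp_continuous_on_grad: "smooth f \<Longrightarrow> continuous_on S (grad f)"
proof -
  assume "smooth f"
  then have "Ck_on 1 UNIV f" by (simp add: smooth_def)
  then have "continuous_on UNIV (iter_partial [k] f)" for k
    by (auto simp: Ck_on_def)
  then have "continuous_on UNIV (partial_deriv k f)" for k
    by (simp add: iter_partial_def)
  then have "continuous_on UNIV (grad f)"
    unfolding grad_def by (intro continuous_on_vec_lambda) auto
  then show ?thesis by (rule continuous_on_subset) simp
qed

text \<open>Translation by v and its inverse both fix f, so the chain rule carries derivatives in
  both directions. The two points have the same set of derivatives, and the choice made by
  \<open>frechet_derivative\<close> agrees even if that set is empty. With v along the axis i this
  makes the gradient of a graph function constant along that axis.\<close>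

lemma partial_deriv_translate:
  fixes f :: "real^'n \<Rightarrow> real"
  assumes "\<And>y. f (y + v) = f y"
  shows "partial_deriv k f (x + v) = partial_deriv k f x"
proof -
  have "(f has_derivative f') (at (x + v)) \<longleftrightarrow> (f has_derivative f') (at x)" for f'
  proof -
    have *: "f \<circ> (\<lambda>y. y + v) = f" "f \<circ> (\<lambda>y. y - v) = f" using assms by (auto simp: fun_eq_iff) (metis diff_add_cancel)
    have 1: "((\<lambda>y. y + v) has_derivative (\<lambda>h. h)) (at x)"
      and 2: "((\<lambda>y. y - v) has_derivative (\<lambda>h. h)) (at (x + v))"
      by (auto intro!: derivative_eq_intros)
    show ?thesis
      using diff_chain_at[OF 1, of f f'] diff_chain_at[OF 2, of f f'] * by (auto simp: o_def)
  qed
  then show ?thesis by (simp add: partial_deriv_def frechet_derivative_def)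
qed

text \<open>The gradient is carried along as an explicit witness, so that products and compositions
  come with usable formulas for it.\<close>

definition C1_with :: "('a::euclidean_space \<Rightarrow> real) \<Rightarrow> ('a \<Rightarrow> 'a) \<Rightarrow> bool" where
  "C1_with \<phi> G \<longleftrightarrow> (\<forall>y. (\<phi> has_derivative (\<lambda>h. G y \<bullet> h)) (at y)) \<and> continuous_on UNIV G"

lemma C1_with_continuous: "C1_with \<phi> G \<Longrightarrow> continuous_on UNIV \<phi>"
  unfolding C1_with_def by (meson has_derivative_continuous continuous_at_imp_continuous_on)

lemma C1_with_mult:
  assumes "C1_with \<phi> G" "C1_with \<psi> H"
  shows "C1_with (\<lambda>y. \<phi> y * \<psi> y) (\<lambda>y. \<psi> y *\<^sub>R G y + \<phi> y *\<^sub>R H y)"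
  using assms C1_with_continuous[OF assms(1)] C1_with_continuous[OF assms(2)]
  unfolding C1_with_def
  by (auto intro!: derivative_eq_intros continuous_intros simp: inner_add_left algebra_simps)

lemma C1_with_zero:
  assumes "C1_with \<phi> G" "open U" "\<And>y. y \<in> U \<Longrightarrow> \<phi> y = 0" "y \<in> U"
  shows "G y = 0"
proof -
  have "(\<phi> has_derivative (\<lambda>h. 0)) (at y)"
    by (rule has_derivative_transform_within_open[of "\<lambda>_. 0" _ _ _ U]) (use assms in auto)
  then have "(\<lambda>h. G y \<bullet> h) = (\<lambda>h. 0)"
    using assms(1) has_derivative_unique unfolding C1_with_def by blast
  then show ?thesis by (metis inner_eq_zero_iff)
qed

lemma C1_with_along:
  assumes "C1_with \<phi> G" "(c has_vector_derivative c') (at t)"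
  shows "((\<lambda>t. \<phi> (c t)) has_real_derivative G (c t) \<bullet> c') (at t)"
proof -
  have "((\<lambda>t. \<phi> (c t)) has_derivative (\<lambda>h. G (c t) \<bullet> (h *\<^sub>R c'))) (at t)"
    using diff_chain_at[of c "\<lambda>h. h *\<^sub>R c'" t \<phi> "\<lambda>h. G (c t) \<bullet> h"] assms
    by (auto simp: C1_with_def has_vector_derivative_def o_def)
  then show ?thesis
    by (simp add: has_field_derivative_def mult.commute[of _ "G (c t) \<bullet> c'"])
qed

section \<open>The fundamental theorem of calculus on lines\<close>

text \<open>For s = 1 the half line is t > b, for s = -1 it is t < -b, and the factor -s is the
  orientation of its end point s b. The other end is cut off beyond the support of g, and open and
  closed intervals differ by a null set.\<close>

lemma integral_deriv_half_line:
  fixes g g' :: "real \<Rightarrow> real"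
  assumes d: "\<And>t. (g has_real_derivative g' t) (at t)" and c: "continuous_on UNIV g'"
    and z: "\<And>t. \<bar>t\<bar> > N \<Longrightarrow> g t = 0" and s: "s \<in> {1, -1}"
  shows "(LINT t|lborel. indicator {t. s * t > b} t * g' t) = - s * g (s * b)"
proof -
  \<comment> \<open>Beyond \<open>N + 1\<close> the function g vanishes (its hypothesis is strict,
    hence the 1), and \<open>M\<close> is at least |b|, so the truncated interval is not
    reversed.\<close>
  define M where "M = max (N + 1) \<bar>b\<bar>"
  have z': "g' t = 0" if "\<bar>t\<bar> > N" for t
    by (rule DERIV_local_const[OF d, of "\<bar>t\<bar> - N"]) (use that z in auto)
  have cont: "isCont g' x" for x using c by (simp add: continuous_on_eq_continuous_at)
  have [measurable]: "g' \<in> borel_measurable borel" using c by (rule borel_measurable_continuous_onI)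
  have NM: "N < M" "\<bar>b\<bar> \<le> M" by (auto simp: M_def)
  consider "s = 1" | "s = -1" using s by auto
  then show ?thesis
  proof cases
    case 1
    have "has_bochner_integral lborel (\<lambda>x. g' x * indicator {b..M} x) (g M - g b)"
      using has_bochner_integral_FTC_Icc_real[of b M g g'] d cont NM by auto
    then have "(LINT x|lborel. g' x * indicator {b..M} x) = - g b"
      using z[of M] NM by (simp add: has_bochner_integral_integral_eq)
    moreover have "(LINT t|lborel. indicator {t. s * t > b} t * g' t) = (LINT x|lborel. g' x * indicator {b..M} x)"
    proof (rule integral_cong_AE)
      show "AE x in lborel. indicator {t. s * t > b} x * g' x = g' x * indicator {b..M} x"
        using AE_lborel_singleton[of b]
        by eventually_elim (use 1 NM in \<open>auto simp: indicator_def intro!: z'\<close>)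
    qed measurable
    ultimately show ?thesis using 1 by simp
  next
    case 2
    have "has_bochner_integral lborel (\<lambda>x. g' x * indicator {-M..-b} x) (g (-b) - g (-M))"
      using has_bochner_integral_FTC_Icc_real[of "-M" "-b" g g'] d cont NM by auto
    then have "(LINT x|lborel. g' x * indicator {-M..-b} x) = g (-b)"
      using z[of "-M"] NM by (simp add: has_bochner_integral_integral_eq)
    moreover have "(LINT t|lborel. indicator {t. s * t > b} t * g' t) = (LINT x|lborel. g' x * indicator {-M..-b} x)"
    proof (rule integral_cong_AE)
      show "AE x in lborel. indicator {t. s * t > b} x * g' x = g' x * indicator {-M..-b} x"
        using AE_lborel_singleton[of "-b"]
        by eventually_elim (use 2 NM in \<open>auto simp: indicator_def intro!: z'\<close>)
    qed measurable
    ultimately show ?thesis using 2 by simp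
  qed
qed

lemma integral_deriv_line:
  fixes g g' :: "real \<Rightarrow> real"
  assumes d: "\<And>t. (g has_real_derivative g' t) (at t)" and c: "continuous_on UNIV g'"
    and z: "\<And>t. \<bar>t\<bar> > N \<Longrightarrow> g t = 0"
  shows "(LINT t|lborel. g' t) = 0"
proof -
  have z': "g' t = 0" if "\<bar>t\<bar> > N" for t
    by (rule DERIV_local_const[OF d, of "\<bar>t\<bar> - N"]) (use that z in auto)
  \<comment> \<open>The half line starts to the left of the support, so nothing is lost and the
    value of g at its end point is zero.\<close>
  have "(LINT t|lborel. g' t) = (LINT t|lborel. indicator {t. 1 * t > - (\<bar>N\<bar> + 1)} t * g' t)"
    by (rule Bochner_Integration.integral_cong) (auto simp: indicator_def intro!: z')
  then show ?thesis
    using integral_deriv_half_line[OF assms, where s = 1 and b = "- (\<bar>N\<bar> + 1)"] z by simp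
qed

lemma integrable_compact_support:
  fixes f :: "'a::euclidean_space \<Rightarrow> real"
  assumes "continuous_on UNIV f" "\<And>y. y \<notin> cball p r \<Longrightarrow> f y = 0"
  shows "integrable lborel f"
proof -
  have "integrable lborel (\<lambda>x. indicator (cball p r) x *\<^sub>R f x)"
    by (rule borel_integrable_compact) (auto intro: continuous_on_subset[OF assms(1)])
  also have "(\<lambda>x. indicator (cball p r) x *\<^sub>R f x) = f"
    using assms(2) by (auto simp: indicator_def fun_eq_iff)
  finally show ?thesis .
qed

section \<open>Flux through a smooth graph\<close>

text \<open>On a line parallel to the axis i the function \<gamma> is constant, so there the shear
  is a translation; Fubini and translation invariance on each line give the claim.\<close>

lemma distr_lborel_shear:
  fixes \<gamma> :: "real^'n \<Rightarrow> real"
  assumes c: "continuous_on UNIV \<gamma>" and inv: "\<And>x t. \<gamma> (x + t *\<^sub>R axis i 1) = \<gamma> x"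
  shows "distr lborel borel (\<lambda>z. z + (s * \<gamma> z) *\<^sub>R axis i 1) = lborel"
proof (rule measure_eqI)
  fix A :: "(real^'n) set" assume "A \<in> sets (distr lborel borel (\<lambda>z. z + (s * \<gamma> z) *\<^sub>R axis i 1))"
  then have [measurable]: "A \<in> sets borel" by simp
  have [measurable]: "\<gamma> \<in> borel_measurable borel" using c by (rule borel_measurable_continuous_onI)
  have "emeasure (distr lborel borel (\<lambda>z. z + (s * \<gamma> z) *\<^sub>R axis i 1)) A
      = (\<integral>\<^sup>+ y. indicator A y \<partial>distr lborel borel (\<lambda>z. z + (s * \<gamma> z) *\<^sub>R axis i 1))"
    by simp
  also have "\<dots> = (\<integral>\<^sup>+ y. indicator A (y + (s * \<gamma> y) *\<^sub>R axis i 1) \<partial>lborel)"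
    by (rule nn_integral_distr) measurable
  also have "\<dots> = (\<integral>\<^sup>+ z. (\<integral>\<^sup>+ t. indicator A (z + t *\<^sub>R axis i 1 + (s * \<gamma> z) *\<^sub>R axis i 1) \<partial>lborel) \<partial>hyperplane_lborel i)"
    by (subst nn_integral_slices[of _ i]) (measurable, simp add: inv)
  also have "\<dots> = (\<integral>\<^sup>+ z. (\<integral>\<^sup>+ t. indicator A (z + t *\<^sub>R axis i 1) \<partial>lborel) \<partial>hyperplane_lborel i)"
  proof (rule nn_integral_cong)
    fix z
    show "(\<integral>\<^sup>+ t. indicator A (z + t *\<^sub>R axis i 1 + (s * \<gamma> z) *\<^sub>R axis i 1) \<partial>lborel) =
       (\<integral>\<^sup>+ t. indicator A (z + t *\<^sub>R axis i 1) \<partial>lborel)"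
      by (subst (2) nn_integral_real_affine[of _ 1 "s * \<gamma> z"])
         (auto simp: algebra_simps intro!: nn_integral_cong)
  qed
  also have "\<dots> = (\<integral>\<^sup>+ y. indicator A y \<partial>lborel)"
    by (rule nn_integral_slices[symmetric]) measurable
  finally show "emeasure (distr lborel borel (\<lambda>z. z + (s * \<gamma> z) *\<^sub>R axis i 1)) A = emeasure lborel A"
    by simp
qed simp

lemma C1_with_continuous_nth: "C1_with \<phi> G \<Longrightarrow> continuous_on UNIV (\<lambda>y. G y $ j)"
  unfolding C1_with_def by (auto intro!: continuous_intros)

lemma C1_with_zero_cball:
  assumes "C1_with \<phi> G" "\<And>y. y \<notin> cball p \<rho> \<Longrightarrow> \<phi> y = 0" "y \<notin> cball p \<rho>"
  shows "G y = 0"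
  by (rule C1_with_zero[OF assms(1), of "- cball p \<rho>"]) (use assms in \<open>auto simp: open_Compl\<close>)

lemma not_in_cball_far:
  fixes z :: "real^'n"
  assumes "\<bar>y $ j\<bar> > norm p + \<rho>"
  shows "y \<notin> cball p \<rho>"
  using component_le_norm_cart[of y j] norm_triangle_ineq2[of y p] assms
  by (auto simp: dist_norm norm_minus_commute)

text \<open>Each line parallel to the axis i meets the region in a half line ending on the graph,
  where the one-dimensional fundamental theorem leaves the value of \<phi>. The weight a is constant
  on the line and passes through. Two weights are used later: 1, and a partial derivative of
  \<gamma>.\<close>

lemma flux_vertical:
  fixes \<phi> a \<gamma> :: "real^'n \<Rightarrow> real"
  assumes s: "s \<in> {1, -1}" and \<gamma>: "continuous_on UNIV \<gamma>" "\<And>x t. \<gamma> (x + t *\<^sub>R axis i 1) = \<gamma> x"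
    and a: "continuous_on UNIV a" "\<And>x t. a (x + t *\<^sub>R axis i 1) = a x"
    and \<phi>: "C1_with \<phi> G" "\<And>y. y \<notin> cball p \<rho> \<Longrightarrow> \<phi> y = 0"
  shows "(LINT y|lborel. indicator {y. s * (y $ i) > \<gamma> y} y * (a y * G y $ i)) =
     - s * (LINT z|hyperplane_lborel i. a z * \<phi> (z + (s * \<gamma> z) *\<^sub>R axis i 1))"
proof -
  let ?E = "{y. s * (y $ i) > \<gamma> y}"
  let ?F = "\<lambda>z. LINT t|lborel. indicator ?E (z + t *\<^sub>R axis i 1) * (a (z + t *\<^sub>R axis i 1) * G (z + t *\<^sub>R axis i 1) $ i)"
  have G0: "G y = 0" if "y \<notin> cball p \<rho>" for y
    by (rule C1_with_zero_cball[OF \<phi>(1), of p \<rho>]) (use \<phi>(2) that in auto)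
  note cG = C1_with_continuous_nth[OF \<phi>(1)]
  have [measurable]: "\<gamma> \<in> borel_measurable borel" "a \<in> borel_measurable borel"
    "\<phi> \<in> borel_measurable borel" "(\<lambda>y. G y $ i) \<in> borel_measurable borel"
    using \<gamma>(1) a(1) C1_with_continuous[OF \<phi>(1)] cG by (auto intro: borel_measurable_continuous_onI)
  have int: "integrable lborel (\<lambda>y. indicator ?E y *\<^sub>R (a y * G y $ i))"
  proof (rule integrable_mult_indicator)
    show "integrable lborel (\<lambda>y. a y * G y $ i)"
      by (rule integrable_compact_support[where p = p and r = \<rho>]) (auto intro: continuous_on_mult a cG simp: G0)
  qed measurable
  have inner: "?F z =
      - s * (a z * \<phi> (z + (s * \<gamma> z) *\<^sub>R axis i 1))" if z: "z $ i = 0" for z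
  proof -
    let ?g = "\<lambda>t. a z * \<phi> (z + t *\<^sub>R axis i 1)"
    let ?g' = "\<lambda>t. a z * G (z + t *\<^sub>R axis i 1) $ i"
    have nth: "(z + t *\<^sub>R axis i 1) $ i = t" for t using z by (simp add: axis_def)
    have "(LINT t|lborel. indicator {t. s * t > \<gamma> z} t * ?g' t) = - s * ?g (s * \<gamma> z)"
    proof (rule integral_deriv_half_line[where N = "norm p + \<rho>"])
      show "(?g has_real_derivative ?g' t) (at t)" for t
        by (rule DERIV_cmult, rule C1_with_along[OF \<phi>(1), THEN DERIV_cong])
           (auto intro!: derivative_eq_intros simp: inner_axis)
      show "continuous_on UNIV ?g'"
        by (intro continuous_intros continuous_on_compose2[OF cG]) auto
      show "?g t = 0" if "\<bar>t\<bar> > norm p + \<rho>" for t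
        using not_in_cball_far[where y = "z + t *\<^sub>R axis i 1" and j = i] that nth \<phi>(2) by simp
    qed (rule s)
    moreover have "indicator ?E (z + t *\<^sub>R axis i 1) = (indicator {t. s * t > \<gamma> z} t :: real)" for t
      using \<gamma>(2) nth[of t] by (simp add: indicator_def)
    ultimately show ?thesis by (simp add: a(2))
  qed
  have "(LINT y|lborel. indicator ?E y * (a y * G y $ i)) =
    (LINT z|hyperplane_lborel i. ?F z)"
    using integral_slices[OF int, of i] by simp
  also have "\<dots> = (LINT z|hyperplane_lborel i. - s * (a z * \<phi> (z + (s * \<gamma> z) *\<^sub>R axis i 1)))"
  proof (rule integral_cong_AE)
    show "?F
      \<in> borel_measurable (hyperplane_lborel i)"
      by (intro lborel.borel_measurable_lebesgue_integral) measurable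
    show "AE z in hyperplane_lborel i. ?F z =
      - s * (a z * \<phi> (z + (s * \<gamma> z) *\<^sub>R axis i 1))"
      using AE_hyperplane_lborel[of i] by eventually_elim (rule inner)
  qed measurable
  finally show ?thesis by simp
qed

text \<open>The shear along the \<open>i\<close>-th axis straightens the graph; the combination below is the derivative of the
  sheared function in direction \<open>j\<close>, along lines that stay on one side of the boundary.\<close>

lemma flux_tangential:
  fixes \<phi> \<gamma> :: "real^'n \<Rightarrow> real"
  assumes s: "s \<in> {1, -1}" and \<gamma>: "C1_with \<gamma> D" "\<And>x t. \<gamma> (x + t *\<^sub>R axis i 1) = \<gamma> x"
    and \<phi>: "C1_with \<phi> G" "\<And>y. y \<notin> cball p \<rho> \<Longrightarrow> \<phi> y = 0" and ji: "j \<noteq> i"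
    and D: "\<And>x t. D (x + t *\<^sub>R axis i 1) = D x"
  shows "(LINT y|lborel. indicator {y. s * (y $ i) > \<gamma> y} y * (G y $ j + s * D y $ j * G y $ i)) = 0"
proof -
  let ?E = "{y. s * (y $ i) > \<gamma> y}"
  let ?\<Phi> = "\<lambda>z. z + (s * \<gamma> z) *\<^sub>R axis i 1"
  let ?f = "\<lambda>y. G y $ j + s * D y $ j * G y $ i"
  have G0: "G y = 0" if "y \<notin> cball p \<rho>" for y
    by (rule C1_with_zero_cball[OF \<phi>(1), of p \<rho>]) (use \<phi>(2) that in auto)
  note cG = C1_with_continuous_nth[OF \<phi>(1)] and cD = C1_with_continuous_nth[OF \<gamma>(1)]
    and c\<gamma> = C1_with_continuous[OF \<gamma>(1)]
  have cf: "continuous_on UNIV ?f" by (intro continuous_intros cG cD)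
  have c\<Phi>: "continuous_on UNIV ?\<Phi>" by (intro continuous_intros c\<gamma>)
  have [measurable]: "\<gamma> \<in> borel_measurable borel" "?f \<in> borel_measurable borel" "?\<Phi> \<in> borel_measurable borel"
    using c\<gamma> cf c\<Phi> by (auto intro: borel_measurable_continuous_onI)
  have int: "integrable lborel (\<lambda>y. indicator ?E y *\<^sub>R ?f y)"
  proof (rule integrable_mult_indicator)
    show "integrable lborel ?f"
      by (rule integrable_compact_support[OF cf, where p = p and r = \<rho>]) (simp add: G0)
  qed measurable
  have dl: "lborel = distr lborel borel ?\<Phi>" using distr_lborel_shear[OF c\<gamma> \<gamma>(2)] by simp
  \<comment> \<open>Since s^2 = 1, the shear maps the half space s z_i > 0 onto the region above the
    graph. Membership in the half space does not change along direction j, as j differs from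
    i.\<close>
  have ind: "indicator ?E (?\<Phi> z) = (indicator {z. s * (z $ i) > 0} z :: real)" for z
  proof -
    have "?\<Phi> z $ i = z $ i + s * \<gamma> z" by (simp add: axis_def)
    then show ?thesis using s unfolding indicator_def mem_Collect_eq \<gamma>(2) by (auto simp: algebra_simps)
  qed
  have "(LINT y|lborel. indicator ?E y *\<^sub>R ?f y) = (LINT z|lborel. indicator ?E (?\<Phi> z) *\<^sub>R ?f (?\<Phi> z))"
    by (subst dl, rule integral_distr) measurable
  also have "\<dots> = (LINT z|hyperplane_lborel j. LINT t|lborel.
       indicator ?E (?\<Phi> (z + t *\<^sub>R axis j 1)) *\<^sub>R ?f (?\<Phi> (z + t *\<^sub>R axis j 1)))"
  proof (rule integral_slices)
    show "integrable lborel (\<lambda>z. indicator ?E (?\<Phi> z) *\<^sub>R ?f (?\<Phi> z))"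
      using int by (subst (asm) dl, subst (asm) integrable_distr_eq) auto
  qed
  also have "\<dots> = (LINT z|hyperplane_lborel j. 0)"
  proof (rule Bochner_Integration.integral_cong[OF refl])
    fix z :: "real^'n"
    let ?c = "\<lambda>t. ?\<Phi> (z + t *\<^sub>R axis j 1)"
    have "(LINT t|lborel. ?f (?c t)) = 0"
    proof (rule integral_deriv_line[where N = "norm p + \<rho> + \<bar>z $ j\<bar>"])
      fix t
      have "((\<lambda>t. \<gamma> (z + t *\<^sub>R axis j 1)) has_real_derivative D (z + t *\<^sub>R axis j 1) $ j) (at t)"
        by (rule C1_with_along[OF \<gamma>(1), THEN DERIV_cong])
           (auto intro!: derivative_eq_intros simp: inner_axis)
      then have "(?c has_vector_derivative (axis j 1 + (s * D (z + t *\<^sub>R axis j 1) $ j) *\<^sub>R axis i 1)) (at t)"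
        by (auto intro!: derivative_eq_intros simp: has_real_derivative_iff_has_vector_derivative)
      \<comment> \<open>The shear moves points along the axis i only, where \<open>D\<close> is
        constant, so the coefficient may be evaluated at the point of the curve.\<close>
      moreover have "D (z + t *\<^sub>R axis j 1) = D (?c t)" by (simp only: D)
      ultimately have "(?c has_vector_derivative (axis j 1 + (s * D (?c t) $ j) *\<^sub>R axis i 1)) (at t)"
        by metis
      from C1_with_along[OF \<phi>(1) this]
      show "((\<lambda>t. \<phi> (?c t)) has_real_derivative ?f (?c t)) (at t)"
        by (rule DERIV_cong) (simp add: inner_add_right inner_axis)
    next
      show "continuous_on UNIV (\<lambda>t. ?f (?c t))"
        by (rule continuous_on_compose2[OF cf]) (auto intro!: continuous_intros continuous_on_compose2[OF c\<gamma>])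
    next
      fix t :: real assume "\<bar>t\<bar> > norm p + \<rho> + \<bar>z $ j\<bar>"
      moreover have "?c t $ j = z $ j + t" using ji by (simp add: axis_def)
      ultimately show "\<phi> (?c t) = 0"
        by (intro \<phi>(2) not_in_cball_far[where j = j]) linarith
    qed
    moreover have "indicator ?E (?c t) = (indicator {z. s * (z $ i) > 0} z :: real)" for t
      unfolding ind using ji by (simp add: indicator_def axis_def)
    ultimately show "(LINT t|lborel. indicator ?E (?c t) *\<^sub>R ?f (?c t)) = 0"
      by (simp only: integral_scaleR_right) simp
  qed
  finally show ?thesis by simp
qed

section \<open>Surface integrals in a chart\<close>

text \<open>The chart formula speaks only of sets inside the ball. Both S and the image of the
  weighted hyperplane measure are therefore multiplied by the indicator of the ball; the results
  agree on all Borel sets, and f does not see the cut.\<close>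

lemma nn_integral_surface_measure:
  fixes f :: "real^'n \<Rightarrow> ennreal"
  assumes S: "is_surface_measure \<Omega> S" and ch: "graph_chart \<Omega> p r i s \<gamma>"
    and [measurable]: "f \<in> borel_measurable borel" and f0: "\<And>y. y \<notin> ball p r \<Longrightarrow> f y = 0"
  shows "(\<integral>\<^sup>+ y. f y \<partial>S) = (\<integral>\<^sup>+ z. f (z + (s * \<gamma> z) *\<^sub>R axis i 1) *
     ennreal (sqrt (1 + (\<Sum>j\<in>UNIV. (partial_deriv j \<gamma> z)\<^sup>2))) \<partial>hyperplane_lborel i)"
proof -
  let ?w = "\<lambda>z. ennreal (sqrt (1 + (\<Sum>j\<in>UNIV. (partial_deriv j \<gamma> z)\<^sup>2)))"
  let ?\<Phi> = "\<lambda>z. z + (s * \<gamma> z) *\<^sub>R axis i 1"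
  have sm: "smooth \<gamma>" using ch by (simp add: graph_chart_def)
  have sS[measurable_cong]: "sets S = sets borel" using S by (simp add: is_surface_measure_def)
  have c\<gamma>: "continuous_on UNIV \<gamma>"
    using smooth_imp_differentiable[OF sm] by (meson differentiable_imp_continuous_within continuous_at_imp_continuous_on)
  have "continuous_on UNIV (\<lambda>z. grad \<gamma> z $ j)" for j
    by (intro continuous_intros smooth_imp_continuous_on_grad[OF sm])
  then have [measurable]: "partial_deriv j \<gamma> \<in> borel_measurable borel" for j
    by (auto simp: grad_def intro: borel_measurable_continuous_onI)
  have [measurable]: "\<gamma> \<in> borel_measurable borel" "?\<Phi> \<in> borel_measurable borel"
    by (intro borel_measurable_continuous_onI continuous_intros c\<gamma>)+
  let ?N = "distr (density (hyperplane_lborel i) ?w) borel ?\<Phi>"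
  have ball[simp]: "(indicator (ball p r) :: _ \<Rightarrow> ennreal) \<in> borel_measurable borel"
    by (intro borel_measurable_indicator borel_open open_ball)
  have ballS[simp]: "(indicator (ball p r) :: _ \<Rightarrow> ennreal) \<in> borel_measurable S"
    by (intro borel_measurable_indicator) (simp add: sS)
  have eq: "density S (indicator (ball p r)) = density ?N (indicator (ball p r))"
  proof (rule measure_eqI)
    fix A assume "A \<in> sets (density S (indicator (ball p r)))"
    then have A[measurable]: "A \<in> sets borel" by (simp add: sS)
    have ind: "indicator (A \<inter> ball p r) \<in> borel_measurable (borel :: (real^'n) measure)"
      by (rule borel_measurable_indicator, rule sets.Int, rule A, rule borel_open, rule open_ball)
    have "emeasure (density S (indicator (ball p r))) A = emeasure S (A \<inter> ball p r)"
    proof -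
      have "emeasure (density S (indicator (ball p r))) A = (\<integral>\<^sup>+ y. indicator (ball p r) y * indicator A y \<partial>S)"
        by (rule emeasure_density) (auto simp: sS intro!: borel_measurable_indicator)
      also have "\<dots> = (\<integral>\<^sup>+ y. indicator (A \<inter> ball p r) y \<partial>S)"
        by (rule nn_integral_cong) (auto simp: indicator_def)
      also have "\<dots> = emeasure S (A \<inter> ball p r)"
        by (rule nn_integral_indicator) (simp add: sS)
      finally show ?thesis .
    qed
    also have "\<dots> = (\<integral>\<^sup>+ z. indicator (A \<inter> ball p r) (?\<Phi> z) * ?w z \<partial>hyperplane_lborel i)"
      using S ch unfolding is_surface_measure_def by auto
    also have "\<dots> = (\<integral>\<^sup>+ z. indicator (A \<inter> ball p r) (?\<Phi> z) \<partial>density (hyperplane_lborel i) ?w)"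
    proof -
      have "(\<lambda>z. indicator (A \<inter> ball p r) (?\<Phi> z) :: ennreal) \<in> borel_measurable (hyperplane_lborel i)"
        by (rule measurable_compose[OF _ ind]) measurable
      then show ?thesis
        by (subst nn_integral_density, measurable) (simp_all only: mult.commute)
    qed
    also have "\<dots> = (\<integral>\<^sup>+ y. indicator (A \<inter> ball p r) y \<partial>?N)"
      by (subst nn_integral_distr) (auto simp: ind)
    also have "\<dots> = emeasure (density ?N (indicator (ball p r))) A"
      by (subst emeasure_density) (auto simp: mult.commute simp flip: indicator_inter_arith intro!: nn_integral_cong split: split_indicator)
    finally show "emeasure (density S (indicator (ball p r))) A = emeasure (density ?N (indicator (ball p r))) A" .
  qed (simp add: sS)
  have [measurable]: "f \<in> borel_measurable S" by measurable
  have if0: "indicator (ball p r) y * f y = f y" for y using f0 by (auto simp: indicator_def)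
  have "(\<integral>\<^sup>+ y. f y \<partial>S) = (\<integral>\<^sup>+ y. f y \<partial>density S (indicator (ball p r)))"
    by (subst nn_integral_density) (auto simp: if0 sS)
  also have "\<dots> = (\<integral>\<^sup>+ y. f y \<partial>?N)"
    unfolding eq by (subst nn_integral_density) (auto simp: if0)
  also have "\<dots> = (\<integral>\<^sup>+ z. f (?\<Phi> z) \<partial>density (hyperplane_lborel i) ?w)"
    by (subst nn_integral_distr) auto
  also have "\<dots> = (\<integral>\<^sup>+ z. f (?\<Phi> z) * ?w z \<partial>hyperplane_lborel i)"
    by (subst nn_integral_density) (auto simp: mult.commute)
  finally show ?thesis .
qed

text \<open>A nonintegrable function has Bochner integral 0, so the bound persists in that
  case.\<close>

lemma ennreal_abs_integral_le:
  fixes f :: "'a \<Rightarrow> real"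
  shows "ennreal \<bar>LINT x|M. f x\<bar> \<le> (\<integral>\<^sup>+ x. ennreal \<bar>f x\<bar> \<partial>M)"
  by (cases "integrable M f") (use integral_norm_bound_ennreal[of M f] in \<open>auto simp: not_integrable_integral_eq\<close>)

text \<open>The area density dominates 1 and every |partial derivative of \<gamma>|, that is, every
  component of the unnormalised normal to the graph. Bounding the component by the density turns the
  exact flux formula into the inequality.\<close>

lemma divergence_bound_chart:
  fixes \<phi> :: "real^'n \<Rightarrow> real"
  assumes S: "is_surface_measure \<Omega> S" and ch: "graph_chart \<Omega> p r i s \<gamma>"
    and \<phi>: "C1_with \<phi> G" "\<And>y. y \<notin> cball p \<rho> \<Longrightarrow> \<phi> y = 0" and \<rho>: "\<rho> < r"
  shows "ennreal \<bar>LINT y|lborel. indicator \<Omega> y * G y $ j\<bar> \<le> (\<integral>\<^sup>+ y. ennreal \<bar>\<phi> y\<bar> \<partial>S)"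
proof -
  let ?E = "{y. s * (y $ i) > \<gamma> y}"
  let ?\<Phi> = "\<lambda>z. z + (s * \<gamma> z) *\<^sub>R axis i 1"
  let ?w = "\<lambda>z. sqrt (1 + (\<Sum>j\<in>UNIV. (partial_deriv j \<gamma> z)\<^sup>2))"
  let ?D = "grad \<gamma>"
  have s: "s \<in> {1, -1}" and sm: "smooth \<gamma>" and inv: "\<And>x t. \<gamma> (x + t *\<^sub>R axis i 1) = \<gamma> x"
    and Om: "\<Omega> \<inter> ball p r = {x \<in> ball p r. s * (x $ i) > \<gamma> x}"
    using ch by (auto simp: graph_chart_def)
  have C\<gamma>: "C1_with \<gamma> ?D"
    unfolding C1_with_def
    using has_derivative_grad[OF smooth_imp_differentiable[OF sm]] smooth_imp_continuous_on_grad[OF sm] by blast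
  have D: "?D (x + t *\<^sub>R axis i 1) = ?D x" for x t
    unfolding grad_def using partial_deriv_translate[of \<gamma> "t *\<^sub>R axis i 1"] inv by simp
  have G0: "G y = 0" if "y \<notin> cball p \<rho>" for y
    by (rule C1_with_zero_cball[OF \<phi>(1), of p \<rho>]) (use \<phi>(2) that in auto)
  note cG = C1_with_continuous_nth[OF \<phi>(1)] and cD = C1_with_continuous_nth[OF C\<gamma>]
    and c\<gamma> = C1_with_continuous[OF C\<gamma>]
  have [measurable]: "\<phi> \<in> borel_measurable borel" "\<gamma> \<in> borel_measurable borel"
    "(\<lambda>y. G y $ k) \<in> borel_measurable borel" "(\<lambda>y. ?D y $ k) \<in> borel_measurable borel" for k
    using C1_with_continuous[OF \<phi>(1)] c\<gamma> cG cD by (auto intro: borel_measurable_continuous_onI)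
  \<comment> \<open>\<open>G\<close> vanishes outside the smaller ball, so the domain may be
    replaced by the full region above the graph.\<close>
  have IE: "indicator \<Omega> y * G y $ j = indicator ?E y * G y $ j" for y
  proof (cases "y \<in> ball p r")
    case True
    then have "y \<in> \<Omega> \<longleftrightarrow> y \<in> ?E" using Om by blast
    then show ?thesis by (simp add: indicator_def)
  next
    case False
    then have "G y = 0" using \<rho> by (intro G0) auto
    then show ?thesis by simp
  qed
  have w: "\<bar>?D z $ k\<bar> \<le> ?w z" "1 \<le> ?w z" for z k
  proof -
    have "(?D z $ k)\<^sup>2 \<le> (\<Sum>j\<in>UNIV. (partial_deriv j \<gamma> z)\<^sup>2)"
      unfolding grad_def using member_le_sum[of k UNIV "\<lambda>j. (partial_deriv j \<gamma> z)\<^sup>2"] by simp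
    then show "\<bar>?D z $ k\<bar> \<le> ?w z" by (intro real_le_rsqrt) simp
    show "1 \<le> ?w z" by (simp add: sum_nonneg)
  qed
  \<comment> \<open>For j = i the weight is 1. Otherwise the vanishing tangential combination
    expresses the j-th flux through the i-th one, and the weight is the j-th partial derivative of
    \<gamma>; the two factors s cancel.\<close>
  have "\<exists>a. continuous_on UNIV a \<and> (\<forall>z. \<bar>a z\<bar> \<le> ?w z) \<and>
     \<bar>LINT y|lborel. indicator ?E y * G y $ j\<bar> = \<bar>LINT z|hyperplane_lborel i. a z * \<phi> (?\<Phi> z)\<bar>"
  proof (cases "j = i")
    case True
    have "(LINT y|lborel. indicator ?E y * (1 * G y $ i)) = - s * (LINT z|hyperplane_lborel i. 1 * \<phi> (?\<Phi> z))"
      by (rule flux_vertical[OF s c\<gamma> inv _ _ \<phi>]) auto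
    then show ?thesis using True s w by (intro exI[of _ "\<lambda>_. 1"]) (auto simp: abs_mult)
  next
    case False
    have int: "integrable lborel (\<lambda>y. indicator ?E y *\<^sub>R (a y * G y $ k))" if "continuous_on UNIV a" for a k
    proof (rule integrable_mult_indicator)
      show "integrable lborel (\<lambda>y. a y * G y $ k)"
        by (rule integrable_compact_support[where p = p and r = \<rho>]) (auto intro: continuous_on_mult that cG simp: G0)
    qed measurable
    have "0 = (LINT y|lborel. indicator ?E y * (G y $ j + s * ?D y $ j * G y $ i))"
      by (rule flux_tangential[OF s C\<gamma> inv \<phi> False D, symmetric])
    also have "\<dots> = (LINT y|lborel. indicator ?E y * (1 * G y $ j) + s * (indicator ?E y * (?D y $ j * G y $ i)))"
      by (simp add: algebra_simps)
    also have "\<dots> = (LINT y|lborel. indicator ?E y * G y $ j) + s * (LINT y|lborel. indicator ?E y * (?D y $ j * G y $ i))"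
      using int[of "\<lambda>_. 1" j] int[of "\<lambda>y. ?D y $ j" i] cD by simp
    also have "(LINT y|lborel. indicator ?E y * (?D y $ j * G y $ i)) = - s * (LINT z|hyperplane_lborel i. ?D z $ j * \<phi> (?\<Phi> z))"
      by (rule flux_vertical[OF s c\<gamma> inv _ _ \<phi>]) (auto simp: D cD)
    finally have "(LINT y|lborel. indicator ?E y * G y $ j) = (LINT z|hyperplane_lborel i. ?D z $ j * \<phi> (?\<Phi> z))"
      using s by auto
    then show ?thesis using w cD by (intro exI[of _ "\<lambda>z. ?D z $ j"]) auto
  qed
  then obtain a where a: "continuous_on UNIV a" "\<And>z. \<bar>a z\<bar> \<le> ?w z"
     "\<bar>LINT y|lborel. indicator ?E y * G y $ j\<bar> = \<bar>LINT z|hyperplane_lborel i. a z * \<phi> (?\<Phi> z)\<bar>"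
    by blast
  have "ennreal \<bar>LINT y|lborel. indicator \<Omega> y * G y $ j\<bar> \<le> (\<integral>\<^sup>+ z. ennreal \<bar>a z * \<phi> (?\<Phi> z)\<bar> \<partial>hyperplane_lborel i)"
    unfolding IE a(3) by (rule ennreal_abs_integral_le)
  also have "\<dots> \<le> (\<integral>\<^sup>+ z. ennreal \<bar>\<phi> (?\<Phi> z)\<bar> * ennreal (?w z) \<partial>hyperplane_lborel i)"
  proof (rule nn_integral_mono)
    fix z
    have "\<bar>a z * \<phi> (?\<Phi> z)\<bar> \<le> \<bar>\<phi> (?\<Phi> z)\<bar> * ?w z"
      using mult_right_mono[OF a(2)[of z], of "\<bar>\<phi> (?\<Phi> z)\<bar>"] by (simp add: abs_mult mult.commute)
    then show "ennreal \<bar>a z * \<phi> (?\<Phi> z)\<bar> \<le> ennreal \<bar>\<phi> (?\<Phi> z)\<bar> * ennreal (?w z)"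
      using w(2)[of z] by (subst ennreal_mult[symmetric]) (auto intro: ennreal_leI)
  qed
  also have "\<dots> = (\<integral>\<^sup>+ y. ennreal \<bar>\<phi> y\<bar> \<partial>S)"
  proof (rule nn_integral_surface_measure[OF S ch, symmetric])
    show "ennreal \<bar>\<phi> y\<bar> = 0" if "y \<notin> ball p r" for y
      using \<phi>(2)[of y] that \<rho> by simp
  qed measurable
  finally show ?thesis .
qed

lemma C1_with_compose:
  assumes \<phi>: "C1_with \<phi> G" and k: "\<And>y. (k has_real_derivative k' (\<phi> y)) (at (\<phi> y))"
    and c: "continuous_on (range \<phi>) k'"
  shows "C1_with (\<lambda>y. k (\<phi> y)) (\<lambda>y. k' (\<phi> y) *\<^sub>R G y)"
  unfolding C1_with_def
proof (intro conjI allI)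
  fix y
  have "((\<lambda>y. k (\<phi> y)) has_derivative (\<lambda>h. (G y \<bullet> h) * k' (\<phi> y))) (at y)"
    using diff_chain_at[of \<phi> "\<lambda>h. G y \<bullet> h" y k "\<lambda>x. x * k' (\<phi> y)"] \<phi> k[of y]
    by (simp add: C1_with_def has_field_derivative_def o_def mult_commute_abs mult.commute[of _ "k' (\<phi> y)"])
  then show "((\<lambda>y. k (\<phi> y)) has_derivative (\<lambda>h. (k' (\<phi> y) *\<^sub>R G y) \<bullet> h)) (at y)"
    by (simp add: mult.commute)
  show "continuous_on UNIV (\<lambda>y. k' (\<phi> y) *\<^sub>R G y)"
    using \<phi> unfolding C1_with_def
    by (intro continuous_intros continuous_on_compose2[OF c C1_with_continuous[OF \<phi>]]) auto
qed

lemma C1_with_norm_square: "C1_with (\<lambda>y. (norm (y - p))\<^sup>2) (\<lambda>y. 2 *\<^sub>R (y - p))"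
  unfolding C1_with_def power2_norm_eq_inner
  by (auto intro!: derivative_eq_intros continuous_intros simp: inner_commute)

section \<open>Cutoff functions\<close>

text \<open>The squared positive part is the building block of a C^1 cutoff: it vanishes exactly on
  the nonpositive half line and has a continuous derivative.\<close>

lemma DERIV_max0_square: "((\<lambda>x. (max 0 x)\<^sup>2) has_real_derivative 2 * max 0 x) (at x)"
proof -
  consider "x > 0" | "x < 0" | "x = 0" by linarith
  then show ?thesis
  proof cases
    case 1
    show ?thesis
      by (rule DERIV_cong[OF has_field_derivative_transform_within_open[of "\<lambda>x. x\<^sup>2" _ _ "{0<..}"]])
         (use 1 in \<open>auto intro!: derivative_eq_intros\<close>)
  next
    case 2
    show ?thesis
      by (rule DERIV_cong[OF has_field_derivative_transform_within_open[of "\<lambda>x. 0" _ _ "{..<0}"]])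
         (use 2 in \<open>auto intro!: derivative_eq_intros\<close>)
  next
    case 3
    \<comment> \<open>For nonzero h the difference quotient of the square at 0 is
      \<open>max 0 h\<close> itself.\<close>
    have "((\<lambda>h::real. max 0 h) \<longlongrightarrow> 0) (at 0)"
      by (rule tendsto_eq_intros | simp)+
    then have "((\<lambda>h. ((max 0 (0 + h))\<^sup>2 - (max 0 0)\<^sup>2) / h) \<longlongrightarrow> (0::real)) (at 0)"
      by (rule Lim_transform_eventually) (auto simp: eventually_at_filter max_def power2_eq_square)
    then show ?thesis using 3 by (simp add: DERIV_def)
  qed
qed

text \<open>With d the squared distance to p, the quotient m(\<rho>^2 - d) / (m(\<rho>^2 - d) + m(d
  - \<rho>^2/4)) is 1 up to \<rho>/2 and 0 from \<rho> on. Its denominator is positive because the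
  two terms never vanish together.\<close>

lemma C1_cutoff:
  assumes "\<rho> > 0"
  obtains \<eta> :: "'a::euclidean_space \<Rightarrow> real" and E where "C1_with \<eta> E" "\<And>y. 0 \<le> \<eta> y" "\<And>y. \<eta> y \<le> 1"
    "\<And>y. y \<in> ball p (\<rho>/2) \<Longrightarrow> \<eta> y = 1" "\<And>y. y \<notin> cball p \<rho> \<Longrightarrow> \<eta> y = 0"
proof -
  define m where "m x = (max 0 x)\<^sup>2" for x :: real
  define k where "k d = m (\<rho>\<^sup>2 - d) / (m (\<rho>\<^sup>2 - d) + m (d - (\<rho>/2)\<^sup>2))" for d
  have m_pos: "m x > 0 \<longleftrightarrow> x > 0" "m x \<ge> 0" "x \<le> 0 \<Longrightarrow> m x = 0" for x
    by (auto simp: m_def max_def)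
  have \<rho>4: "(\<rho>/2)\<^sup>2 < \<rho>\<^sup>2" using assms by (simp add: power2_eq_square)
  have den: "m (\<rho>\<^sup>2 - d) + m (d - (\<rho>/2)\<^sup>2) > 0" for d
  proof (cases "d < \<rho>\<^sup>2")
    case True
    then show ?thesis using m_pos(1)[of "\<rho>\<^sup>2 - d"] m_pos(2)[of "d - (\<rho>/2)\<^sup>2"] by simp
  next
    case False
    then show ?thesis using m_pos(1)[of "d - (\<rho>/2)\<^sup>2"] m_pos(2)[of "\<rho>\<^sup>2 - d"] \<rho>4 by simp
  qed
  define k' where "k' d = ((- (2 * max 0 (\<rho>\<^sup>2 - d))) * (m (\<rho>\<^sup>2 - d) + m (d - (\<rho>/2)\<^sup>2))
      - m (\<rho>\<^sup>2 - d) * (- (2 * max 0 (\<rho>\<^sup>2 - d)) + 2 * max 0 (d - (\<rho>/2)\<^sup>2))) /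
      ((m (\<rho>\<^sup>2 - d) + m (d - (\<rho>/2)\<^sup>2)) * (m (\<rho>\<^sup>2 - d) + m (d - (\<rho>/2)\<^sup>2)))" for d
  have m1: "((\<lambda>d. m (\<rho>\<^sup>2 - d)) has_real_derivative - (2 * max 0 (\<rho>\<^sup>2 - d))) (at d)" for d
    unfolding m_def
    using DERIV_chain2[OF DERIV_max0_square, of "\<lambda>d. \<rho>\<^sup>2 - d" "- 1" d]
    by (simp add: DERIV_diff[OF DERIV_const DERIV_ident, simplified])
  have m2: "((\<lambda>d. m (d - (\<rho>/2)\<^sup>2)) has_real_derivative 2 * max 0 (d - (\<rho>/2)\<^sup>2)) (at d)" for d
    unfolding m_def
    using DERIV_chain2[OF DERIV_max0_square, of "\<lambda>d. d - (\<rho>/2)\<^sup>2" 1 d]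
    by (simp add: DERIV_diff[OF DERIV_ident DERIV_const, simplified])
  have dk: "(k has_real_derivative k' d) (at d)" for d
    unfolding k_def k'_def
    by (rule DERIV_divide[OF m1 DERIV_add[OF m1 m2]]) (use den[of d] in linarith)
  have ck: "continuous_on A k'" for A
  proof -
    have "(m (\<rho>\<^sup>2 - d) + m (d - (\<rho>/2)\<^sup>2)) \<noteq> 0" for d using den[of d] by linarith
    then show ?thesis unfolding k'_def m_def by (intro continuous_intros) auto
  qed
  define \<eta> where "\<eta> y = k ((norm (y - p))\<^sup>2)" for y :: 'a
  have "C1_with \<eta> (\<lambda>y. k' ((norm (y - p))\<^sup>2) *\<^sub>R (2 *\<^sub>R (y - p)))"
    unfolding \<eta>_def by (rule C1_with_compose[OF C1_with_norm_square dk ck])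
  moreover have "0 \<le> k d" "k d \<le> 1" for d
    unfolding k_def using den[of d] m_pos(2)[of "\<rho>\<^sup>2 - d"] m_pos(2)[of "d - (\<rho>/2)\<^sup>2"] by auto
  moreover have "\<eta> y = 1" if "y \<in> ball p (\<rho>/2)" for y
  proof -
    have "(norm (y - p))\<^sup>2 \<le> (\<rho>/2)\<^sup>2"
      using that by (intro power_mono) (auto simp: dist_norm norm_minus_commute)
    then show ?thesis unfolding \<eta>_def k_def using m_pos(3) den[of "(norm (y - p))\<^sup>2"] by simp
  qed
  moreover have "\<eta> y = 0" if "y \<notin> cball p \<rho>" for y
  proof -
    have "\<rho>\<^sup>2 \<le> (norm (y - p))\<^sup>2"
      using that assms by (intro power_mono) (auto simp: dist_norm norm_minus_commute)
    then show ?thesis unfolding \<eta>_def k_def using m_pos(3) by simp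
  qed
  ultimately show ?thesis using that unfolding \<eta>_def by blast
qed

lemma integrable_indicator_continuous:
  fixes f :: "'a::euclidean_space \<Rightarrow> real"
  assumes "bounded \<Omega>" "\<Omega> \<in> sets borel" "continuous_on UNIV f"
  shows "integrable lborel (\<lambda>y. indicator \<Omega> y * f y)"
proof -
  obtain p e where B: "\<Omega> \<subseteq> cball p e" using assms(1) bounded_subset_cball by blast
  have "integrable lborel (\<lambda>y. indicator (cball p e) y *\<^sub>R f y)"
    by (rule borel_integrable_compact) (auto intro: continuous_on_subset[OF assms(3)])
  from integrable_mult_indicator[OF _ this, of \<Omega>] assms(2)
  have "integrable lborel (\<lambda>y. indicator \<Omega> y *\<^sub>R (indicator (cball p e) y *\<^sub>R f y))" by simp
  also have "(\<lambda>y. indicator \<Omega> y *\<^sub>R (indicator (cball p e) y *\<^sub>R f y)) = (\<lambda>y. indicator \<Omega> y * f y)"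
    using B by (auto simp: indicator_def fun_eq_iff)
  finally show ?thesis .
qed

lemma integral_C1_compact_support:
  fixes \<phi> :: "real^'n \<Rightarrow> real"
  assumes \<phi>: "C1_with \<phi> G" "\<And>y. y \<notin> cball p \<rho> \<Longrightarrow> \<phi> y = 0"
  shows "(LINT y|lborel. G y $ j) = 0"
proof -
  have G0: "G y = 0" if "y \<notin> cball p \<rho>" for y
    by (rule C1_with_zero_cball[OF \<phi>(1), of p \<rho>]) (use \<phi>(2) that in auto)
  note cG = C1_with_continuous_nth[OF \<phi>(1)]
  have "(LINT y|lborel. G y $ j) = (LINT z|hyperplane_lborel j. LINT t|lborel. G (z + t *\<^sub>R axis j 1) $ j)"
    by (intro integral_slices integrable_compact_support[OF cG, where p = p and r = \<rho>]) (simp add: G0)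
  also have "\<dots> = (LINT z|hyperplane_lborel j. 0)"
  proof (rule Bochner_Integration.integral_cong[OF refl])
    fix z :: "real^'n"
    show "(LINT t|lborel. G (z + t *\<^sub>R axis j 1) $ j) = 0"
    proof (rule integral_deriv_line[where N = "norm p + \<rho> + \<bar>z $ j\<bar>"])
      show "((\<lambda>t. \<phi> (z + t *\<^sub>R axis j 1)) has_real_derivative G (z + t *\<^sub>R axis j 1) $ j) (at t)" for t
        by (rule C1_with_along[OF \<phi>(1), THEN DERIV_cong])
           (auto intro!: derivative_eq_intros simp: inner_axis)
      show "continuous_on UNIV (\<lambda>t. G (z + t *\<^sub>R axis j 1) $ j)"
        by (intro continuous_on_compose2[OF cG] continuous_intros) auto
    next
      fix t :: real assume "\<bar>t\<bar> > norm p + \<rho> + \<bar>z $ j\<bar>"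
      then show "\<phi> (z + t *\<^sub>R axis j 1) = 0"
        by (intro \<phi>(2) not_in_cball_far[where j = j]) (simp add: axis_def)
    qed
  qed
  finally show ?thesis by simp
qed

section \<open>From charts to the whole domain\<close>

text \<open>Quantifying over all test functions supported in the ball makes the property applicable
  to arbitrary functions multiplied by a cutoff.\<close>

definition locally_flux_bounded :: "(real^'n) set \<Rightarrow> (real^'n) measure \<Rightarrow> real^'n \<Rightarrow> real \<Rightarrow> bool" where
  "locally_flux_bounded \<Omega> S p \<rho> \<longleftrightarrow> (\<forall>\<phi> G j. C1_with \<phi> G \<longrightarrow> (\<forall>y. y \<notin> cball p \<rho> \<longrightarrow> \<phi> y = 0) \<longrightarrow>
     ennreal \<bar>LINT y|lborel. indicator \<Omega> y * G y $ j\<bar> \<le> (\<integral>\<^sup>+ y. ennreal \<bar>\<phi> y\<bar> \<partial>S))"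

text \<open>Around an interior point the support fits into the domain and the left side is zero.
  Around a boundary point half the chart radius provides the strict inclusion required by
  \<open>divergence_bound_chart\<close>.\<close>

lemma locally_flux_bounded_closure:
  fixes \<Omega> :: "(real^'n) set"
  assumes "open \<Omega>" "smooth_boundary \<Omega>" "is_surface_measure \<Omega> S" "p \<in> closure \<Omega>"
  shows "\<exists>\<rho>>0. locally_flux_bounded \<Omega> S p \<rho>"
proof (cases "p \<in> \<Omega>")
  case True
  then obtain \<rho> where \<rho>: "\<rho> > 0" "cball p \<rho> \<subseteq> \<Omega>" using assms(1) open_contains_cball by blast
  have "locally_flux_bounded \<Omega> S p \<rho>"
    unfolding locally_flux_bounded_def
  proof (intro allI impI)
    fix \<phi> and G :: "real^'n \<Rightarrow> real^'n" and j assume C: "C1_with \<phi> G" and z: "\<forall>y. y \<notin> cball p \<rho> \<longrightarrow> \<phi> y = 0"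
    have G0: "G y = 0" if "y \<notin> cball p \<rho>" for y
      by (rule C1_with_zero_cball[OF C, of p \<rho>]) (use z that in auto)
    have "indicator \<Omega> y * G y $ j = G y $ j" for y
      using \<rho>(2) G0[of y] by (cases "y \<in> cball p \<rho>") auto
    moreover have "(LINT y|lborel. G y $ j) = 0"
      using integral_C1_compact_support[OF C, of p \<rho> j] z by simp
    ultimately show "ennreal \<bar>LINT y|lborel. indicator \<Omega> y * G y $ j\<bar> \<le> (\<integral>\<^sup>+ y. ennreal \<bar>\<phi> y\<bar> \<partial>S)"
      by (simp only:) simp
  qed
  then show ?thesis using \<rho>(1) by blast
next
  case False
  then have "p \<in> frontier \<Omega>" using assms(1,4) by (simp add: frontier_def interior_open)
  then obtain r i s \<gamma> where ch: "graph_chart \<Omega> p r i s \<gamma>"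
    using assms(2) unfolding smooth_boundary_def by blast
  have r: "r > 0" using ch by (simp add: graph_chart_def)
  have "locally_flux_bounded \<Omega> S p (r/2)"
    unfolding locally_flux_bounded_def
    using divergence_bound_chart[OF assms(3) ch, where \<rho> = "r/2"] r by auto
  then show ?thesis using r by (intro exI[of _ "r/2"]) auto
qed

text \<open>Splitting \<open>\<phi> = \<phi> \<eta> + \<phi> (1 - \<eta>)\<close> with a cutoff \<open>0 \<le> \<eta> \<le> 1\<close> removes one ball of the cover, and the
  absolute values of the two parts add up exactly; hence no partition of unity is required.\<close>

lemma divergence_bound_covered:
  fixes \<phi> :: "real^'n \<Rightarrow> real"
  assumes \<Omega>: "open \<Omega>" "bounded \<Omega>" and S: "sets S = sets borel"
    and P: "finite P" "\<And>p \<rho>. (p, \<rho>) \<in> P \<Longrightarrow> \<rho> > 0 \<and> locally_flux_bounded \<Omega> S p \<rho>"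
    and \<phi>: "C1_with \<phi> G" "\<And>y. y \<in> \<Omega> \<Longrightarrow> y \<notin> (\<Union>(p, \<rho>)\<in>P. ball p (\<rho>/2)) \<Longrightarrow> \<phi> y = 0"
  shows "ennreal \<bar>LINT y|lborel. indicator \<Omega> y * G y $ j\<bar> \<le> (\<integral>\<^sup>+ y. ennreal \<bar>\<phi> y\<bar> \<partial>S)"
  using P \<phi>
proof (induction P arbitrary: \<phi> G rule: finite_induct)
  case empty
  \<comment> \<open>With no ball left \<phi> vanishes on the open set \<Omega>, and hence so does
    its gradient there.\<close>
  then have "G y = 0" if "y \<in> \<Omega>" for y
    using C1_with_zero[OF empty.prems(2) \<Omega>(1)] that by auto
  then have "indicator \<Omega> y * G y $ j = 0" for y by (simp add: indicator_def)
  then show ?case by (simp only:) simp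
next
  case (insert q P)
  obtain p \<rho> where q: "q = (p, \<rho>)" by fastforce
  then have \<rho>: "\<rho> > 0" "locally_flux_bounded \<Omega> S p \<rho>" using insert.prems(1) by auto
  obtain \<eta> E where \<eta>: "C1_with \<eta> E" "\<And>y. 0 \<le> \<eta> y" "\<And>y. \<eta> y \<le> 1"
    "\<And>y. y \<in> ball p (\<rho>/2) \<Longrightarrow> \<eta> y = 1" "\<And>y. y \<notin> cball p \<rho> \<Longrightarrow> \<eta> y = 0"
    using C1_cutoff[OF \<rho>(1), of p] by metis
  have c1: "C1_with (\<lambda>y. 1 - \<eta> y) (\<lambda>y. - E y)"
    using \<eta>(1) unfolding C1_with_def by (auto intro!: derivative_eq_intros continuous_intros)
  let ?G1 = "\<lambda>y. \<eta> y *\<^sub>R G y + \<phi> y *\<^sub>R E y" and ?G2 = "\<lambda>y. (1 - \<eta> y) *\<^sub>R G y + \<phi> y *\<^sub>R (- E y)"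
  let ?L = "\<lambda>G. LINT y|lborel. indicator \<Omega> y * G y $ j"
  let ?N = "\<lambda>\<phi>. \<integral>\<^sup>+ y. ennreal \<bar>\<phi> y\<bar> \<partial>S"
  note C1 = C1_with_mult[OF insert.prems(2) \<eta>(1)] and C2 = C1_with_mult[OF insert.prems(2) c1]
  note S[measurable_cong]
  have [measurable]: "\<phi> \<in> borel_measurable borel" "\<eta> \<in> borel_measurable borel"
    using C1_with_continuous[OF insert.prems(2)] C1_with_continuous[OF \<eta>(1)]
    by (auto intro: borel_measurable_continuous_onI)
  have int: "integrable lborel (\<lambda>y. indicator \<Omega> y * ?G1 y $ j)" "integrable lborel (\<lambda>y. indicator \<Omega> y * ?G2 y $ j)"
    using C1_with_continuous_nth[OF C1, of j] C1_with_continuous_nth[OF C2, of j] \<Omega>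
    by (auto intro: integrable_indicator_continuous)
  have "?L G = (LINT y|lborel. indicator \<Omega> y * ?G1 y $ j + indicator \<Omega> y * ?G2 y $ j)"
    by (rule Bochner_Integration.integral_cong) (auto simp: algebra_simps)
  also have "\<dots> = ?L ?G1 + ?L ?G2"
    by (rule Bochner_Integration.integral_add[OF int])
  finally have "ennreal \<bar>?L G\<bar> \<le>
     ennreal (\<bar>?L ?G1\<bar> + \<bar>?L ?G2\<bar>)"
    by (intro ennreal_leI) linarith
  also have "\<dots> = ennreal \<bar>?L ?G1\<bar> + ennreal \<bar>?L ?G2\<bar>"
    by simp
  also have "\<dots> \<le> ?N (\<lambda>y. \<phi> y * \<eta> y) + ?N (\<lambda>y. \<phi> y * (1 - \<eta> y))"
  proof (rule add_mono)
    show "ennreal \<bar>?L ?G1\<bar> \<le> ?N (\<lambda>y. \<phi> y * \<eta> y)"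
      by (rule \<rho>(2)[unfolded locally_flux_bounded_def, rule_format, OF C1]) (simp add: \<eta>(5))
    show "ennreal \<bar>?L ?G2\<bar> \<le> ?N (\<lambda>y. \<phi> y * (1 - \<eta> y))"
    proof (rule insert.IH[OF _ C2])
      \<comment> \<open>On the removed ball of radius \<rho>/2 the factor 1 - \<eta> is zero, so the
        remaining balls still cover the points of \<Omega> where the new function is
        nonzero.\<close>
      fix y assume "y \<in> \<Omega>" "y \<notin> (\<Union>(p, \<rho>)\<in>P. ball p (\<rho>/2))"
      then show "\<phi> y * (1 - \<eta> y) = 0"
        using insert.prems(3)[of y] \<eta>(4)[of y] q by auto
    qed (use insert.prems(1) in blast)
  qed
  also have "\<dots> = (\<integral>\<^sup>+ y. ennreal \<bar>\<phi> y * \<eta> y\<bar> + ennreal \<bar>\<phi> y * (1 - \<eta> y)\<bar> \<partial>S)"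
    by (rule nn_integral_add[symmetric]) measurable
  also have "\<dots> = ?N \<phi>"
  proof (rule nn_integral_cong)
    fix y
    have "\<bar>\<phi> y * \<eta> y\<bar> + \<bar>\<phi> y * (1 - \<eta> y)\<bar> = \<bar>\<phi> y\<bar>"
      using \<eta>(2,3)[of y] by (simp add: abs_mult) (simp add: algebra_simps)
    then show "ennreal \<bar>\<phi> y * \<eta> y\<bar> + ennreal \<bar>\<phi> y * (1 - \<eta> y)\<bar> = ennreal \<bar>\<phi> y\<bar>"
      by (metis abs_ge_zero ennreal_plus)
  qed
  finally show ?case .
qed

text \<open>Compactness of the closure yields finitely many balls of half radius. They cover
  \<Omega> itself, so the condition that \<phi> vanish in \<Omega> off the cover is vacuous.\<close>

theorem divergence_bound:
  fixes \<phi> :: "real^'n \<Rightarrow> real"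
  assumes \<Omega>: "open \<Omega>" "bounded \<Omega>" "smooth_boundary \<Omega>" and S: "is_surface_measure \<Omega> S"
    and \<phi>: "C1_with \<phi> G"
  shows "ennreal \<bar>LINT y|lborel. indicator \<Omega> y * G y $ j\<bar> \<le> (\<integral>\<^sup>+ y. ennreal \<bar>\<phi> y\<bar> \<partial>S)"
proof -
  have "\<forall>p\<in>closure \<Omega>. \<exists>\<rho>>0. locally_flux_bounded \<Omega> S p \<rho>"
    using locally_flux_bounded_closure[OF \<Omega>(1,3) S] by blast
  then obtain \<rho> where \<rho>: "\<And>p. p \<in> closure \<Omega> \<Longrightarrow> \<rho> p > 0 \<and> locally_flux_bounded \<Omega> S p (\<rho> p)"
    by metis
  have cover: "closure \<Omega> \<subseteq> (\<Union>p\<in>closure \<Omega>. ball p (\<rho> p / 2))" using \<rho> by force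
  obtain C where C: "C \<subseteq> closure \<Omega>" "finite C" "closure \<Omega> \<subseteq> (\<Union>p\<in>C. ball p (\<rho> p / 2))"
    by (rule compactE_image[of "closure \<Omega>" "closure \<Omega>" "\<lambda>p. ball p (\<rho> p / 2)"])
       (use \<Omega>(2) cover compact_closure in auto)
  show ?thesis
  proof (rule divergence_bound_covered[OF \<Omega>(1,2) _ _ _ \<phi>, of S "(\<lambda>p. (p, \<rho> p)) ` C"])
    show "sets S = sets borel" using S by (simp add: is_surface_measure_def)
    fix y assume "y \<in> \<Omega>" "y \<notin> (\<Union>(p, \<rho>)\<in>(\<lambda>p. (p, \<rho> p)) ` C. ball p (\<rho>/2))"
    then show "\<phi> y = 0" using C(3) closure_subset by blast
  qed (use C \<rho> in auto)
qed

text \<open>In a chart the area density is bounded on compact sets, and the part of the graph inside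
  the ball lies over a bounded piece of the hyperplane; finitely many charts cover the boundary.
  Finiteness makes bounded kernels integrable over the boundary.\<close>

lemma emeasure_surface_measure_finite:
  fixes \<Omega> :: "(real^'n) set"
  assumes \<Omega>: "open \<Omega>" "bounded \<Omega>" "smooth_boundary \<Omega>" and S: "is_surface_measure \<Omega> S"
  shows "emeasure S UNIV < \<infinity>"
proof -
  have sS: "sets S = sets borel" using S by (simp add: is_surface_measure_def)
  have "\<exists>\<rho>>0. emeasure S (ball p \<rho>) < \<infinity>" if p: "p \<in> frontier \<Omega>" for p
  proof -
    obtain r i s \<gamma> where ch: "graph_chart \<Omega> p r i s \<gamma>"
      using \<Omega>(3) p unfolding smooth_boundary_def by blast
    then have r: "r > 0" and s: "s \<in> {1, -1}" and sm: "smooth \<gamma>" by (auto simp: graph_chart_def)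
    let ?\<Phi> = "\<lambda>z. z + (s * \<gamma> z) *\<^sub>R axis i 1"
    let ?w = "\<lambda>z. sqrt (1 + (\<Sum>j\<in>UNIV. (partial_deriv j \<gamma> z)\<^sup>2))"
    \<comment> \<open>Coordinates of points in the ball have modulus at most \<open>b\<close>. The
      graph map alters only the i-th coordinate, which is 0 on the hyperplane, so the preimage of
      the ball lies in the cube of half side \<open>b\<close>.\<close>
    define b where "b = norm p + r"
    have "continuous_on UNIV (\<lambda>z. grad \<gamma> z $ j)" for j
      by (intro continuous_intros smooth_imp_continuous_on_grad[OF sm])
    then have "continuous_on UNIV (partial_deriv j \<gamma>)" for j by (simp add: grad_def)
    then have cw: "continuous_on (cbox (\<chi> j. - b) (\<chi> j. b)) ?w"
      by (intro continuous_intros) (auto intro: continuous_on_subset)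
    have "bounded (?w ` cbox (\<chi> j. - b) (\<chi> j. b))"
      by (rule compact_imp_bounded[OF compact_continuous_image[OF cw compact_cbox]])
    then obtain M where "\<forall>x\<in>?w ` cbox (\<chi> j. - b) (\<chi> j. b). norm x \<le> M"
      unfolding bounded_iff by blast
    then have M: "?w z \<le> M" if "z \<in> cbox (\<chi> j. - b) (\<chi> j. b)" for z
      using that abs_le_D1[of "?w z" M] by simp
    have b0: "b > 0" using r by (simp add: b_def add_nonneg_pos)
    let ?e = "\<lambda>c. \<chi> j. if j = i then 0 else c j"
    let ?Q = "cbox (\<chi> j. - b) (\<chi> j. b) :: (real^'n) set"
    interpret product_sigma_finite "\<lambda>_::'n. lborel::real measure" by standard
    have "emeasure (hyperplane_lborel i) ?Q = emeasure (\<Pi>\<^sub>M j\<in>UNIV - {i}. lborel) (?e -` ?Q \<inter> space (\<Pi>\<^sub>M j\<in>UNIV - {i}. lborel))"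
      unfolding hyperplane_lborel_def by (rule emeasure_distr[OF measurable_embed_hyperplane]) (rule borel_closed, rule closed_cbox)
    also have "?e -` ?Q \<inter> space (\<Pi>\<^sub>M j\<in>UNIV - {i}. lborel) = (\<Pi>\<^sub>E j\<in>UNIV - {i}. {-b..b})"
    proof (rule set_eqI)
      fix c
      have "?e c \<in> ?Q \<longleftrightarrow> (\<forall>j\<in>UNIV - {i}. c j \<in> {-b..b})"
        unfolding mem_box_cart using b0 by auto
      then show "c \<in> ?e -` ?Q \<inter> space (\<Pi>\<^sub>M j\<in>UNIV - {i}. lborel) \<longleftrightarrow> c \<in> (\<Pi>\<^sub>E j\<in>UNIV - {i}. {-b..b})"
        by (simp add: space_PiM PiE_iff conj_commute del: Diff_iff)
    qed
    also have "emeasure (\<Pi>\<^sub>M j\<in>UNIV - {i}. lborel) \<dots> = (\<Prod>j\<in>UNIV - {i}. ennreal (2 * b))"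
      using b0 by (subst emeasure_PiM) auto
    also have "\<dots> < \<infinity>" by (simp add: power_less_top_ennreal)
    finally have fin: "emeasure (hyperplane_lborel i) ?Q < \<infinity>" .
    have "emeasure S (ball p r) = (\<integral>\<^sup>+ z. indicator (ball p r) (?\<Phi> z) * ennreal (?w z) \<partial>hyperplane_lborel i)"
      using S ch unfolding is_surface_measure_def by auto
    also have "\<dots> \<le> (\<integral>\<^sup>+ z. ennreal M * indicator ?Q z \<partial>hyperplane_lborel i)"
    proof (rule nn_integral_mono_AE)
      show "AE z in hyperplane_lborel i. indicator (ball p r) (?\<Phi> z) * ennreal (?w z) \<le> ennreal M * indicator ?Q z"
        using AE_hyperplane_lborel[of i]
      proof eventually_elim
        case (elim z)
        show ?case
        proof (cases "?\<Phi> z \<in> ball p r")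
          case True
          have "\<bar>z $ j\<bar> \<le> b" for j
          proof (cases "j = i")
            case False
            have "\<bar>?\<Phi> z $ j\<bar> \<le> norm (?\<Phi> z)" by (rule component_le_norm_cart)
            also have "\<dots> \<le> b"
              using True norm_triangle_ineq2[of "?\<Phi> z" p] by (simp add: b_def dist_norm norm_minus_commute)
            finally show ?thesis using False by (simp add: axis_def)
          qed (use elim b0 in simp)
          then have "z \<in> ?Q" by (auto simp: mem_box_cart abs_le_iff minus_le_iff)
          then show ?thesis using M[of z] by (auto simp: indicator_def intro: ennreal_leI)
        qed simp
      qed
    qed
    also have "\<dots> = ennreal M * emeasure (hyperplane_lborel i) ?Q"
      by (rule nn_integral_cmult_indicator) simp
    also have "\<dots> < \<infinity>" using fin by (simp add: ennreal_mult_less_top)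
    finally show ?thesis using r by blast
  qed
  then obtain \<rho> where \<rho>: "\<And>p. p \<in> frontier \<Omega> \<Longrightarrow> \<rho> p > 0 \<and> emeasure S (ball p (\<rho> p)) < \<infinity>"
    by metis
  obtain C where C: "C \<subseteq> frontier \<Omega>" "finite C" "frontier \<Omega> \<subseteq> (\<Union>p\<in>C. ball p (\<rho> p))"
    by (rule compactE_image[of "frontier \<Omega>" "frontier \<Omega>" "\<lambda>p. ball p (\<rho> p)"])
       (use \<Omega>(2) \<rho> compact_frontier_bounded in force)+
  have "emeasure S UNIV \<le> emeasure S (- frontier \<Omega> \<union> (\<Union>p\<in>C. ball p (\<rho> p)))"
    by (rule emeasure_mono) (use C in \<open>auto simp: sS intro!: borel_open open_Un open_Compl frontier_closed\<close>)
  also have "\<dots> \<le> emeasure S (- frontier \<Omega>) + emeasure S (\<Union>p\<in>C. ball p (\<rho> p))"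
    by (rule emeasure_subadditive) (auto simp: sS intro!: borel_open open_Compl frontier_closed)
  also have "\<dots> \<le> 0 + (\<Sum>p\<in>C. emeasure S (ball p (\<rho> p)))"
    by (intro add_mono emeasure_subadditive_finite) (use S C in \<open>auto simp: sS is_surface_measure_def\<close>)
  also have "\<dots> < \<infinity>"
    using C \<rho> by (auto simp: subset_iff)
  finally show ?thesis .
qed

section \<open>Taylor expansion on a nonconvex domain\<close>

text \<open>The mean value theorem is applied to the second difference in direction i and then in
  direction j. The left side is symmetric in i and j, the right side is not; comparing the two
  orders is the point.\<close>

lemma partial_derivs_commute_aux:
  fixes f :: "real^'n \<Rightarrow> real"
  assumes U: "cball x (2 * h) \<subseteq> U" "h > 0"
    and f: "\<And>z. z \<in> U \<Longrightarrow> f differentiable (at z)"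
    and f1: "\<And>z. z \<in> U \<Longrightarrow> partial_deriv i f differentiable (at z)"
  shows "\<exists>p\<in>cball x (2 * h). f (x + h *\<^sub>R axis i 1 + h *\<^sub>R axis j 1) - f (x + h *\<^sub>R axis i 1) - f (x + h *\<^sub>R axis j 1) + f x
      = h\<^sup>2 * partial_deriv j (partial_deriv i f) p"
proof -
  have inball: "x + s *\<^sub>R axis i 1 + t *\<^sub>R axis j 1 \<in> cball x (2 * h)" if "0 \<le> s" "s \<le> h" "0 \<le> t" "t \<le> h" for s t
  proof -
    have "norm (s *\<^sub>R axis i 1 + t *\<^sub>R axis j 1 :: real^'n) \<le> s + t"
      using norm_triangle_ineq[of "s *\<^sub>R axis i 1 :: real^'n" "t *\<^sub>R axis j 1"] that by (simp add: norm_axis_1)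
    moreover have "x - (x + s *\<^sub>R axis i 1 + t *\<^sub>R axis j 1) = - (s *\<^sub>R axis i 1 + t *\<^sub>R axis j 1)" by simp
    ultimately show ?thesis using that unfolding mem_cball dist_norm by (simp only: norm_minus_cancel)
  qed
  have d: "((\<lambda>s. g (y + s *\<^sub>R axis k 1)) has_real_derivative partial_deriv k g (y + s *\<^sub>R axis k 1)) (at s)"
    if "g differentiable (at (y + s *\<^sub>R axis k 1))" for g :: "real^'n \<Rightarrow> real" and y s k
  proof -
    have "((\<lambda>s. y + s *\<^sub>R axis k 1) has_derivative (\<lambda>h. h *\<^sub>R axis k 1)) (at s)"
      by (auto intro!: derivative_eq_intros)
    from diff_chain_at[OF this has_derivative_grad[OF that]]
    show ?thesis
      by (simp add: o_def has_field_derivative_def inner_axis grad_def mult_commute_abs)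
  qed
  let ?g = "\<lambda>s. f (x + s *\<^sub>R axis i 1 + h *\<^sub>R axis j 1) - f (x + s *\<^sub>R axis i 1)"
  have "\<exists>\<xi>>0. \<xi> < h \<and> ?g h - ?g 0 = (h - 0) * (partial_deriv i f (x + \<xi> *\<^sub>R axis i 1 + h *\<^sub>R axis j 1) - partial_deriv i f (x + \<xi> *\<^sub>R axis i 1))"
  proof (rule MVT2)
    fix s assume s: "0 \<le> s" "s \<le> h"
    have 1: "f differentiable (at (x + h *\<^sub>R axis j 1 + s *\<^sub>R axis i 1))"
      using inball[of s h] s U by (intro f) (auto simp: algebra_simps)
    have 2: "f differentiable (at (x + s *\<^sub>R axis i 1))"
      using inball[of s 0] s U by (intro f) auto
    show "(?g has_real_derivative partial_deriv i f (x + s *\<^sub>R axis i 1 + h *\<^sub>R axis j 1) - partial_deriv i f (x + s *\<^sub>R axis i 1)) (at s)"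
      using DERIV_diff[OF d[OF 1] d[OF 2]] by (simp add: algebra_simps)
  qed (use U in auto)
  then obtain \<xi> where \<xi>: "0 < \<xi>" "\<xi> < h" "?g h - ?g 0 = h * (partial_deriv i f (x + \<xi> *\<^sub>R axis i 1 + h *\<^sub>R axis j 1) - partial_deriv i f (x + \<xi> *\<^sub>R axis i 1))"
    by auto
  have "\<exists>\<eta>>0. \<eta> < h \<and> partial_deriv i f (x + \<xi> *\<^sub>R axis i 1 + h *\<^sub>R axis j 1) - partial_deriv i f (x + \<xi> *\<^sub>R axis i 1 + 0 *\<^sub>R axis j 1) =
      (h - 0) * partial_deriv j (partial_deriv i f) (x + \<xi> *\<^sub>R axis i 1 + \<eta> *\<^sub>R axis j 1)"
  proof (rule MVT2)
    fix t assume t: "0 \<le> t" "t \<le> h"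
    show "((\<lambda>t. partial_deriv i f (x + \<xi> *\<^sub>R axis i 1 + t *\<^sub>R axis j 1)) has_real_derivative
       partial_deriv j (partial_deriv i f) (x + \<xi> *\<^sub>R axis i 1 + t *\<^sub>R axis j 1)) (at t)"
      using inball[of \<xi> t] t \<xi> U by (intro d f1) auto
  qed (use U in auto)
  then obtain \<eta> where \<eta>: "0 < \<eta>" "\<eta> < h" "partial_deriv i f (x + \<xi> *\<^sub>R axis i 1 + h *\<^sub>R axis j 1) - partial_deriv i f (x + \<xi> *\<^sub>R axis i 1) =
      h * partial_deriv j (partial_deriv i f) (x + \<xi> *\<^sub>R axis i 1 + \<eta> *\<^sub>R axis j 1)"
    by auto
  show ?thesis
  proof (rule bexI)
    show "x + \<xi> *\<^sub>R axis i 1 + \<eta> *\<^sub>R axis j 1 \<in> cball x (2 * h)" using inball \<xi> \<eta> by simp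
    show "f (x + h *\<^sub>R axis i 1 + h *\<^sub>R axis j 1) - f (x + h *\<^sub>R axis i 1) - f (x + h *\<^sub>R axis j 1) + f x
      = h\<^sup>2 * partial_deriv j (partial_deriv i f) (x + \<xi> *\<^sub>R axis i 1 + \<eta> *\<^sub>R axis j 1)"
      using \<xi>(3) \<eta>(3) by (simp add: power2_eq_square)
  qed
qed

text \<open>Both mixed derivatives take a common value at points arbitrarily close to x, so
  continuity forces them to agree at x. The Taylor remainder uses this to identify the gradient of
  the quadratic term.\<close>

lemma partial_derivs_commute:
  fixes f :: "real^'n \<Rightarrow> real"
  assumes U: "open U" "x \<in> U"
    and f: "\<And>z. z \<in> U \<Longrightarrow> f differentiable (at z)"
    and f1: "\<And>z k. z \<in> U \<Longrightarrow> partial_deriv k f differentiable (at z)"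
    and f2: "\<And>k l. continuous_on U (partial_deriv k (partial_deriv l f))"
  shows "partial_deriv i (partial_deriv j f) x = partial_deriv j (partial_deriv i f) x"
proof (rule ccontr)
  let ?a = "partial_deriv i (partial_deriv j f)" and ?b = "partial_deriv j (partial_deriv i f)"
  assume ne: "?a x \<noteq> ?b x"
  define e where "e = \<bar>?a x - ?b x\<bar> / 2"
  have e: "e > 0" using ne by (simp add: e_def)
  have "isCont ?a x" "isCont ?b x"
    using f2 U by (auto simp: continuous_on_eq_continuous_at)
  then obtain da db where d: "da > 0" "\<And>z. dist z x < da \<Longrightarrow> dist (?a z) (?a x) < e"
     "db > 0" "\<And>z. dist z x < db \<Longrightarrow> dist (?b z) (?b x) < e"
    using e unfolding continuous_at_eps_delta by metis
  obtain r where r: "r > 0" "cball x r \<subseteq> U" using U open_contains_cball by blast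
  \<comment> \<open>Division by 4 keeps the closed ball of radius 2h strictly inside all three
    neighbourhoods.\<close>
  define h where "h = min r (min da db) / 4"
  have h: "h > 0" "2 * h \<le> r" "2 * h < da" "2 * h < db" using r d by (auto simp: h_def)
  have sub: "cball x (2 * h) \<subseteq> U" using h r by (meson order_trans subset_cball)
  obtain p where p: "p \<in> cball x (2 * h)" "f (x + h *\<^sub>R axis j 1 + h *\<^sub>R axis i 1) - f (x + h *\<^sub>R axis j 1) - f (x + h *\<^sub>R axis i 1) + f x = h\<^sup>2 * ?a p"
    using partial_derivs_commute_aux[OF sub h(1) f f1, of j i] by auto
  obtain q where q: "q \<in> cball x (2 * h)" "f (x + h *\<^sub>R axis i 1 + h *\<^sub>R axis j 1) - f (x + h *\<^sub>R axis i 1) - f (x + h *\<^sub>R axis j 1) + f x = h\<^sup>2 * ?b q"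
    using partial_derivs_commute_aux[OF sub h(1) f f1, of i j] by auto
  have "h\<^sup>2 * ?a p = h\<^sup>2 * ?b q"
    unfolding p(2)[symmetric] q(2)[symmetric] by (simp add: algebra_simps)
  then have "?a p = ?b q" using h by simp
  moreover have "dist (?a p) (?a x) < e" "dist (?b q) (?b x) < e"
    using d p q h by (auto simp: dist_commute)
  ultimately have "\<bar>?a x - ?b x\<bar> < 2 * e" by (simp add: dist_real_def) 
  then show False by (simp add: e_def)
qed

text \<open>The factor \<open>CARD('n)\<close> comes from bounding the norm of the gradient by the
  sum of the absolute values of its components.\<close>

lemma abs_diff_le_on_segment:
  fixes v :: "real^'n \<Rightarrow> real" and N :: real
  assumes "\<And>z. z \<in> closed_segment a b \<Longrightarrow> v differentiable (at z)"
    and "\<And>z k. z \<in> closed_segment a b \<Longrightarrow> \<bar>partial_deriv k v z\<bar> \<le> N"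
  shows "\<bar>v a - v b\<bar> \<le> CARD('n) * N * dist a b"
proof -
  have "norm (v a - v b) \<le> CARD('n) * N * norm (a - b)"
  proof (rule differentiable_bound[of "closed_segment a b"])
    fix z assume z: "z \<in> closed_segment a b"
    show "(v has_derivative (\<lambda>h. grad v z \<bullet> h)) (at z within closed_segment a b)"
      using has_derivative_grad[OF assms(1)[OF z]] has_derivative_at_withinI by blast
    have "norm (grad v z) \<le> (\<Sum>k\<in>UNIV. \<bar>partial_deriv k v z\<bar>)"
      using norm_le_l1_cart[of "grad v z"] by (simp add: grad_def)
    also have "\<dots> \<le> CARD('n) * N" using sum_bounded_above[of UNIV "\<lambda>k. \<bar>partial_deriv k v z\<bar>" N] assms(2)[OF z] by simp
    finally have "norm (grad v z) \<le> CARD('n) * N" .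
    then show "onorm (\<lambda>h. grad v z \<bullet> h) \<le> CARD('n) * N"
      by (intro onorm_le) (metis Cauchy_Schwarz_ineq2 mult_right_mono norm_ge_zero order_trans real_norm_def)
  qed auto
  then show ?thesis by (simp add: dist_norm)
qed

text \<open>Segments between points of the domain may leave it.  Near a graph, moving away from the boundary,
  across, and back gives a polygonal substitute of comparable length.\<close>

definition locally_quasiconvex :: "('a::real_normed_vector) set \<Rightarrow> real \<Rightarrow> real \<Rightarrow> bool" where
  "locally_quasiconvex \<Omega> C \<epsilon> \<longleftrightarrow> (\<forall>x\<in>\<Omega>. \<forall>y\<in>\<Omega>. dist x y < \<epsilon> \<longrightarrow>
     (\<exists>a b. closed_segment x a \<union> closed_segment a b \<union> closed_segment b y \<subseteq> \<Omega> \<inter> cball x (C * dist x y)))"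

lemma quasiconvex_at_graph:
  fixes \<Omega> :: "(real^'n) set"
  assumes ch: "graph_chart \<Omega> p r i s \<gamma>"
  shows "\<exists>\<rho>>0. \<exists>C. \<forall>x\<in>\<Omega> \<inter> ball p \<rho>. \<forall>y\<in>\<Omega> \<inter> ball p \<rho>. \<exists>a b.
     closed_segment x a \<union> closed_segment a b \<union> closed_segment b y \<subseteq> \<Omega> \<inter> cball x (C * dist x y)"
proof -
  have r: "r > 0" and s: "s \<in> {1, -1}" and sm: "smooth \<gamma>" and inv: "\<And>x t. \<gamma> (x + t *\<^sub>R axis i 1) = \<gamma> x"
    and Om': "\<Omega> \<inter> ball p r = {x \<in> ball p r. s * (x $ i) > \<gamma> x}"
    using ch by (auto simp: graph_chart_def)
  have Om: "x \<in> \<Omega> \<longleftrightarrow> s * (x $ i) > \<gamma> x" if "x \<in> ball p r" for x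
    using Om' that by blast
  have "bounded (grad \<gamma> ` cball p r)"
    by (rule compact_imp_bounded[OF compact_continuous_image[OF smooth_imp_continuous_on_grad[OF sm] compact_cball]])
  then obtain M where "M > 0" "\<forall>z\<in>grad \<gamma> ` cball p r. norm z \<le> M"
    unfolding bounded_pos by blast
  then have M: "\<And>z. z \<in> cball p r \<Longrightarrow> norm (grad \<gamma> z) \<le> M" "M > 0" by blast+
  have lip: "\<bar>\<gamma> x - \<gamma> y\<bar> \<le> M * dist x y" if "x \<in> cball p r" "y \<in> cball p r" for x y
  proof -
    have "norm (\<gamma> x - \<gamma> y) \<le> M * norm (x - y)"
    proof (rule differentiable_bound[OF convex_cball[of p r]])
      fix z assume z: "z \<in> cball p r"
      show "(\<gamma> has_derivative (\<lambda>h. grad \<gamma> z \<bullet> h)) (at z within cball p r)"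
        using has_derivative_grad[OF smooth_imp_differentiable[OF sm]] has_derivative_at_withinI by blast
      show "onorm (\<lambda>h. grad \<gamma> z \<bullet> h) \<le> M"
        using M(1)[OF z] by (intro onorm_le) (metis Cauchy_Schwarz_ineq2 mult_right_mono norm_ge_zero order_trans real_norm_def)
    qed (use that in auto)
    then show ?thesis by (simp add: dist_norm)
  qed
  \<comment> \<open>This makes \<rho> + (1 + M) (2 \<rho>) equal to r/2: two points of the small
    ball are less than 2\<rho> apart, so a detour of reach (1 + M) times their distance stays in the
    chart.\<close>
  define \<rho> where "\<rho> = r / (2 * (3 + 2 * M))"
  have \<rho>: "\<rho> > 0" "\<rho> + (1 + M) * (2 * \<rho>) < r"
  proof -
    show "\<rho> > 0" using r M by (simp add: \<rho>_def)
    have "(3 + 2 * M) * \<rho> = r / 2" using M(2) by (simp add: \<rho>_def field_simps)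
    then show "\<rho> + (1 + M) * (2 * \<rho>) < r" using r by (simp add: algebra_simps)
  qed
  have "\<exists>a b. closed_segment x a \<union> closed_segment a b \<union> closed_segment b y \<subseteq> \<Omega> \<inter> cball x ((1 + M) * dist x y)"
    if x: "x \<in> \<Omega> \<inter> ball p \<rho>" and y: "y \<in> \<Omega> \<inter> ball p \<rho>" for x y
  proof -
    define d where "d = dist x y"
    \<comment> \<open>\<open>M\<close> bounds the slope of \<gamma> and \<open>d\<close> is the
      distance of x and y; raising both ends by M d lifts the connecting segment clear of the
      graph.\<close>
    define a where "a = x + (s * (M * d)) *\<^sub>R axis i 1"
    define b where "b = y + (s * (M * d)) *\<^sub>R axis i 1"
    have d: "d \<ge> 0" "d < 2 * \<rho>" using x y dist_triangle[of x y p] by (auto simp: d_def dist_commute)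
    have "0 \<le> (1 + M) * (2 * \<rho>)" using \<rho>(1) M(2) by simp
    then have \<rho>r: "\<rho> < r" using \<rho>(2) by linarith
    have xi: "s * (x $ i) > \<gamma> x" "s * (y $ i) > \<gamma> y" using Om[of x] Om[of y] x y \<rho>r by auto
    \<comment> \<open>Every point of the three legs is a point w of the segment from x to y, raised
      by some \<tau> between 0 and M d. Only the position relative to the graph differs from leg to
      leg.\<close>
    have main: "z \<in> \<Omega> \<inter> cball x ((1 + M) * d)"
      if z: "z = w + (s * \<tau>) *\<^sub>R axis i 1" and w: "w = (1 - u) *\<^sub>R x + u *\<^sub>R y" and u: "0 \<le> u" "u \<le> 1"
        and \<tau>: "0 \<le> \<tau>" "\<tau> \<le> M * d" and wi: "s * (w $ i) + \<tau> > \<gamma> w" for z w \<tau> u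
    proof -
      have "dist x w = u * d"
      proof -
        have "x - w = u *\<^sub>R (x - y)" by (simp add: w algebra_simps)
        then show ?thesis using u by (simp add: dist_norm d_def)
      qed
      then have xw: "dist x w \<le> d" using u d mult_left_le_one_le[of d u] by simp
      have wz: "dist w z \<le> M * d" using s \<tau> by (auto simp: z dist_norm norm_axis_1)
      have xz: "dist x z \<le> (1 + M) * d" using xw wz dist_triangle[of x z w] by (simp add: algebra_simps)
      have "(1 + M) * d \<le> (1 + M) * (2 * \<rho>)" using d M by (intro mult_left_mono) auto
      then have "dist p z < r" using xz x \<rho>(2) dist_triangle[of p z x] by auto
      moreover have "s * (z $ i) > \<gamma> z"
      proof -
        have "z $ i = w $ i + s * \<tau>" by (simp add: z axis_def)
        then show ?thesis using s wi unfolding z inv by (auto simp: algebra_simps)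
      qed
      ultimately show ?thesis using Om[of z] xz by auto
    qed
    have "closed_segment x a \<subseteq> \<Omega> \<inter> cball x ((1 + M) * d)"
    proof
      fix z assume "z \<in> closed_segment x a"
      then obtain u where u: "0 \<le> u" "u \<le> 1" "z = (1 - u) *\<^sub>R x + u *\<^sub>R a" by (auto simp: in_segment)
      then have z: "z = x + (s * (u * (M * d))) *\<^sub>R axis i 1" by (simp add: a_def algebra_simps)
      have "0 \<le> u * (M * d)" "u * (M * d) \<le> M * d" using u d M by (auto intro: mult_left_le_one_le)
      then show "z \<in> \<Omega> \<inter> cball x ((1 + M) * d)"
        using xi by (intro main[OF z, of 0]) auto
    qed
    moreover have "closed_segment b y \<subseteq> \<Omega> \<inter> cball x ((1 + M) * d)"
    proof
      fix z assume "z \<in> closed_segment b y"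
      then obtain u where u: "0 \<le> u" "u \<le> 1" "z = (1 - u) *\<^sub>R b + u *\<^sub>R y" by (auto simp: in_segment)
      then have z: "z = y + (s * ((1 - u) * (M * d))) *\<^sub>R axis i 1" by (simp add: b_def algebra_simps)
      have "0 \<le> (1 - u) * (M * d)" "(1 - u) * (M * d) \<le> M * d" using u d M by (auto intro: mult_left_le_one_le)
      then show "z \<in> \<Omega> \<inter> cball x ((1 + M) * d)"
        using xi by (intro main[OF z, of 1]) auto
    qed
    moreover have "closed_segment a b \<subseteq> \<Omega> \<inter> cball x ((1 + M) * d)"
    proof
      fix z assume "z \<in> closed_segment a b"
      then obtain u where u: "0 \<le> u" "u \<le> 1" "z = (1 - u) *\<^sub>R a + u *\<^sub>R b" by (auto simp: in_segment)
      define w where "w = (1 - u) *\<^sub>R x + u *\<^sub>R y"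
      have z: "z = w + (s * (M * d)) *\<^sub>R axis i 1" using u(3) by (simp add: a_def b_def w_def algebra_simps)
      have wp: "w \<in> ball p \<rho>"
        unfolding w_def using x y u by (intro convexD[OF convex_ball]) auto
      have "x - w = u *\<^sub>R (x - y)" "y - w = (1 - u) *\<^sub>R (y - x)" by (auto simp: w_def algebra_simps)
      then have "dist x w \<le> d" "dist y w \<le> d"
        using u d mult_left_le_one_le[of d u] mult_left_le_one_le[of d "1 - u"]
        by (auto simp: dist_norm d_def norm_minus_commute)
      then have "M * dist x w \<le> M * d" "M * dist y w \<le> M * d" using M by auto
      moreover have "\<bar>\<gamma> x - \<gamma> w\<bar> \<le> M * dist x w" "\<bar>\<gamma> y - \<gamma> w\<bar> \<le> M * dist y w"
        using x y wp \<rho>r by (auto intro!: lip)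
      ultimately have "s * (x $ i) > \<gamma> w - M * d" "s * (y $ i) > \<gamma> w - M * d" using xi by auto
      then have "(1 - u) * (s * (x $ i)) + u * (s * (y $ i)) > \<gamma> w - M * d"
        using u convex_bound_lt[of "- (s * (x $ i))" "M * d - \<gamma> w" "- (s * (y $ i))" "1 - u" u] by simp
      then have "s * (w $ i) + M * d > \<gamma> w" by (simp add: w_def algebra_simps)
      then show "z \<in> \<Omega> \<inter> cball x ((1 + M) * d)"
        using u d M by (intro main[OF z w_def]) auto
    qed
    ultimately show ?thesis unfolding d_def by blast
  qed
  then show ?thesis using \<rho>(1) by blast
qed

text \<open>A Lebesgue number argument on the compact closure: points closer than half the smallest
  radius lie in a common ball of the cover, and the largest local constant serves for all.\<close>

lemma locally_quasiconvex_smooth_boundary: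
  fixes \<Omega> :: "(real^'n) set"
  assumes \<Omega>: "open \<Omega>" "bounded \<Omega>" "smooth_boundary \<Omega>"
  obtains C \<epsilon> where "C \<ge> 0" "\<epsilon> > 0" "locally_quasiconvex \<Omega> C \<epsilon>"
proof -
  let ?path = "\<lambda>C x y. \<exists>a b. closed_segment x a \<union> closed_segment a b \<union> closed_segment b y \<subseteq> \<Omega> \<inter> cball x (C * dist x y)"
  have "\<exists>\<rho>>0. \<exists>C. \<forall>x\<in>\<Omega> \<inter> ball p \<rho>. \<forall>y\<in>\<Omega> \<inter> ball p \<rho>. ?path C x y" if p: "p \<in> closure \<Omega>" for p
  proof (cases "p \<in> \<Omega>")
    case True
    then obtain \<rho> where \<rho>: "\<rho> > 0" "ball p \<rho> \<subseteq> \<Omega>" using \<Omega>(1) open_contains_ball by blast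
    have "?path 1 x y" if "x \<in> \<Omega> \<inter> ball p \<rho>" "y \<in> \<Omega> \<inter> ball p \<rho>" for x y
    proof (rule exI[of _ x], rule exI[of _ y])
      have "closed_segment x y \<subseteq> ball p \<rho>"
        using that by (intro closed_segment_subset) auto
      moreover have "closed_segment x y \<subseteq> cball x (1 * dist x y)"
        by (rule closed_segment_subset) auto
      ultimately show "closed_segment x x \<union> closed_segment x y \<union> closed_segment y y \<subseteq> \<Omega> \<inter> cball x (1 * dist x y)"
        using \<rho>(2) that by auto
    qed
    then show ?thesis using \<rho>(1) by blast
  next
    case False
    then have "p \<in> frontier \<Omega>" using \<Omega>(1) p by (simp add: frontier_def interior_open)
    then show ?thesis using \<Omega>(3) quasiconvex_at_graph unfolding smooth_boundary_def by metis
  qed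
  then obtain \<rho> C where \<rho>: "\<And>p. p \<in> closure \<Omega> \<Longrightarrow> \<rho> p > 0"
    and C: "\<And>p x y. p \<in> closure \<Omega> \<Longrightarrow> x \<in> \<Omega> \<inter> ball p (\<rho> p) \<Longrightarrow> y \<in> \<Omega> \<inter> ball p (\<rho> p) \<Longrightarrow> ?path (C p) x y"
    by metis
  have cover: "closure \<Omega> \<subseteq> (\<Union>p\<in>closure \<Omega>. ball p (\<rho> p / 2))" using \<rho> by force
  obtain K where K: "K \<subseteq> closure \<Omega>" "finite K" "closure \<Omega> \<subseteq> (\<Union>p\<in>K. ball p (\<rho> p / 2))"
    by (rule compactE_image[of "closure \<Omega>" "closure \<Omega>" "\<lambda>p. ball p (\<rho> p / 2)"])
       (use \<Omega>(2) cover compact_closure in auto)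
  \<comment> \<open>The inserted values 0 and, below, 1 give the sign of both constants and keep
    them meaningful for an empty cover.\<close>
  define C' where "C' = Max (insert 0 (C ` K))"
  define \<epsilon> where "\<epsilon> = Min (insert 1 ((\<lambda>p. \<rho> p / 2) ` K))"
  have "locally_quasiconvex \<Omega> C' \<epsilon>"
    unfolding locally_quasiconvex_def
  proof (intro ballI impI)
    fix x y assume xy: "x \<in> \<Omega>" "y \<in> \<Omega>" "dist x y < \<epsilon>"
    then obtain p where p: "p \<in> K" "x \<in> ball p (\<rho> p / 2)" using K(3) closure_subset by blast
    have "\<epsilon> \<le> \<rho> p / 2" unfolding \<epsilon>_def using K(2) p(1) by (intro Min_le) auto
    then have "y \<in> ball p (\<rho> p)" "x \<in> ball p (\<rho> p)"
      using p(2) xy(3) dist_triangle[of p y x] \<rho>[of p] K(1) p(1) by auto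
    then have "?path (C p) x y" using C xy p(1) K(1) by blast
    moreover have "C p * dist x y \<le> C' * dist x y"
      using K(2) p(1) by (intro mult_right_mono) (auto simp: C'_def)
    then have "cball x (C p * dist x y) \<subseteq> cball x (C' * dist x y)" by (rule subset_cball)
    ultimately show "?path C' x y" by blast
  qed
  moreover have "C' \<ge> 0" "\<epsilon> > 0" using K \<rho> by (auto simp: C'_def \<epsilon>_def)
  ultimately show ?thesis using that by blast
qed

section \<open>Taylor remainders along polygons\<close>

text \<open>All legs stay within C d of x, where d is the distance of x and y: the partial
  derivatives there are at most N (C d)^m and each leg has length at most 2 C d. Three legs give the
  factor 6. A derivative bound of order m becomes a bound of order m + 1, so repeated use climbs the
  Taylor expansion.\<close>

lemma locally_quasiconvex_bound:
  fixes v :: "real^'n \<Rightarrow> real" and N C :: real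
  assumes q: "locally_quasiconvex \<Omega> C \<epsilon>" and C: "C \<ge> 0" and N: "N \<ge> 0"
    and v: "\<And>z. z \<in> \<Omega> \<Longrightarrow> v differentiable (at z)"
    and bd: "\<And>z k. z \<in> \<Omega> \<Longrightarrow> \<bar>partial_deriv k v z\<bar> \<le> N * dist x z ^ m"
    and xy: "x \<in> \<Omega>" "y \<in> \<Omega>" "dist x y < \<epsilon>"
  shows "\<bar>v y - v x\<bar> \<le> 6 * real CARD('n) * N * C ^ Suc m * dist x y ^ Suc m"
proof -
  define d where "d = dist x y"
  obtain a b where ab: "closed_segment x a \<union> closed_segment a b \<union> closed_segment b y \<subseteq> \<Omega> \<inter> cball x (C * d)"
    using q xy unfolding locally_quasiconvex_def d_def by blast
  have seg: "\<bar>v p - v q\<bar> \<le> 2 * CARD('n) * N * C ^ Suc m * d ^ Suc m" if "closed_segment p q \<subseteq> \<Omega> \<inter> cball x (C * d)" for p q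
  proof -
    have "\<bar>v p - v q\<bar> \<le> CARD('n) * (N * (C * d) ^ m) * dist p q"
    proof (rule abs_diff_le_on_segment)
      fix z k assume z: "z \<in> closed_segment p q"
      then show "v differentiable (at z)" using v that by blast
      have "z \<in> \<Omega>" "dist x z \<le> C * d" using z that by auto
      then show "\<bar>partial_deriv k v z\<bar> \<le> N * (C * d) ^ m"
        using bd[of z k] N mult_left_mono[OF power_mono[of "dist x z" "C * d" m], of N] by force
    qed
    also have "dist p q \<le> 2 * (C * d)"
    proof -
      have "p \<in> cball x (C * d)" "q \<in> cball x (C * d)" using that by auto
      then show ?thesis using dist_triangle[of p q x] by (auto simp: dist_commute)
    qed
    then have "CARD('n) * (N * (C * d) ^ m) * dist p q \<le> CARD('n) * (N * (C * d) ^ m) * (2 * (C * d))"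
      using N C by (intro mult_left_mono) (auto simp: d_def)
    finally show ?thesis by (simp add: power_mult_distrib algebra_simps)
  qed
  have "\<bar>v x - v a\<bar> \<le> 2 * CARD('n) * N * C ^ Suc m * d ^ Suc m"
    "\<bar>v a - v b\<bar> \<le> 2 * CARD('n) * N * C ^ Suc m * d ^ Suc m"
    "\<bar>v b - v y\<bar> \<le> 2 * CARD('n) * N * C ^ Suc m * d ^ Suc m"
    by (rule seg; use ab in blast)+
  then have "\<bar>v y - v x\<bar> \<le> 3 * (2 * CARD('n) * N * C ^ Suc m * d ^ Suc m)" by linarith
  then show ?thesis by (simp add: d_def)
qed

lemma iter_partial_Nil [simp]: "iter_partial [] f = f"
  and iter_partial_Cons [simp]: "iter_partial (k # ks) f = partial_deriv k (iter_partial ks f)"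
  by (simp_all add: iter_partial_def)

text \<open>Each derivative agrees on \<Omega> with a continuous function on the compact closure,
  and there are only finitely many index lists of length at most k.\<close>

lemma Ck_closure_bounded:
  assumes "Ck_closure k \<Omega> u" "bounded \<Omega>"
  obtains B where "B \<ge> 0" "\<And>is x. length is \<le> k \<Longrightarrow> x \<in> \<Omega> \<Longrightarrow> \<bar>iter_partial is u x\<bar> \<le> B"
proof -
  have "\<exists>B. \<forall>x\<in>\<Omega>. \<bar>iter_partial is u x\<bar> \<le> B" if l: "length is \<le> k" for "is"
  proof -
    obtain h where h: "continuous_on (closure \<Omega>) h" "\<forall>x\<in>\<Omega>. h x = iter_partial is u x"
      using assms(1) l unfolding Ck_closure_def by metis
    have "bounded (h ` closure \<Omega>)"
      by (rule compact_imp_bounded[OF compact_continuous_image[OF h(1)]]) (use assms(2) in simp)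
    then obtain B where "\<forall>x\<in>h ` closure \<Omega>. norm x \<le> B" unfolding bounded_iff by blast
    then show ?thesis using h(2) closure_subset[of \<Omega>] by (metis image_eqI in_mono real_norm_def)
  qed
  then obtain B where B: "\<And>is x. length is \<le> k \<Longrightarrow> x \<in> \<Omega> \<Longrightarrow> \<bar>iter_partial is u x\<bar> \<le> B is" by metis
  let ?L = "{is. set is \<subseteq> UNIV \<and> length is \<le> k} :: 'a list set"
  have fin: "finite ?L" by (rule finite_lists_length_le) simp
  show ?thesis
  proof (rule that[of "Max (insert 0 (B ` ?L))"])
    fix "is" x assume l: "length (is :: 'a list) \<le> k" and x: "x \<in> \<Omega>"
    have "B is \<le> Max (insert 0 (B ` ?L))" using fin l by (intro Max_ge) auto
    then show "\<bar>iter_partial is u x\<bar> \<le> Max (insert 0 (B ` ?L))" using B[OF l x] by linarith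
  qed (use fin in auto)
qed

text \<open>At distance at least \<epsilon> the crude bound C2 is at most (C2 / \<epsilon>^m) d^m,
  so an estimate for nearby points becomes global at the price of a larger constant.\<close>

lemma bound_extends_far:
  fixes w d :: real
  assumes "d < \<epsilon> \<Longrightarrow> \<bar>w\<bar> \<le> C1 * d ^ m" "\<bar>w\<bar> \<le> C2" "\<epsilon> > 0" "d \<ge> 0" "C1 \<ge> 0"
  shows "\<bar>w\<bar> \<le> (C1 + C2 / \<epsilon> ^ m) * d ^ m"
proof (cases "d < \<epsilon>")
  case True
  have "0 \<le> C2 / \<epsilon> ^ m * d ^ m" using assms by (intro mult_nonneg_nonneg divide_nonneg_nonneg) auto
  then show ?thesis using assms(1)[OF True] by (simp add: distrib_right)
next
  case False
  have "C2 = C2 / \<epsilon> ^ m * \<epsilon> ^ m" using assms(3) by simp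
  also have "\<dots> \<le> C2 / \<epsilon> ^ m * d ^ m"
    using False assms by (intro mult_left_mono power_mono divide_nonneg_nonneg) auto
  finally have "C2 \<le> C2 / \<epsilon> ^ m * d ^ m" .
  moreover have "0 \<le> C1 * d ^ m" using assms by simp
  ultimately show ?thesis using assms(2) by (simp add: distrib_right)
qed

text \<open>Bounded third derivatives make the second derivatives Lipschitz; these give first
  derivatives with a quadratic remainder, and these give u with a cubic one. At each level the
  function minus its Taylor polynomial has a gradient controlled by the level before.\<close>

lemma Taylor_bounds_closure:
  fixes \<Omega> :: "(real^'n) set"
  assumes \<Omega>: "open \<Omega>" "bounded \<Omega>" "smooth_boundary \<Omega>" and u: "Ck_closure 4 \<Omega> u"
  obtains T where "T \<ge> 0"
    "\<And>x i. x \<in> \<Omega> \<Longrightarrow> \<bar>partial_deriv i u x\<bar> \<le> T"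
    "\<And>x i j. x \<in> \<Omega> \<Longrightarrow> \<bar>partial_deriv j (partial_deriv i u) x\<bar> \<le> T"
    "\<And>x y. x \<in> \<Omega> \<Longrightarrow> y \<in> \<Omega> \<Longrightarrow> \<bar>u y - u x\<bar> \<le> T * dist x y"
    "\<And>x y. x \<in> \<Omega> \<Longrightarrow> y \<in> \<Omega> \<Longrightarrow> \<bar>laplacian u y - laplacian u x\<bar> \<le> T * dist x y"
    "\<And>x y. x \<in> \<Omega> \<Longrightarrow> y \<in> \<Omega> \<Longrightarrow> \<bar>u y - u x - (\<Sum>i\<in>UNIV. partial_deriv i u x * (y - x) $ i)
       - (\<Sum>i\<in>UNIV. \<Sum>j\<in>UNIV. partial_deriv j (partial_deriv i u) x * ((y - x) $ i * (y - x) $ j)) / 2\<bar> \<le> T * dist x y ^ 3"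
proof -
  let ?n = "real CARD('n)"
  let ?A = "\<lambda>i. partial_deriv i u" and ?H = "\<lambda>j i. partial_deriv j (partial_deriv i u)"
  obtain B where B: "B \<ge> 0" "\<And>is x. length is \<le> 4 \<Longrightarrow> x \<in> \<Omega> \<Longrightarrow> \<bar>iter_partial is u x\<bar> \<le> B"
    using Ck_closure_bounded[OF u \<Omega>(2)] by blast
  have B0: "\<bar>u x\<bar> \<le> B" and B1: "\<bar>?A i x\<bar> \<le> B" and B2: "\<bar>?H j i x\<bar> \<le> B"
    and B3: "\<bar>partial_deriv k (?H j i) x\<bar> \<le> B" if "x \<in> \<Omega>" for x i j k
    using B(2)[of "[]" x] B(2)[of "[i]" x] B(2)[of "[j, i]" x] B(2)[of "[k, j, i]" x] that by simp_all
  have "Ck_on 4 \<Omega> u" using u by (simp add: Ck_closure_def)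
  then have C: "\<And>is x. length is < 4 \<Longrightarrow> x \<in> \<Omega> \<Longrightarrow> iter_partial is u differentiable (at x)"
    "\<And>is. length is \<le> 4 \<Longrightarrow> continuous_on \<Omega> (iter_partial is u)"
    unfolding Ck_on_def by blast+
  have D0: "u differentiable (at x)" and D1: "?A i differentiable (at x)" and D2: "?H j i differentiable (at x)"
    if "x \<in> \<Omega>" for x i j
    using C(1)[of "[]" x] C(1)[of "[i]" x] C(1)[of "[j, i]" x] that by simp_all
  have C2: "continuous_on \<Omega> (?H j i)" for j i using C(2)[of "[j, i]"] by simp
  have sym: "?H j i x = ?H i j x" if "x \<in> \<Omega>" for x i j
    by (rule partial_derivs_commute[OF \<Omega>(1) that D0 D1 C2])
  obtain Q \<epsilon> where q: "Q \<ge> 0" "\<epsilon> > 0" "locally_quasiconvex \<Omega> Q \<epsilon>"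
    using locally_quasiconvex_smooth_boundary[OF \<Omega>] by blast
  obtain R where R: "R > 0" "\<And>x y. x \<in> \<Omega> \<Longrightarrow> y \<in> \<Omega> \<Longrightarrow> dist x y \<le> R"
  proof -
    obtain r where "\<forall>x\<in>\<Omega>. \<forall>y\<in>\<Omega>. dist x y \<le> r" using \<Omega>(2) bounded_two_points by blast
    then show ?thesis using that[of "max 1 r"] by (meson less_max_iff_disj max.coboundedI2 zero_less_one)
  qed
  define K where "K m N = 6 * ?n * N * Q ^ Suc m" for m N
  have K0: "K m N \<ge> 0" if "N \<ge> 0" for m N using that q by (simp add: K_def)
  have nth_le: "\<bar>(y - x) $ i\<bar> \<le> dist x y" for x y :: "real^'n" and i
    using component_le_norm_cart[of "y - x" i] by (simp add: dist_norm norm_minus_commute)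

  define T0 where "T0 = K 0 B + 2 * B / \<epsilon> ^ 1"
  have T0: "T0 \<ge> 0" using K0 B q by (simp add: T0_def)
  have lip: "\<bar>v y - v x\<bar> \<le> T0 * dist x y"
    if "\<And>z. z \<in> \<Omega> \<Longrightarrow> v differentiable (at z)" "\<And>z. z \<in> \<Omega> \<Longrightarrow> \<bar>v z\<bar> \<le> B"
      "\<And>z k. z \<in> \<Omega> \<Longrightarrow> \<bar>partial_deriv k v z\<bar> \<le> B" "x \<in> \<Omega>" "y \<in> \<Omega>" for v :: "real^'n \<Rightarrow> real" and x y
  proof -
    have "\<bar>v y - v x\<bar> \<le> (K 0 B + 2 * B / \<epsilon> ^ 1) * dist x y ^ 1"
    proof (rule bound_extends_far)
      assume "dist x y < \<epsilon>"
      then show "\<bar>v y - v x\<bar> \<le> K 0 B * dist x y ^ 1"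
        using locally_quasiconvex_bound[OF q(3,1) B(1), of v x 0 y] that by (simp add: K_def)
    qed (use that(2)[OF that(4)] that(2)[OF that(5)] q K0 B in auto)
    then show ?thesis by (simp add: T0_def)
  qed
  have L0: "\<bar>u y - u x\<bar> \<le> T0 * dist x y" if "x \<in> \<Omega>" "y \<in> \<Omega>" for x y
    using that by (intro lip D0 B0 B1)
  have L2: "\<bar>?H j i y - ?H j i x\<bar> \<le> T0 * dist x y" if "x \<in> \<Omega>" "y \<in> \<Omega>" for x y i j
    using that by (intro lip D2 B2 B3)

  define a where "a x i = (\<chi> j. ?H j i x)" for x i
  have a_inner: "a x i \<bullet> h = (\<Sum>j\<in>UNIV. ?H j i x * h $ j)" for x i h
    by (simp add: a_def inner_vec_def)
  have a_bd: "\<bar>a x i \<bullet> (y - x)\<bar> \<le> ?n * (B * R)" if "x \<in> \<Omega>" "y \<in> \<Omega>" for x y i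
  proof -
    have "\<bar>a x i \<bullet> (y - x)\<bar> \<le> (\<Sum>j\<in>UNIV. \<bar>?H j i x * (y - x) $ j\<bar>)" unfolding a_inner by (rule sum_abs)
    also have "\<dots> \<le> ?n * (B * R)"
    proof (rule sum_bounded_above)
      fix j
      show "\<bar>?H j i x * (y - x) $ j\<bar> \<le> B * R"
        using B2[of x j i] nth_le[of y x j] R(2)[of x y] that B(1) unfolding abs_mult by (intro mult_mono) auto
    qed
    finally show ?thesis .
  qed
  define T1 where "T1 = K 1 T0 + (2 * B + ?n * (B * R)) / \<epsilon> ^ 2"
  have T1: "T1 \<ge> 0" using K0[OF T0] B q R by (simp add: T1_def)
  have L1: "\<bar>?A i y - ?A i x - a x i \<bullet> (y - x)\<bar> \<le> T1 * dist x y ^ 2" if xy: "x \<in> \<Omega>" "y \<in> \<Omega>" for x y i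
    unfolding T1_def
  proof (rule bound_extends_far)
    assume d: "dist x y < \<epsilon>"
    \<comment> \<open>The partial derivatives of \<open>?v\<close> are differences of second
      derivatives of u at z and x, hence linear in the distance.\<close>
    let ?v = "\<lambda>z. ?A i z - a x i \<bullet> (z - x)"
    have dv: "(?v has_derivative (\<lambda>h. grad (?A i) z \<bullet> h - a x i \<bullet> h)) (at z)" if "z \<in> \<Omega>" for z
      by (auto intro!: derivative_eq_intros has_derivative_grad[OF D1[OF that]])
    have "\<bar>?v y - ?v x\<bar> \<le> 6 * ?n * T0 * Q ^ Suc 1 * dist x y ^ Suc 1"
    proof (rule locally_quasiconvex_bound[where v = ?v and m = 1, OF q(3,1) T0 _ _ xy d])
      fix z k assume z: "z \<in> \<Omega>"
      show "?v differentiable (at z)" using dv[OF z] differentiableI by blast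
      have "partial_deriv k ?v z = ?H k i z - ?H k i x"
        using partial_deriv_eqI[OF dv[OF z], of k] by (simp add: inner_axis grad_def a_def)
      then show "\<bar>partial_deriv k ?v z\<bar> \<le> T0 * dist x z ^ 1" using L2[OF xy(1) z] by simp
    qed
    then show "\<bar>?A i y - ?A i x - a x i \<bullet> (y - x)\<bar> \<le> K 1 T0 * dist x y ^ 2"
      by (simp add: K_def numeral_2_eq_2 algebra_simps)
  next
    show "\<bar>?A i y - ?A i x - a x i \<bullet> (y - x)\<bar> \<le> 2 * B + ?n * (B * R)"
      using B1[OF xy(1), of i] B1[OF xy(2), of i] a_bd[OF xy, of i] by linarith
  qed (use q K0[OF T0] in auto)

  let ?quad = "\<lambda>x z. (\<Sum>i\<in>UNIV. (axis i 1 \<bullet> (z - x)) * (a x i \<bullet> (z - x))) / 2"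
  have g_bd: "\<bar>grad u x \<bullet> (y - x)\<bar> \<le> ?n * (B * R)" and q_bd: "\<bar>?quad x y\<bar> \<le> ?n * (R * (?n * (B * R)))"
    if xy: "x \<in> \<Omega>" "y \<in> \<Omega>" for x y
  proof -
    have "\<bar>grad u x \<bullet> (y - x)\<bar> \<le> (\<Sum>i\<in>UNIV. \<bar>?A i x * (y - x) $ i\<bar>)"
      unfolding grad_def inner_vec_def by simp
    also have "\<dots> \<le> ?n * (B * R)"
    proof (rule sum_bounded_above)
      fix i
      show "\<bar>?A i x * (y - x) $ i\<bar> \<le> B * R"
        using B1[of x i] nth_le[of y x i] R(2)[of x y] xy B(1) unfolding abs_mult by (intro mult_mono) auto
    qed
    finally show "\<bar>grad u x \<bullet> (y - x)\<bar> \<le> ?n * (B * R)" .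
    have "\<bar>\<Sum>i\<in>UNIV. (axis i 1 \<bullet> (y - x)) * (a x i \<bullet> (y - x))\<bar> \<le> (\<Sum>i\<in>UNIV. \<bar>(axis i 1 \<bullet> (y - x)) * (a x i \<bullet> (y - x))\<bar>)"
      by (rule sum_abs)
    also have "\<dots> \<le> ?n * (R * (?n * (B * R)))"
    proof (rule sum_bounded_above)
      fix i
      show "\<bar>(axis i 1 \<bullet> (y - x)) * (a x i \<bullet> (y - x))\<bar> \<le> R * (?n * (B * R))"
        using nth_le[of y x i] R(2)[of x y] R(1) xy a_bd[OF xy, of i] unfolding abs_mult inner_axis'
        by (intro mult_mono) auto
    qed
    finally show "\<bar>?quad x y\<bar> \<le> ?n * (R * (?n * (B * R)))" by simp
  qed
  define T2 where "T2 = K 2 T1 + (2 * B + ?n * (B * R) + ?n * (R * (?n * (B * R)))) / \<epsilon> ^ 3"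
  have T2: "T2 \<ge> 0" using K0[OF T1] B q R by (simp add: T2_def)
  have L3: "\<bar>u y - u x - grad u x \<bullet> (y - x) - ?quad x y\<bar> \<le> T2 * dist x y ^ 3" if xy: "x \<in> \<Omega>" "y \<in> \<Omega>" for x y
    unfolding T2_def
  proof (rule bound_extends_far)
    assume d: "dist x y < \<epsilon>"
    let ?v = "\<lambda>z. u z - grad u x \<bullet> (z - x) - ?quad x z"
    have dv: "(?v has_derivative (\<lambda>h. grad u z \<bullet> h - grad u x \<bullet> h -
       (\<Sum>i\<in>UNIV. (axis i 1 \<bullet> (z - x)) * (a x i \<bullet> h) + (axis i 1 \<bullet> h) * (a x i \<bullet> (z - x))) / 2)) (at z)" if "z \<in> \<Omega>" for z
      by (auto intro!: derivative_eq_intros has_derivative_grad[OF D0[OF that]])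
    have "\<bar>?v y - ?v x\<bar> \<le> 6 * ?n * T1 * Q ^ Suc 2 * dist x y ^ Suc 2"
    proof (rule locally_quasiconvex_bound[where v = ?v and m = 2, OF q(3,1) T1 _ _ xy d])
      fix z k assume z: "z \<in> \<Omega>"
      show "?v differentiable (at z)" using dv[OF z] differentiableI by blast
      \<comment> \<open>Differentiating the quadratic form gives a row term and a column term of the
        Hessian. Symmetry makes them equal, and the factor 1/2 removes the duplication.\<close>
      have "(\<Sum>i\<in>UNIV. (axis i 1 \<bullet> (z - x)) * (a x i \<bullet> axis k 1) + (axis i 1 \<bullet> (axis k 1 :: real^'n)) * (a x i \<bullet> (z - x)))
          = (\<Sum>i\<in>UNIV. ?H i k x * (z - x) $ i + (if i = k then a x k \<bullet> (z - x) else 0))"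
      proof (rule sum.cong[OF refl])
        fix i
        have e1: "axis i 1 \<bullet> (axis k 1 :: real^'n) = (if i = k then 1 else 0)"
          by (simp add: inner_axis) (simp add: axis_def)
        have e2: "a x i \<bullet> axis k 1 = ?H i k x" using sym[OF xy(1)] by (simp add: inner_axis a_def)
        have e3: "(axis i 1 :: real^'n) \<bullet> (z - x) = (z - x) $ i" by (simp add: inner_axis')
        show "(axis i 1 \<bullet> (z - x)) * (a x i \<bullet> axis k 1) + (axis i 1 \<bullet> (axis k 1 :: real^'n)) * (a x i \<bullet> (z - x))
          = ?H i k x * (z - x) $ i + (if i = k then a x k \<bullet> (z - x) else 0)"
          using e1 e2 e3 by simp
      qed
      also have "\<dots> = 2 * (a x k \<bullet> (z - x))"
        by (simp add: sum.distrib a_inner)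
      finally have "partial_deriv k ?v z = ?A k z - ?A k x - a x k \<bullet> (z - x)"
        using partial_deriv_eqI[OF dv[OF z], of k] by (simp add: inner_axis grad_def)
      then show "\<bar>partial_deriv k ?v z\<bar> \<le> T1 * dist x z ^ 2" using L1[OF xy(1) z] by simp
    qed
    then show "\<bar>u y - u x - grad u x \<bullet> (y - x) - ?quad x y\<bar> \<le> K 2 T1 * dist x y ^ 3"
      by (simp add: K_def numeral_3_eq_3 numeral_2_eq_2 algebra_simps)
  next
    show "\<bar>u y - u x - grad u x \<bullet> (y - x) - ?quad x y\<bar> \<le> 2 * B + ?n * (B * R) + ?n * (R * (?n * (B * R)))"
      using B0[OF xy(1)] B0[OF xy(2)] g_bd[OF xy] q_bd[OF xy] by linarith
  qed (use q K0[OF T1] in auto)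
  \<comment> \<open>A single constant dominates the derivative bound, the Lipschitz constants and
    the cubic remainder; \<open>?n * T0\<close> covers the n diagonal terms of the
    Laplacian.\<close>
  define T where "T = B + ?n * T0 + T2"
  have n1: "?n \<ge> 1" by (simp add: Suc_leI)
  have T0n: "T0 \<le> ?n * T0" using n1 T0 by (simp add: mult_le_cancel_right1)
  have T: "B \<le> T" "T0 \<le> T" "?n * T0 \<le> T" "T2 \<le> T" "T \<ge> 0"
    using B(1) T0 T2 T0n by (auto simp: T_def)
  show ?thesis
  proof (rule that[of T])
    fix x y assume xy: "x \<in> \<Omega>" "y \<in> \<Omega>"
    show "\<bar>u y - u x\<bar> \<le> T * dist x y"
      using L0[OF xy] mult_right_mono[OF T(2), of "dist x y"] by simp
    have "\<bar>laplacian u y - laplacian u x\<bar> \<le> (\<Sum>i\<in>UNIV. \<bar>?H i i y - ?H i i x\<bar>)"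
      unfolding laplacian_def sum_subtractf[symmetric] by (rule sum_abs)
    also have "\<dots> \<le> ?n * (T0 * dist x y)" by (rule sum_bounded_above) (rule L2[OF xy])
    also have "\<dots> \<le> T * dist x y" using mult_right_mono[OF T(3), of "dist x y"] by simp
    finally show "\<bar>laplacian u y - laplacian u x\<bar> \<le> T * dist x y" .
    have "?quad x y = (\<Sum>i\<in>UNIV. \<Sum>j\<in>UNIV. ?H j i x * ((y - x) $ i * (y - x) $ j)) / 2"
      unfolding a_inner inner_axis' sum_distrib_left by (simp add: mult_ac)
    moreover have "grad u x \<bullet> (y - x) = (\<Sum>i\<in>UNIV. ?A i x * (y - x) $ i)"
      by (simp add: grad_def inner_vec_def)
    ultimately show "\<bar>u y - u x - (\<Sum>i\<in>UNIV. ?A i x * (y - x) $ i)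
       - (\<Sum>i\<in>UNIV. \<Sum>j\<in>UNIV. ?H j i x * ((y - x) $ i * (y - x) $ j)) / 2\<bar> \<le> T * dist x y ^ 3"
      using L3[OF xy] mult_right_mono[OF T(4), of "dist x y ^ 3"] by simp
  qed (auto intro: T(5) order_trans[OF B1 T(1)] order_trans[OF B2 T(1)])
qed

section \<open>The minimum principle\<close>

text \<open>The negative part \<open>n\<close> of \<open>h\<close> satisfies \<open>(\<integral>k x y \<partial>y) n x \<le> \<integral>k x y n y \<partial>y\<close>, strictly where \<open>n > 0\<close>, while
  both sides have the same integral by the symmetry of \<open>k\<close>.  So \<open>h \<ge> 0\<close> almost everywhere, and the
  inequality at a single point then gives the sign of \<open>h\<close> there; no continuity of \<open>h\<close> enters.\<close>

lemma nonlocal_minimum_principle: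
  fixes M :: "'a measure" and k :: "'a \<Rightarrow> 'a \<Rightarrow> real" and h \<beta> :: "'a \<Rightarrow> real"
  assumes "finite_measure M"
    and k_meas: "(\<lambda>(x, y). k x y) \<in> borel_measurable (M \<Otimes>\<^sub>M M)"
    and k_bounds: "\<And>x y. 0 \<le> k x y" "\<And>x y. k x y \<le> B" and k_sym: "\<And>x y. k x y = k y x"
    and h: "integrable M h" and \<beta>: "\<And>x. x \<in> space M \<Longrightarrow> 0 \<le> \<beta> x"
    and pos: "\<And>x. x \<in> space M \<Longrightarrow> (LINT y|M. k x y * (h x - h y)) + \<beta> x * h x > 0"
    and x: "x \<in> space M"
  shows "h x \<ge> 0"
proof -
  interpret finite_measure M by fact
  interpret P: pair_sigma_finite M M ..
  have [measurable]: "h \<in> borel_measurable M" using h by auto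
  note k_meas[measurable]
  have kx[measurable]: "(\<lambda>y. k x y) \<in> borel_measurable M" if "x \<in> space M" for x
    using measurable_Pair2[OF k_meas that] by simp
  have B0: "\<bar>k x y\<bar> \<le> B" for x y using k_bounds[of x y] by simp
  have ik: "integrable M (\<lambda>y. k x y * g y)" if g: "integrable M g" and x: "x \<in> space M" for g x
  proof (rule Bochner_Integration.integrable_bound[OF integrable_mult_right[OF integrable_abs[OF g], of B]])
    show "(\<lambda>y. k x y * g y) \<in> borel_measurable M" using kx[OF x] g by measurable
    show "AE y in M. norm (k x y * g y) \<le> norm (B * \<bar>g y\<bar>)"
      using B0[of x] order_trans[OF abs_ge_zero B0[of x]] by (auto simp: abs_mult intro!: mult_right_mono)
  qed
  define a where "a x = (LINT y|M. k x y)" for x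
  define n where "n y = max 0 (- h y)" for y
  have n: "integrable M n" unfolding n_def using h by auto
  have n0: "n y \<ge> 0" "- h y \<le> n y" for y by (auto simp: n_def)
  have ik1: "integrable M (\<lambda>y. k x y)" if "x \<in> space M" for x
    using ik[of "\<lambda>_. 1" x] that by simp
  have a0: "a x \<ge> 0" for x unfolding a_def using k_bounds(1) by simp
  have split: "(LINT y|M. k x y * (h x - h y)) = a x * h x - (LINT y|M. k x y * h y)" if "x \<in> space M" for x
    using ik[OF h that] ik1[OF that] by (simp add: right_diff_distrib a_def)
  have neg: "a x * n x < (LINT y|M. k x y * n y)" if x: "x \<in> space M" "h x < 0" for x
  proof -
    have "\<beta> x * h x \<le> 0" using \<beta>[OF x(1)] x(2) by (simp add: mult_nonneg_nonpos)
    with pos[OF x(1)] split[OF x(1)] have "a x * n x < - (LINT y|M. k x y * h y)"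
      using x(2) by (simp add: n_def)
    also have "\<dots> = (LINT y|M. k x y * (- h y))" by simp
    also have "\<dots> \<le> (LINT y|M. k x y * n y)"
      by (intro integral_mono ik n x integrable_minus h mult_left_mono n0 k_bounds)
    finally show ?thesis .
  qed
  have nonneg: "0 \<le> (LINT y|M. k x y * n y) - a x * n x" if x: "x \<in> space M" for x
  proof (cases "h x < 0")
    case False
    then have "n x = 0" by (simp add: n_def)
    then show ?thesis using k_bounds n0 by (auto intro!: Bochner_Integration.integral_nonneg)
  qed (use neg[OF x] in simp)
  \<comment> \<open>k is bounded and M is finite, so B n(y), viewed as a function of both variables,
    is an integrable majorant and Fubini applies.\<close>
  have int2: "integrable (M \<Otimes>\<^sub>M M) (\<lambda>(x, y). k x y * n y)"
  proof (rule Bochner_Integration.integrable_bound)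
    show "integrable (M \<Otimes>\<^sub>M M) (\<lambda>(x, y). B * n y)"
      by (rule P.Fubini_integrable) (use n in auto)
    show "(\<lambda>(x, y). k x y * n y) \<in> borel_measurable (M \<Otimes>\<^sub>M M)"
      unfolding n_def by measurable
    show "AE p in M \<Otimes>\<^sub>M M. norm (case p of (x, y) \<Rightarrow> k x y * n y) \<le> norm (case p of (x, y) \<Rightarrow> B * n y)"
      using B0 order_trans[OF abs_ge_zero B0] n0
      by (auto simp: abs_mult intro!: AE_I2 mult_right_mono)
  qed
  have i1: "integrable M (\<lambda>x. LINT y|M. k x y * n y)"
    using P.integrable_fst[OF int2] .
  have i2: "integrable M (\<lambda>x. a x * n x)"
    using P.integrable_snd[OF int2] unfolding a_def by (simp add: k_sym)
  have "(LINT x|M. LINT y|M. k x y * n y) = (LINT y|M. LINT x|M. k x y * n y)"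
    using P.Fubini_integral[OF int2] by simp
  also have "\<dots> = (LINT x|M. a x * n x)" unfolding a_def by (simp add: k_sym)
  finally have "(LINT x|M. (LINT y|M. k x y * n y) - a x * n x) = 0"
    using i1 i2 by simp
  then have "AE x in M. (LINT y|M. k x y * n y) - a x * n x = 0"
    by (subst (asm) integral_nonneg_eq_0_iff_AE) (use i1 i2 nonneg in auto)
  then have "AE x in M. h x \<ge> 0"
    using AE_space by eventually_elim (use neg in force)
  then have "0 \<le> (LINT y|M. k x y * h y)"
    using k_bounds by (intro integral_nonneg_AE) auto
  with pos[OF x] split[OF x] have "(a x + \<beta> x) * h x > 0" by (simp add: algebra_simps)
  then show ?thesis using a0[of x] \<beta>[OF x] by (smt (verit) mult_nonneg_nonpos)
qed

section \<open>Moments of the kernel\<close>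

locale radial_kernel =
  fixes R :: "real \<Rightarrow> real" and b :: real
  assumes cont: "continuous_on {0..1} R"
    and nonneg: "0 \<le> r \<Longrightarrow> 0 \<le> R r"
    and bound: "0 \<le> r \<Longrightarrow> R r \<le> b"
    and support: "r > 1 \<Longrightarrow> R r = 0"
begin

text \<open>\<open>R\<close> may jump at \<open>1\<close>, so its tail integral need not be differentiable there.  The continuous majorants
  below converge to \<open>R\<close> pointwise on the half line; \<open>max 0 r\<close> hides the unconstrained values of \<open>R\<close> at
  negative arguments.\<close>

definition ramp :: "nat \<Rightarrow> real \<Rightarrow> real" where
  "ramp k r = (if r \<le> 1 then R (max 0 r) else R 1 * max 0 (1 - real (Suc k) * (r - 1)))"

lemma b_nonneg: "0 \<le> b"
  using nonneg[of 0] bound[of 0] by simp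

lemma continuous_on_ramp: "continuous_on A (ramp k)"
proof -
  have "continuous_on ({..1} \<union> {1..}) (\<lambda>r. if r \<le> 1 then R (max 0 r) else R 1 * max 0 (1 - real (Suc k) * (r - 1)))"
  proof (rule continuous_on_If)
    show "continuous_on {..1} (\<lambda>r. R (max 0 r))"
      by (rule continuous_on_compose2[OF cont]) (auto intro!: continuous_intros)
    show "continuous_on {1..} (\<lambda>r. R 1 * max 0 (1 - real (Suc k) * (r - 1)))"
      by (intro continuous_intros)
  qed auto
  moreover have "{..1} \<union> {1..} = (UNIV :: real set)" by auto
  ultimately show ?thesis unfolding ramp_def[abs_def] using continuous_on_subset by fastforce
qed

lemma ramp_bounds: "0 \<le> ramp k r" "ramp k r \<le> b"
proof -
  show "0 \<le> ramp k r" by (simp add: ramp_def nonneg)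
  have "R 1 * max 0 (1 - real (Suc k) * (r - 1)) \<le> b * 1" if "r > 1"
  proof (rule mult_mono)
    have "0 \<le> real (Suc k) * (r - 1)" using that by (intro mult_nonneg_nonneg) auto
    then show "max 0 (1 - real (Suc k) * (r - 1)) \<le> 1" by simp
  qed (use bound[of 1] b_nonneg in auto)
  then show "ramp k r \<le> b" by (simp add: ramp_def bound)
qed

lemma ramp_far: "1 + 1 / real (Suc k) \<le> r \<Longrightarrow> ramp k r = 0"
proof -
  assume r: "1 + 1 / real (Suc k) \<le> r"
  then have "1 < r" by (smt (verit) divide_pos_pos of_nat_0_less_iff zero_less_Suc)
  moreover have "1 \<le> real (Suc k) * (r - 1)"
    using mult_left_mono[of "1 / real (Suc k)" "r - 1" "real (Suc k)"] r by simp
  ultimately show ?thesis by (simp add: ramp_def)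
qed

lemma ramp_near: "0 \<le> r \<Longrightarrow> r \<le> 1 \<Longrightarrow> ramp k r = R r"
  by (simp add: ramp_def)

lemma ramp_LIMSEQ:
  assumes "0 \<le> r" shows "(\<lambda>k. ramp k r) \<longlonglongrightarrow> R r"
proof (cases "r \<le> 1")
  case False
  obtain n where n: "1 / (r - 1) < real n" using reals_Archimedean2 by blast
  have "eventually (\<lambda>k. ramp k r = 0) sequentially"
    unfolding eventually_sequentially
  proof (intro exI allI impI)
    fix k assume "n \<le> k"
    then have "1 / (r - 1) < real (Suc k)" using n by linarith
    then have "1 / real (Suc k) \<le> r - 1" using False by (simp add: field_simps)
    then show "ramp k r = 0" by (intro ramp_far) linarith
  qed
  then show ?thesis using support[of r] False by (simp add: tendsto_eventually)
qed (use assms in \<open>simp add: ramp_near\<close>)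

lemma integrable_tail: "0 \<le> r \<Longrightarrow> integrable lborel (\<lambda>s. indicator {r..} s *\<^sub>R R s)"
proof -
  assume r: "0 \<le> r"
  have "integrable lborel (\<lambda>s. indicator {0..1} s *\<^sub>R R s)"
    by (rule borel_integrable_compact) (auto simp: cont)
  from integrable_mult_indicator[OF _ this, of "{r..}"]
  have "integrable lborel (\<lambda>s. indicator {r..} s *\<^sub>R (indicator {0..1} s *\<^sub>R R s))" by simp
  also have "(\<lambda>s. indicator {r..} s *\<^sub>R (indicator {0..1} s *\<^sub>R R s)) = (\<lambda>s. indicator {r..} s *\<^sub>R R s)"
    using r support by (auto simp: indicator_def fun_eq_iff)
  finally show ?thesis .
qed

lemma integrable_tail_ramp: "integrable lborel (\<lambda>s. indicator {r..} s *\<^sub>R ramp k s)"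
proof -
  have "integrable lborel (\<lambda>s. indicator {r..2} s *\<^sub>R ramp k s)"
    by (rule borel_integrable_compact) (auto simp: continuous_on_ramp)
  also have "(\<lambda>s. indicator {r..2} s *\<^sub>R ramp k s) = (\<lambda>s. indicator {r..} s *\<^sub>R ramp k s)"
  proof
    fix s
    have "ramp k s = 0" if "s > 2"
    proof (rule ramp_far)
      have "1 / real (Suc k) \<le> 1" by simp
      then show "1 + 1 / real (Suc k) \<le> s" using that by linarith
    qed
    then show "indicator {r..2} s *\<^sub>R ramp k s = indicator {r..} s *\<^sub>R ramp k s"
      by (auto simp: indicator_def)
  qed
  finally show ?thesis .
qed

text \<open>The bound b of R serves for the tail as well, because R is supported in an interval of
  length one.\<close>

lemma tail_bounds:
  assumes "0 \<le> r"
  shows "0 \<le> tail_integral R r" "tail_integral R r \<le> b"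
proof -
  show "0 \<le> tail_integral R r"
    unfolding tail_integral_def set_lebesgue_integral_def
    by (rule Bochner_Integration.integral_nonneg) (use assms nonneg in \<open>auto simp: indicator_def\<close>)
  have "tail_integral R r \<le> (LINT s|lborel. b * indicator {0..1::real} s)"
    unfolding tail_integral_def set_lebesgue_integral_def
  proof (rule integral_mono[OF integrable_tail[OF assms]])
    show "indicator {r..} s *\<^sub>R R s \<le> b * indicator {0..1} s" for s
      using assms bound support b_nonneg by (auto simp: indicator_def)
  qed simp
  then show "tail_integral R r \<le> b" by simp
qed

lemma tail_support: "r > 1 \<Longrightarrow> tail_integral R r = 0"
  unfolding tail_integral_def set_lebesgue_integral_def
  by (rule integral_eq_zero_AE) (use support in \<open>auto simp: indicator_def\<close>)

text \<open>On the half line the majorant exceeds R only on an interval of length 1/(k + 1) to the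
  right of 1, and by at most b. The error is uniform in r, which controls the boundary integral in
  the limit.\<close>

lemma tail_ramp:
  assumes "0 \<le> r"
  shows "tail_integral R r \<le> tail_integral (ramp k) r"
    "tail_integral (ramp k) r \<le> tail_integral R r + b / real (Suc k)"
proof -
  have le: "R s \<le> ramp k s" if "0 \<le> s" for s
    using that support ramp_bounds(1) ramp_near[of s k] by (cases "s \<le> 1") auto
  show "tail_integral R r \<le> tail_integral (ramp k) r"
    unfolding tail_integral_def set_lebesgue_integral_def
    by (rule integral_mono[OF integrable_tail[OF assms] integrable_tail_ramp])
       (use assms le in \<open>auto simp: indicator_def\<close>)
  have "tail_integral (ramp k) r \<le> (LINT s|lborel. indicator {r..} s *\<^sub>R R s + b * indicator {1..1 + 1 / real (Suc k)} s)"
    unfolding tail_integral_def set_lebesgue_integral_def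
  proof (rule integral_mono)
    fix s
    show "indicator {r..} s *\<^sub>R ramp k s \<le> indicator {r..} s *\<^sub>R R s + b * indicator {1..1 + 1 / real (Suc k)} s"
    proof (cases "s \<le> 1")
      case True
      then show ?thesis using assms ramp_near[of s k] b_nonneg by (auto simp: indicator_def)
    next
      case False
      then show ?thesis
        using ramp_far[of k s] ramp_bounds(2)[of k s] support[of s] b_nonneg by (auto simp: indicator_def)
    qed
  qed (auto intro!: integrable_tail[OF assms, simplified] integrable_tail_ramp[simplified])
  also have "\<dots> = tail_integral R r + b / real (Suc k)"
    using integrable_tail[OF assms] unfolding tail_integral_def set_lebesgue_integral_def
    by (subst Bochner_Integration.integral_add) auto
  finally show "tail_integral (ramp k) r \<le> tail_integral R r + b / real (Suc k)" .
qed

lemma tail_ramp_LIMSEQ: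
  assumes "0 \<le> r" shows "(\<lambda>k. tail_integral (ramp k) r) \<longlonglongrightarrow> tail_integral R r"
proof (rule tendsto_sandwich[OF _ _ tendsto_const])
  have "(\<lambda>k. b * inverse (real (Suc k))) \<longlonglongrightarrow> b * 0"
    by (intro tendsto_intros LIMSEQ_inverse_real_of_nat)
  then show "(\<lambda>k. tail_integral R r + b / real (Suc k)) \<longlonglongrightarrow> tail_integral R r"
    using tendsto_add[OF tendsto_const] by (fastforce simp: divide_inverse)
qed (use tail_ramp[OF assms] in auto)

lemma DERIV_tail_ramp: "(tail_integral (ramp k) has_real_derivative - ramp k r) (at r)"
proof -
  \<comment> \<open>Every \<open>ramp k\<close> vanishes beyond 2, so \<open>c\<close> is a finite
    upper limit valid for all arguments in a neighbourhood of r; the tail there is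
    \<open>F c - F x\<close>.\<close>
  define c where "c = max 2 (r + 1)"
  define F where "F x = integral {r - 1..x} (ramp k)" for x
  have "(F has_real_derivative ramp k r) (at r within {r - 1..c})"
    unfolding F_def by (rule integral_has_real_derivative[OF continuous_on_ramp]) (auto simp: c_def)
  then have "(F has_real_derivative ramp k r) (at r)"
    by (subst (asm) at_within_Icc_at) (auto simp: c_def)
  then have "((\<lambda>x. F c - F x) has_real_derivative - ramp k r) (at r)"
    by (auto intro!: derivative_eq_intros)
  then show ?thesis
  proof (rule has_field_derivative_transform_within_open[of _ _ _ "{r - 1<..<r + 1}"])
    fix x assume x: "x \<in> {r - 1<..<r + 1}"
    have int: "ramp k integrable_on {r - 1..c}" by (intro integrable_continuous_real continuous_on_ramp)
    have "F x + integral {x..c} (ramp k) = F c"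
      unfolding F_def by (rule Henstock_Kurzweil_Integration.integral_combine[OF _ _ int]) (use x in \<open>auto simp: c_def\<close>)
    moreover have "tail_integral (ramp k) x = (LINT s:{x..c}|lborel. ramp k s)"
      unfolding tail_integral_def set_lebesgue_integral_def
    proof (rule Bochner_Integration.integral_cong[OF refl])
      fix s
      have "ramp k s = 0" if "s > c"
      proof (rule ramp_far)
        have "1 / real (Suc k) \<le> 1" by simp
        then show "1 + 1 / real (Suc k) \<le> s" using that unfolding c_def by linarith
      qed
      then show "indicator {x..} s *\<^sub>R ramp k s = indicator {x..c} s *\<^sub>R ramp k s"
        by (auto simp: indicator_def)
    qed
    moreover have "(LINT s:{x..c}|lborel. ramp k s) = integral {x..c} (ramp k)"
      unfolding set_lebesgue_integral_def
      by (rule set_borel_integral_eq_integral(2)[unfolded set_lebesgue_integral_def set_integrable_def])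
         (rule borel_integrable_compact, auto simp: continuous_on_ramp)
    ultimately show "F c - F x = tail_integral (ramp k) x" by simp
  qed (use c_def in auto)
qed

text \<open>R is constrained only on the nonnegative half line, so measurability is established for
  its even reflection. The kernel evaluates it at squares, where the absolute value is
  harmless.\<close>

lemma borel_measurable_R: "(\<lambda>r. R \<bar>r\<bar>) \<in> borel_measurable borel"
proof -
  have "(\<lambda>r. indicator {-1..1} r *\<^sub>R R \<bar>r\<bar>) \<in> borel_measurable borel"
  proof (rule borel_measurable_continuous_on_indicator)
    show "continuous_on {-1..1} (\<lambda>r. R \<bar>r\<bar>)"
      by (rule continuous_on_compose2[OF cont]) (auto intro!: continuous_intros)
  qed simp
  also have "(\<lambda>r. indicator {-1..1} r *\<^sub>R R \<bar>r\<bar>) = (\<lambda>r. R \<bar>r\<bar>)"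
  proof
    fix r :: real
    show "indicator {-1..1} r *\<^sub>R R \<bar>r\<bar> = R \<bar>r\<bar>"
      using support[of "\<bar>r\<bar>"] by (cases "\<bar>r\<bar> \<le> 1") (auto simp: abs_le_iff)
  qed
  finally show ?thesis .
qed

lemma borel_measurable_tail: "(\<lambda>r. tail_integral R \<bar>r\<bar>) \<in> borel_measurable borel"
proof (rule borel_measurable_LIMSEQ_real)
  show "(\<lambda>k. tail_integral (ramp k) \<bar>r\<bar>) \<longlonglongrightarrow> tail_integral R \<bar>r\<bar>" for r
    by (rule tail_ramp_LIMSEQ) simp
  have "continuous_on UNIV (tail_integral (ramp k))" for k
    using DERIV_continuous[OF DERIV_tail_ramp] by (simp add: continuous_at_imp_continuous_on)
  then show "(\<lambda>r. tail_integral (ramp k) \<bar>r\<bar>) \<in> borel_measurable borel" for k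
    by (rule borel_measurable_continuous_onI[OF continuous_on_compose2[OF _ continuous_on_rabs[OF continuous_on_id]]]) simp
qed

lemma scaled_kernel_nonneg:
  assumes "0 \<le> \<alpha>" "0 < \<delta>"
  shows "0 \<le> scaled_kernel \<alpha> R \<delta> x y" "0 \<le> scaled_kernel \<alpha> (tail_integral R) \<delta> x y"
  unfolding scaled_kernel_def using assms
  by (auto intro!: mult_nonneg_nonneg divide_nonneg_nonneg nonneg tail_bounds)

lemma scaled_kernel_bounded:
  fixes x y :: "real^'n"
  assumes "0 \<le> \<alpha>" "0 < \<delta>"
  shows "scaled_kernel \<alpha> R \<delta> x y \<le> \<alpha> / \<delta> ^ CARD('n) * b"
    "scaled_kernel \<alpha> (tail_integral R) \<delta> x y \<le> \<alpha> / \<delta> ^ CARD('n) * b"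
  unfolding scaled_kernel_def using assms
  by (intro mult_left_mono bound tail_bounds divide_nonneg_nonneg; simp)+

lemma scaled_kernel_support:
  assumes "0 < \<delta>" "2 * \<delta> < dist x y"
  shows "scaled_kernel \<alpha> R \<delta> x y = 0" "scaled_kernel \<alpha> (tail_integral R) \<delta> x y = 0"
proof -
  have "(2 * \<delta>)\<^sup>2 < (dist x y)\<^sup>2" using assms by (intro power_strict_mono) auto
  then have "1 < (norm (x - y))\<^sup>2 / (4 * \<delta>\<^sup>2)" using assms(1) by (simp add: dist_norm power_mult_distrib)
  then show "scaled_kernel \<alpha> R \<delta> x y = 0" "scaled_kernel \<alpha> (tail_integral R) \<delta> x y = 0"
    unfolding scaled_kernel_def using support tail_support by auto
qed

lemma borel_measurable_scaled_kernel:
  fixes f g :: "'c \<Rightarrow> real^'n"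
  assumes [measurable]: "f \<in> borel_measurable M" "g \<in> borel_measurable M"
  shows "(\<lambda>z. scaled_kernel \<alpha> R \<delta> (f z) (g z)) \<in> borel_measurable M"
    "(\<lambda>z. scaled_kernel \<alpha> (tail_integral R) \<delta> (f z) (g z)) \<in> borel_measurable M"
proof -
  have m: "(\<lambda>z. (norm (f z - g z))\<^sup>2 / (4 * \<delta>\<^sup>2)) \<in> borel_measurable M" by measurable
  have "(\<lambda>z. R \<bar>(norm (f z - g z))\<^sup>2 / (4 * \<delta>\<^sup>2)\<bar>) \<in> borel_measurable M"
    by (rule measurable_compose[OF m borel_measurable_R])
  then show "(\<lambda>z. scaled_kernel \<alpha> R \<delta> (f z) (g z)) \<in> borel_measurable M"
    unfolding scaled_kernel_def by simp
  have "(\<lambda>z. tail_integral R \<bar>(norm (f z - g z))\<^sup>2 / (4 * \<delta>\<^sup>2)\<bar>) \<in> borel_measurable M"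
    by (rule measurable_compose[OF m borel_measurable_tail])
  then show "(\<lambda>z. scaled_kernel \<alpha> (tail_integral R) \<delta> (f z) (g z)) \<in> borel_measurable M"
    unfolding scaled_kernel_def by simp
qed

end

section \<open>The boundary measure and integration by parts for the kernel\<close>

lemma finite_measure_surface:
  fixes \<Omega> :: "(real^'n) set"
  assumes "open \<Omega>" "bounded \<Omega>" "smooth_boundary \<Omega>" "is_surface_measure \<Omega> S"
  shows "finite_measure (restrict_space S (frontier \<Omega>))"
proof (rule finite_measure_restrict_space)
  have sS: "sets S = sets borel" using assms(4) by (simp add: is_surface_measure_def)
  show "finite_measure S"
    using emeasure_surface_measure_finite[OF assms] sets_eq_imp_space_eq[OF sS]
    by (intro finite_measureI) auto
  show "frontier \<Omega> \<in> sets S" using sS by (simp add: borel_closed frontier_closed)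
qed

lemma nn_integral_restrict_frontier:
  assumes "is_surface_measure \<Omega> S"
  shows "(\<integral>\<^sup>+ y. f y \<partial>S) = (\<integral>\<^sup>+ y. f y \<partial>restrict_space S (frontier \<Omega>))"
proof -
  have sS: "sets S = sets borel" and null: "emeasure S (- frontier \<Omega>) = 0"
    using assms by (auto simp: is_surface_measure_def)
  have fr: "frontier \<Omega> \<in> sets S" using sS by (simp add: borel_closed frontier_closed)
  have "- frontier \<Omega> \<in> null_sets S"
    using null sS by (auto intro!: borel_open open_Compl frontier_closed)
  then have "AE y in S. y \<in> frontier \<Omega>" using AE_not_in by force
  then have "(\<integral>\<^sup>+ y. f y \<partial>S) = (\<integral>\<^sup>+ y. f y * indicator (frontier \<Omega>) y \<partial>S)"
    by (intro nn_integral_cong_AE) (auto simp: indicator_def)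
  then show ?thesis using fr by (simp add: nn_integral_restrict_space)
qed

lemma (in radial_kernel) kernel_flux_bound:
  fixes \<Omega> :: "(real^'n) set" and p :: "real^'n \<Rightarrow> real"
  assumes \<Omega>: "open \<Omega>" "bounded \<Omega>" "smooth_boundary \<Omega>" and S: "is_surface_measure \<Omega> S"
    and \<alpha>: "0 \<le> \<alpha>" and \<delta>: "0 < \<delta>" and p: "C1_with p P"
  shows "\<bar>LINT y|lebesgue_on \<Omega>. scaled_kernel \<alpha> (tail_integral R) \<delta> x y * P y $ j
       - p y * (scaled_kernel \<alpha> R \<delta> x y * ((y - x) $ j / (2 * \<delta>\<^sup>2)))\<bar>
     \<le> (LINT y|restrict_space S (frontier \<Omega>). scaled_kernel \<alpha> (tail_integral R) \<delta> x y * \<bar>p y\<bar>)"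
proof -
  let ?N = "restrict_space S (frontier \<Omega>)"
  interpret N: finite_measure ?N by (rule finite_measure_surface[OF \<Omega> S])
  have sS: "sets S = sets borel" using S by (simp add: is_surface_measure_def)
  then have spN: "space ?N = frontier \<Omega>" by (simp add: space_restrict_space sets_eq_imp_space_eq)
  define c where "c = \<alpha> / \<delta> ^ CARD('n)"
  have c: "c \<ge> 0" using \<alpha> \<delta> by (simp add: c_def)
  \<comment> \<open>With this factor \<rho> is the argument of the kernel, and the j-th component of
    its gradient is (y - x)_j / (2 \<delta>^2).\<close>
  define \<kappa> where "\<kappa> = 1 / (4 * \<delta>\<^sup>2)"
  have \<kappa>: "\<kappa> > 0" "2 * \<kappa> = 1 / (2 * \<delta>\<^sup>2)" using \<delta> by (auto simp: \<kappa>_def)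
  define \<rho> where "\<rho> y = (norm (y - x))\<^sup>2 * \<kappa>" for y
  have \<rho>: "\<rho> y \<ge> 0" for y using \<kappa> by (simp add: \<rho>_def)
  have ker: "scaled_kernel \<alpha> K \<delta> x y = c * K (\<rho> y)" for K y
    by (simp add: scaled_kernel_def c_def \<rho>_def \<kappa>_def norm_minus_commute)
  have C\<rho>: "C1_with \<rho> (\<lambda>y. \<kappa> *\<^sub>R (2 *\<^sub>R (y - x)))"
    unfolding \<rho>_def
    by (rule C1_with_compose[OF C1_with_norm_square, of "\<lambda>t. t * \<kappa>" "\<lambda>_. \<kappa>"])
       (auto intro!: derivative_eq_intros)
  define \<phi> where "\<phi> k y = c * tail_integral (ramp k) (\<rho> y) * p y" for k y
  define G where "G k y = p y *\<^sub>R ((c * - ramp k (\<rho> y)) *\<^sub>R (\<kappa> *\<^sub>R (2 *\<^sub>R (y - x)))) + (c * tail_integral (ramp k) (\<rho> y)) *\<^sub>R P y" for k y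
  have C\<phi>: "C1_with (\<phi> k) (G k)" for k
  proof -
    have "C1_with (\<lambda>y. c * tail_integral (ramp k) (\<rho> y)) (\<lambda>y. (c * - ramp k (\<rho> y)) *\<^sub>R (\<kappa> *\<^sub>R (2 *\<^sub>R (y - x))))"
      by (rule C1_with_compose[OF C\<rho>, of "\<lambda>r. c * tail_integral (ramp k) r" "\<lambda>r. c * - ramp k r"])
         (auto intro!: DERIV_cmult DERIV_tail_ramp[THEN DERIV_cong] continuous_intros continuous_on_ramp DERIV_cmult[OF DERIV_tail_ramp, THEN DERIV_cong])
    from C1_with_mult[OF this p] show ?thesis unfolding \<phi>_def[abs_def] G_def[abs_def] .
  qed
  let ?f = "\<lambda>y. scaled_kernel \<alpha> (tail_integral R) \<delta> x y * P y $ j - p y * (scaled_kernel \<alpha> R \<delta> x y * ((y - x) $ j / (2 * \<delta>\<^sup>2)))"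
  have lim: "(\<lambda>k. indicator \<Omega> y * G k y $ j) \<longlonglongrightarrow> indicator \<Omega> y * ?f y" for y
  proof -
    have "(\<lambda>k. indicator \<Omega> y * (p y * (c * - ramp k (\<rho> y) * (\<kappa> * (2 * (y - x) $ j))) + c * tail_integral (ramp k) (\<rho> y) * P y $ j))
      \<longlonglongrightarrow> indicator \<Omega> y * (p y * (c * - R (\<rho> y) * (\<kappa> * (2 * (y - x) $ j))) + c * tail_integral R (\<rho> y) * P y $ j)"
      by (intro tendsto_intros ramp_LIMSEQ tail_ramp_LIMSEQ \<rho>)
    also have "p y * (c * - R (\<rho> y) * (\<kappa> * (2 * (y - x) $ j))) + c * tail_integral R (\<rho> y) * P y $ j = ?f y"
    proof -
      have "\<kappa> * (2 * (y - x) $ j) = (y - x) $ j / (2 * \<delta>\<^sup>2)"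
      proof -
        have "\<kappa> * (2 * (y - x) $ j) = 2 * \<kappa> * (y - x) $ j" by simp
        then show ?thesis unfolding \<kappa>(2) by simp
      qed
      then show ?thesis by (simp only: ker)
    qed
    finally show ?thesis
      by (simp only: G_def vector_add_component vector_scaleR_component real_scaleR_def)
  qed
  have cG: "continuous_on UNIV (\<lambda>y. G k y $ j)" for k by (rule C1_with_continuous_nth[OF C\<phi>])
  have meas_k: "(\<lambda>y. indicator \<Omega> y * G k y $ j) \<in> borel_measurable borel" for k
    using cG[of k] \<Omega>(1) by (intro borel_measurable_times borel_measurable_indicator borel_measurable_continuous_onI borel_open)
  have meas: "(\<lambda>y. indicator \<Omega> y * ?f y) \<in> borel_measurable borel"
    by (rule borel_measurable_LIMSEQ_real[OF lim meas_k])
  have bdd: "\<exists>B\<ge>0. \<forall>y\<in>closure \<Omega>. \<bar>h y\<bar> \<le> B" if "continuous_on UNIV h" for h :: "real^'n \<Rightarrow> real"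
  proof -
    have "bounded (h ` closure \<Omega>)"
      using \<Omega>(2) by (intro compact_imp_bounded compact_continuous_image continuous_on_subset[OF that]) auto
    then show ?thesis unfolding bounded_pos by (auto intro: less_imp_le)
  qed
  obtain B0 where B0: "B0 \<ge> 0" "\<And>y. y \<in> closure \<Omega> \<Longrightarrow> \<bar>p y\<bar> \<le> B0" using bdd[OF C1_with_continuous[OF p]] by blast
  obtain B1 where B1: "B1 \<ge> 0" "\<And>y. y \<in> closure \<Omega> \<Longrightarrow> \<bar>P y $ j\<bar> \<le> B1" using bdd[OF C1_with_continuous_nth[OF p]] by blast
  have "continuous_on UNIV (\<lambda>y. (y - x) $ j)" by (intro continuous_intros)
  then obtain B2 where B2: "B2 \<ge> 0" "\<And>y. y \<in> closure \<Omega> \<Longrightarrow> \<bar>(y - x) $ j\<bar> \<le> B2"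
    using bdd[of "\<lambda>y. (y - x) $ j"] by blast
  have tail2: "\<bar>tail_integral (ramp k) (\<rho> y)\<bar> \<le> 2 * b" for k y
  proof -
    have "b / real (Suc k) \<le> b" using b_nonneg by (simp add: divide_le_eq mult_le_cancel_left1)
    then show ?thesis using tail_ramp[OF \<rho>[of y], of k] tail_bounds[OF \<rho>, of y] by auto
  qed
  \<comment> \<open>A bound independent of k: the factor 2 b covers the tail of R and the excess
    b/(k + 1) of the majorant.\<close>
  define Z where "Z = B0 * (c * b * (\<kappa> * (2 * B2))) + c * (2 * b) * B1"
  have dom: "norm (indicator \<Omega> y * G k y $ j) \<le> indicator \<Omega> y * Z" for k y
  proof (cases "y \<in> \<Omega>")
    case True
    then have y: "y \<in> closure \<Omega>" using closure_subset by blast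
    define t where "t = (y - x) $ j"
    have "\<bar>G k y $ j\<bar> \<le> \<bar>p y * (c * - ramp k (\<rho> y) * (\<kappa> * (2 * t)))\<bar> + \<bar>c * tail_integral (ramp k) (\<rho> y) * P y $ j\<bar>"
      unfolding t_def by (simp only: G_def vector_add_component vector_scaleR_component real_scaleR_def abs_triangle_ineq)
    also have "\<dots> = \<bar>p y\<bar> * (c * ramp k (\<rho> y) * (\<kappa> * (2 * \<bar>t\<bar>))) + c * \<bar>tail_integral (ramp k) (\<rho> y)\<bar> * \<bar>P y $ j\<bar>"
      using c \<kappa>(1) ramp_bounds(1)[of k "\<rho> y"] by (simp add: abs_mult)
    also have "\<dots> \<le> Z"
      unfolding Z_def using c \<kappa> b_nonneg B0 B1 B2(1) B2(2)[OF y, folded t_def] y tail2 ramp_bounds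
      by (intro add_mono mult_mono mult_nonneg_nonneg) auto
    finally show ?thesis using True by simp
  qed simp
  have "(\<lambda>k. LINT y|lborel. indicator \<Omega> y * G k y $ j) \<longlonglongrightarrow> (LINT y|lborel. indicator \<Omega> y * ?f y)"
  proof (rule integral_dominated_convergence[where w = "\<lambda>y. indicator \<Omega> y * Z"])
    show "integrable lborel (\<lambda>y. indicator \<Omega> y * Z)"
      using \<Omega> by (intro integrable_indicator_continuous borel_open) auto
  qed (use meas meas_k lim dom in auto)
  then have L: "(\<lambda>k. \<bar>LINT y|lborel. indicator \<Omega> y * G k y $ j\<bar>) \<longlonglongrightarrow> \<bar>LINT y|lborel. indicator \<Omega> y * ?f y\<bar>"
    by (rule tendsto_rabs)
  let ?K = "\<lambda>y. scaled_kernel \<alpha> (tail_integral R) \<delta> x y"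
  have "(\<lambda>y. y) \<in> borel_measurable ?N" by (rule measurable_restrict_space1) (simp add: measurable_ident_sets[OF sS])
  note mN = borel_measurable_scaled_kernel(2)[OF borel_measurable_const this]
  have pN: "p \<in> borel_measurable ?N"
    using C1_with_continuous[OF p]
    by (intro measurable_restrict_space1) (auto simp: measurable_cong_sets[OF sS refl] intro: borel_measurable_continuous_onI)
  have K0: "0 \<le> ?K y" "?K y \<le> c * b" for y
    using scaled_kernel_nonneg(2)[OF \<alpha> \<delta>] scaled_kernel_bounded(2)[OF \<alpha> \<delta>] by (auto simp: c_def)
  have int: "integrable ?N (\<lambda>y. ?K y * \<bar>p y\<bar>)"
  proof (rule N.integrable_const_bound[of _ "c * b * B0"])
    have "norm (?K y * \<bar>p y\<bar>) \<le> c * b * B0" if "y \<in> frontier \<Omega>" for y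
    proof -
      have "y \<in> closure \<Omega>" using that by (simp add: frontier_def)
      then show ?thesis using K0[of y] B0 c b_nonneg by (auto simp: abs_mult intro!: mult_mono)
    qed
    then show "AE y in ?N. norm (?K y * \<bar>p y\<bar>) \<le> c * b * B0" by (intro AE_I2) (simp add: spN)
  qed (use mN pN in measurable)
  define J where "J = (LINT y|?N. ?K y * \<bar>p y\<bar>)"
  \<comment> \<open>Replacing the tail of the majorant by that of R on the boundary costs at most a
    multiple of 1/(k + 1) times the finite surface measure.\<close>
  have bound_k: "\<bar>LINT y|lborel. indicator \<Omega> y * G k y $ j\<bar> \<le> J + (c * b * B0 * measure ?N (space ?N)) * inverse (real (Suc k))" for k
  proof -
    let ?e = "c * b * B0 * inverse (real (Suc k))"
    have e0: "?e \<ge> 0" using c b_nonneg B0 by simp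
    have "ennreal \<bar>LINT y|lborel. indicator \<Omega> y * G k y $ j\<bar> \<le> (\<integral>\<^sup>+ y. ennreal \<bar>\<phi> k y\<bar> \<partial>?N)"
      using divergence_bound[OF \<Omega> S C\<phi>] nn_integral_restrict_frontier[OF S] by simp
    also have "\<dots> \<le> (\<integral>\<^sup>+ y. ennreal (?K y * \<bar>p y\<bar> + ?e) \<partial>?N)"
    proof (rule nn_integral_mono)
      fix y assume "y \<in> space ?N"
      then have "y \<in> frontier \<Omega>" by (simp only: spN)
      then have y: "y \<in> closure \<Omega>" by (simp add: frontier_def)
      have t: "0 \<le> tail_integral (ramp k) (\<rho> y)" "tail_integral (ramp k) (\<rho> y) \<le> tail_integral R (\<rho> y) + b * inverse (real (Suc k))"
        using tail_ramp[OF \<rho>[of y], of k] tail_bounds(1)[OF \<rho>, of y] by (auto simp: divide_inverse)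
      have "\<bar>\<phi> k y\<bar> = c * tail_integral (ramp k) (\<rho> y) * \<bar>p y\<bar>"
        using t(1) c by (simp add: \<phi>_def abs_mult)
      also have "\<dots> \<le> c * (tail_integral R (\<rho> y) + b * inverse (real (Suc k))) * \<bar>p y\<bar>"
        using t(2) c by (intro mult_right_mono mult_left_mono) auto
      also have "\<dots> = ?K y * \<bar>p y\<bar> + c * b * inverse (real (Suc k)) * \<bar>p y\<bar>"
        by (simp add: ker algebra_simps)
      also have "c * b * inverse (real (Suc k)) * \<bar>p y\<bar> \<le> c * b * inverse (real (Suc k)) * B0"
        using B0(2)[OF y] c b_nonneg by (intro mult_left_mono) auto
      finally show "ennreal \<bar>\<phi> k y\<bar> \<le> ennreal (?K y * \<bar>p y\<bar> + ?e)"
        by (intro ennreal_leI) (simp add: mult_ac)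
    qed
    also have "\<dots> = ennreal (LINT y|?N. ?K y * \<bar>p y\<bar> + ?e)"
      using int K0 e0 by (intro nn_integral_eq_integral) auto
    also have "(LINT y|?N. ?K y * \<bar>p y\<bar> + ?e) = J + (c * b * B0 * measure ?N (space ?N)) * inverse (real (Suc k))"
      using int by (subst Bochner_Integration.integral_add) (auto simp: J_def)
    finally show ?thesis
    proof (rule ennreal_le_iff[THEN iffD1, rotated])
      have "0 \<le> J" unfolding J_def using K0 by (intro Bochner_Integration.integral_nonneg) simp
      then show "0 \<le> J + (c * b * B0 * measure ?N (space ?N)) * inverse (real (Suc k))"
        using c b_nonneg B0 by (intro add_nonneg_nonneg mult_nonneg_nonneg) auto
    qed
  qed
  have "(\<lambda>k. J + (c * b * B0 * measure ?N (space ?N)) * inverse (real (Suc k))) \<longlonglongrightarrow> J + (c * b * B0 * measure ?N (space ?N)) * 0"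
    by (intro tendsto_intros LIMSEQ_inverse_real_of_nat)
  from LIMSEQ_le[OF L this] bound_k
  have "\<bar>LINT y|lborel. indicator \<Omega> y * ?f y\<bar> \<le> J" by simp
  moreover have "(LINT y|lebesgue_on \<Omega>. ?f y) = (LINT y|lborel. indicator \<Omega> y * ?f y)"
  proof -
    have "\<Omega> \<in> sets lebesgue" using \<Omega>(1) by (simp add: borel_open)
    then have "(LINT y|lebesgue_on \<Omega>. ?f y) = (LINT y|lebesgue. indicator \<Omega> y * ?f y)"
      by (subst integral_restrict_space) auto
    then show ?thesis using meas by (simp add: integral_completion)
  qed
  ultimately show ?thesis by (simp add: J_def)
qed

section \<open>Masses and moments over the domain\<close>

text \<open>One constant D bounds the norms, which fixes the height of the barrier, and the
  distances, which caps the interaction range 2\<delta> when \<delta> is large.\<close>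

locale nonlocal_domain = radial_kernel R b for R :: "real \<Rightarrow> real" and b :: real +
  fixes \<Omega> :: "(real^'n) set" and S :: "(real^'n) measure" and \<alpha> D :: real
  assumes open_domain: "open \<Omega>" and bounded_domain: "bounded \<Omega>" and smooth_domain: "smooth_boundary \<Omega>"
    and surface: "is_surface_measure \<Omega> S" and \<alpha>_pos: "\<alpha> > 0"
    and D_ge_1: "1 \<le> D" and norm_le_D: "x \<in> \<Omega> \<Longrightarrow> norm x \<le> D"
    and dist_le_D: "x \<in> closure \<Omega> \<Longrightarrow> y \<in> closure \<Omega> \<Longrightarrow> dist x y \<le> D"
begin

abbreviation "M \<equiv> lebesgue_on \<Omega>"
abbreviation "N \<equiv> restrict_space S (frontier \<Omega>)"
abbreviation kR where "kR \<delta> x y \<equiv> scaled_kernel \<alpha> R \<delta> (x::real^'n) y"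
abbreviation kK where "kK \<delta> x y \<equiv> scaled_kernel \<alpha> (tail_integral R) \<delta> (x::real^'n) y"

definition boundary_mass where "boundary_mass \<delta> x = (LINT y|N. kK \<delta> x y)"
definition second_moment where "second_moment \<delta> x = (LINT y|M. kR \<delta> x y * (dist x y)\<^sup>2) / \<delta>\<^sup>2"
text \<open>This is the factor in front of the Laplacian at x, both in the Taylor expansion of the
  interaction term and in the averaged right-hand side.\<close>

definition interior_mass where "interior_mass \<delta> x = (LINT y|M. kK \<delta> x y)"
text \<open>The left side of the model with zero boundary data: the data terms leave when the
  equation for the solution is subtracted from that for u.\<close>

definition nonlocal_op where
  "nonlocal_op \<delta> v x = (LINT y|M. kR \<delta> x y * (v x - v y)) / \<delta>\<^sup>2 + 2 / \<delta> * boundary_mass \<delta> x * v x"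

lemma finite_measure_M: "finite_measure M"
  using bounded_domain open_domain emeasure_bounded_finite[of \<Omega>]
  by (intro finite_measure_lebesgue_on) (auto simp: fmeasurable_def less_top)

lemma finite_measure_N: "finite_measure N"
  by (rule finite_measure_surface[OF open_domain bounded_domain smooth_domain surface])

lemma space_N: "space N = frontier \<Omega>"
  using surface by (simp add: is_surface_measure_def space_restrict_space sets_eq_imp_space_eq)

lemma space_M: "space M = \<Omega>" by simp

lemma frontier_subset: "y \<in> frontier \<Omega> \<Longrightarrow> y \<in> closure \<Omega>"
  by (simp add: frontier_def)

lemma measurable_M: "continuous_on \<Omega> f \<Longrightarrow> (f :: real^'n \<Rightarrow> 'z::euclidean_space) \<in> borel_measurable M"
  using open_domain by (intro continuous_imp_measurable_on_sets_lebesgue) auto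

lemma measurable_N: "continuous_on (frontier \<Omega>) f \<Longrightarrow> (f :: real^'n \<Rightarrow> real) \<in> borel_measurable N"
proof -
  assume "continuous_on (frontier \<Omega>) f"
  then have "f \<in> borel_measurable (restrict_space borel (frontier \<Omega>))"
    by (rule borel_measurable_continuous_on_restrict)
  moreover have "sets N = sets (restrict_space borel (frontier \<Omega>))"
    using surface by (auto simp: is_surface_measure_def intro!: sets_restrict_space_cong)
  then have "measurable N borel = measurable (restrict_space borel (frontier \<Omega>)) (borel :: real measure)"
    by (rule measurable_cong_sets[OF _ refl])
  ultimately show ?thesis by blast
qed

lemma kernel_measurable:
  "kR \<delta> x \<in> borel_measurable M" "kK \<delta> x \<in> borel_measurable M" "kK \<delta> x \<in> borel_measurable N"
proof -
  have id: "(\<lambda>y. y) \<in> borel_measurable M" by (intro measurable_M continuous_intros)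
  show "kR \<delta> x \<in> borel_measurable M" "kK \<delta> x \<in> borel_measurable M"
    using borel_measurable_scaled_kernel[OF borel_measurable_const id] by auto
  have "sets S = sets borel" using surface by (simp add: is_surface_measure_def)
  then have "(\<lambda>y. y) \<in> borel_measurable N"
    by (intro measurable_restrict_space1) (simp add: measurable_ident_sets)
  from borel_measurable_scaled_kernel(2)[OF borel_measurable_const this]
  show "kK \<delta> x \<in> borel_measurable N" by auto
qed

lemma kernel_bounds:
  assumes "0 < \<delta>"
  shows "0 \<le> kR \<delta> x y" "0 \<le> kK \<delta> x y"
    "kR \<delta> x y \<le> \<alpha> / \<delta> ^ CARD('n) * b" "kK \<delta> x y \<le> \<alpha> / \<delta> ^ CARD('n) * b"
  using scaled_kernel_nonneg[OF _ assms, of \<alpha> x y] scaled_kernel_bounded[OF _ assms, of \<alpha> x y] \<alpha>_pos by auto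

lemma integrable_bounded_mult:
  fixes k f :: "real^'n \<Rightarrow> real"
  assumes "k \<in> borel_measurable M" "\<And>y. 0 \<le> k y" "\<And>y. k y \<le> B" "integrable M f"
  shows "integrable M (\<lambda>y. k y * f y)"
proof (rule Bochner_Integration.integrable_bound)
  show "integrable M (\<lambda>y. B * \<bar>f y\<bar>)" using assms(4) by auto
  show "(\<lambda>y. k y * f y) \<in> borel_measurable M"
    using assms(1,4) by (intro borel_measurable_times) auto
  have "\<bar>k y * f y\<bar> \<le> \<bar>B * \<bar>f y\<bar>\<bar>" for y
    by (rule order_trans[OF _ abs_ge_self], unfold abs_mult abs_of_nonneg[OF assms(2)])
       (intro mult_right_mono assms(3) abs_ge_zero)
  then show "AE y in M. norm (k y * f y) \<le> norm (B * \<bar>f y\<bar>)" by simp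
qed

lemma integrable_kernel_mult:
  assumes "0 < \<delta>" "integrable M f"
  shows integrable_kR: "integrable M (\<lambda>y. kR \<delta> x y * f y)"
    and integrable_kK: "integrable M (\<lambda>y. kK \<delta> x y * f y)"
  using kernel_bounds[OF assms(1)] kernel_measurable(1,2) assms(2)
  by (auto intro!: integrable_bounded_mult)

lemma integrable_kK_N:
  assumes "0 < \<delta>" "f \<in> borel_measurable N" "\<And>y. y \<in> frontier \<Omega> \<Longrightarrow> \<bar>f y\<bar> \<le> Z"
  shows "integrable N (\<lambda>y. kK \<delta> x y * f y)"
proof -
  interpret finite_measure N by (rule finite_measure_N)
  show ?thesis
  proof (rule integrable_const_bound)
    show "AE y in N. norm (kK \<delta> x y * f y) \<le> \<alpha> / \<delta> ^ CARD('n) * b * Z"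
    proof (rule AE_I2)
      fix y assume "y \<in> space N"
      then have "\<bar>f y\<bar> \<le> Z" using assms(3) by (simp only: space_N)
      then show "norm (kK \<delta> x y * f y) \<le> \<alpha> / \<delta> ^ CARD('n) * b * Z"
        unfolding real_norm_def abs_mult abs_of_nonneg[OF kernel_bounds(2)[OF assms(1)]]
        using kernel_bounds(2,4)[OF assms(1), of x y] by (intro mult_mono) (linarith | simp)+
    qed
    show "(\<lambda>y. kK \<delta> x y * f y) \<in> borel_measurable N"
      using kernel_measurable(3) assms(2) by (intro borel_measurable_times)
  qed
qed

lemma integrable_bounded_M:
  fixes f :: "real^'n \<Rightarrow> real"
  assumes "f \<in> borel_measurable M" "\<And>y. y \<in> \<Omega> \<Longrightarrow> \<bar>f y\<bar> \<le> Z"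
  shows "integrable M f"
proof -
  interpret finite_measure M by (rule finite_measure_M)
  show ?thesis
    by (rule integrable_const_bound[of _ Z]) (use assms in \<open>auto intro!: AE_I2\<close>)
qed

lemma boundary_mass_nonneg: "0 < \<delta> \<Longrightarrow> 0 \<le> boundary_mass \<delta> x"
  unfolding boundary_mass_def using kernel_bounds by (intro Bochner_Integration.integral_nonneg) auto

lemma interior_mass_nonneg: "0 < \<delta> \<Longrightarrow> 0 \<le> interior_mass \<delta> x"
  unfolding interior_mass_def using kernel_bounds by (intro Bochner_Integration.integral_nonneg) auto

lemma second_moment_nonneg: "0 < \<delta> \<Longrightarrow> 0 \<le> second_moment \<delta> x"
  unfolding second_moment_def using kernel_bounds
  by (intro divide_nonneg_nonneg Bochner_Integration.integral_nonneg) auto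

text \<open>Both kernels vanish beyond distance 2\<delta>, and no two points of the closure are more
  than D apart. Keeping the minimum makes each gained factor of order \<delta> for small \<delta>
  and bounded for large \<delta>.\<close>

lemma kernel_dist_le:
  assumes "0 < \<delta>" "x \<in> \<Omega>" "y \<in> closure \<Omega>"
  shows "kR \<delta> x y * dist x y \<le> kR \<delta> x y * min (2 * \<delta>) D" "kK \<delta> x y * dist x y \<le> kK \<delta> x y * min (2 * \<delta>) D"
proof -
  have "x \<in> closure \<Omega>" using assms(2) closure_subset by blast
  then have "dist x y \<le> D" using dist_le_D assms(3) by blast
  then show "kR \<delta> x y * dist x y \<le> kR \<delta> x y * min (2 * \<delta>) D" "kK \<delta> x y * dist x y \<le> kK \<delta> x y * min (2 * \<delta>) D"
    using kernel_bounds[OF assms(1), of x y] scaled_kernel_support[OF assms(1), of x y \<alpha>]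
    by (cases "2 * \<delta> < dist x y"; auto intro!: mult_left_mono)+
qed

lemma integral_kK_dist_N:
  assumes "0 < \<delta>" "x \<in> \<Omega>" "f \<in> borel_measurable N" "0 \<le> Z"
    and f: "\<And>y. y \<in> frontier \<Omega> \<Longrightarrow> \<bar>f y\<bar> \<le> Z * dist x y"
  shows "\<bar>LINT y|N. kK \<delta> x y * f y\<bar> \<le> Z * (min (2 * \<delta>) D * boundary_mass \<delta> x)"
proof -
  have xc: "x \<in> closure \<Omega>" using assms(2) closure_subset by blast
  have fb: "\<bar>f y\<bar> \<le> Z * D" if "y \<in> frontier \<Omega>" for y
    using f[OF that] mult_left_mono[OF dist_le_D[OF xc frontier_subset[OF that]] assms(4)] by linarith
  have int1: "integrable N (\<lambda>y. kK \<delta> x y * 1)"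
    by (rule integrable_kK_N[OF assms(1), of _ 1]) auto
  have "\<bar>LINT y|N. kK \<delta> x y * f y\<bar> \<le> (LINT y|N. \<bar>kK \<delta> x y * f y\<bar>)"
    using integral_norm_bound[of N "\<lambda>y. kK \<delta> x y * f y"] by simp
  also have "\<dots> \<le> (LINT y|N. (Z * min (2 * \<delta>) D) * kK \<delta> x y)"
  proof (rule integral_mono)
    show "integrable N (\<lambda>y. \<bar>kK \<delta> x y * f y\<bar>)"
      using integrable_kK_N[OF assms(1,3) fb] by (intro integrable_abs)
    fix y assume "y \<in> space N"
    then have y: "y \<in> frontier \<Omega>" by (simp only: space_N)
    have "\<bar>kK \<delta> x y * f y\<bar> \<le> kK \<delta> x y * (Z * dist x y)"
      using kernel_bounds(2)[OF assms(1), of x y] f[OF y] by (simp add: abs_mult mult_left_mono)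
    also have "\<dots> \<le> (Z * min (2 * \<delta>) D) * kK \<delta> x y"
      using mult_left_mono[OF kernel_dist_le(2)[OF assms(1,2) frontier_subset[OF y]] assms(4)] by (simp add: mult_ac)
    finally show "\<bar>kK \<delta> x y * f y\<bar> \<le> (Z * min (2 * \<delta>) D) * kK \<delta> x y" .
  qed (use int1 in auto)
  finally show ?thesis by (simp add: boundary_mass_def mult_ac)
qed

text \<open>\<open>kernel_flux_bound\<close> with the polynomial 1. Where the kernel does not reach
  the boundary the first moment is zero by symmetry; the boundary mass measures the defect.\<close>

lemma first_moment_bound:
  assumes "0 < \<delta>"
  shows "\<bar>LINT y|M. kR \<delta> x y * (y - x) $ j\<bar> \<le> 2 * \<delta>\<^sup>2 * boundary_mass \<delta> x"
proof -
  have C: "C1_with (\<lambda>_::real^'n. 1) (\<lambda>_. 0)" by (auto simp: C1_with_def)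
  have "\<bar>LINT y|M. kK \<delta> x y * 0 $ j - 1 * (kR \<delta> x y * ((y - x) $ j / (2 * \<delta>\<^sup>2)))\<bar> \<le> (LINT y|N. kK \<delta> x y * \<bar>1\<bar>)"
    by (rule kernel_flux_bound[OF open_domain bounded_domain smooth_domain surface _ assms C]) (use \<alpha>_pos in simp)
  moreover have "(LINT y|M. kK \<delta> x y * 0 $ j - 1 * (kR \<delta> x y * ((y - x) $ j / (2 * \<delta>\<^sup>2))))
     = (LINT y|M. (- 1 / (2 * \<delta>\<^sup>2)) * (kR \<delta> x y * (y - x) $ j))"
    by (rule Bochner_Integration.integral_cong) auto
  also have "\<dots> = (- 1 / (2 * \<delta>\<^sup>2)) * (LINT y|M. kR \<delta> x y * (y - x) $ j)"
    by (rule integral_mult_right_zero)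
  ultimately have "\<bar>(- 1 / (2 * \<delta>\<^sup>2)) * (LINT y|M. kR \<delta> x y * (y - x) $ j)\<bar> \<le> boundary_mass \<delta> x"
    by (simp only:) (simp add: boundary_mass_def)
  then show ?thesis using assms by (simp add: abs_mult field_simps)
qed

lemma integrable_diff_M: "integrable M (\<lambda>y. (y - x) $ i)" "integrable M (\<lambda>y. (y - x) $ i * (y - x) $ j)"
  "integrable M (\<lambda>y. (dist x y)\<^sup>2)"
proof -
  \<comment> \<open>\<open>SOME\<close> names a bound that depends on f alone, so it is the same for
    all y.\<close>
  have bd: "\<bar>f y\<bar> \<le> (SOME Z. \<forall>y\<in>closure \<Omega>. \<bar>f y\<bar> \<le> Z)" if "continuous_on UNIV f" "y \<in> \<Omega>" for f :: "real^'n \<Rightarrow> real" and y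
  proof -
    have "bounded (f ` closure \<Omega>)"
      using bounded_domain by (intro compact_imp_bounded compact_continuous_image continuous_on_subset[OF that(1)]) auto
    then have "\<exists>Z. \<forall>y\<in>closure \<Omega>. \<bar>f y\<bar> \<le> Z" unfolding bounded_iff by auto
    from someI_ex[OF this] show ?thesis using that(2) closure_subset by blast
  qed
  have int: "integrable M f" if "continuous_on UNIV f" for f :: "real^'n \<Rightarrow> real"
    by (rule integrable_bounded_M[OF measurable_M bd[OF that]]) (use that continuous_on_subset in blast)+
  show "integrable M (\<lambda>y. (y - x) $ i)" "integrable M (\<lambda>y. (y - x) $ i * (y - x) $ j)" "integrable M (\<lambda>y. (dist x y)\<^sup>2)"
    by (intro int continuous_intros)+
qed

text \<open>\<open>kernel_flux_bound\<close> with the polynomial (y - x)_i, whose j-th derivative is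
  the Kronecker delta and produces the interior mass. On the boundary the polynomial is at most the
  distance, which yields the extra factor.\<close>

lemma second_moment_entries:
  assumes \<delta>: "0 < \<delta>" and x: "x \<in> \<Omega>"
  shows "\<bar>(LINT y|M. kR \<delta> x y * ((y - x) $ i * (y - x) $ j)) / (2 * \<delta>\<^sup>2) - (if i = j then interior_mass \<delta> x else 0)\<bar>
     \<le> min (2 * \<delta>) D * boundary_mass \<delta> x"
proof -
  have C: "C1_with (\<lambda>y::real^'n. (y - x) $ i) (\<lambda>_. axis i 1)"
  proof -
    have "C1_with (\<lambda>y::real^'n. axis i 1 \<bullet> (y - x)) (\<lambda>_. axis i 1)"
      unfolding C1_with_def by (auto intro!: derivative_eq_intros)
    then show ?thesis by (simp add: inner_axis')
  qed
  let ?a = "(axis i 1 :: real^'n) $ j"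
  let ?P = "LINT y|M. kR \<delta> x y * ((y - x) $ i * (y - x) $ j)"
  have "\<bar>LINT y|M. kK \<delta> x y * ?a - (y - x) $ i * (kR \<delta> x y * ((y - x) $ j / (2 * \<delta>\<^sup>2)))\<bar> \<le> (LINT y|N. kK \<delta> x y * \<bar>(y - x) $ i\<bar>)"
    by (rule kernel_flux_bound[OF open_domain bounded_domain smooth_domain surface _ \<delta> C]) (use \<alpha>_pos in simp)
  also have "(LINT y|N. kK \<delta> x y * \<bar>(y - x) $ i\<bar>) \<le> 1 * (min (2 * \<delta>) D * boundary_mass \<delta> x)"
  proof (rule order_trans[OF abs_ge_self integral_kK_dist_N[OF \<delta> x]])
    show "\<bar>\<bar>(y - x) $ i\<bar>\<bar> \<le> 1 * dist x y" for y
      using component_le_norm_cart[of "y - x" i] by (simp add: dist_norm norm_minus_commute)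
    show "(\<lambda>y. \<bar>(y - x) $ i\<bar>) \<in> borel_measurable N"
      by (intro measurable_N continuous_intros)
  qed simp
  also have "(LINT y|M. kK \<delta> x y * ?a - (y - x) $ i * (kR \<delta> x y * ((y - x) $ j / (2 * \<delta>\<^sup>2))))
     = (LINT y|M. ?a * kK \<delta> x y - (kR \<delta> x y * ((y - x) $ i * (y - x) $ j)) / (2 * \<delta>\<^sup>2))"
    by (rule Bochner_Integration.integral_cong) auto
  also have "\<dots> = ?a * interior_mass \<delta> x - ?P / (2 * \<delta>\<^sup>2)"
  proof -
    interpret finite_measure M by (rule finite_measure_M)
    have "integrable M (\<lambda>y. kK \<delta> x y * 1)" by (rule integrable_kK[OF \<delta>]) simp
    then have 1: "integrable M (\<lambda>y. ?a * kK \<delta> x y)" by simp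
    have 2: "integrable M (\<lambda>y. (kR \<delta> x y * ((y - x) $ i * (y - x) $ j)) / (2 * \<delta>\<^sup>2))"
      using integrable_kR[OF \<delta> integrable_diff_M(2)] by (rule integrable_divide_zero)
    show ?thesis unfolding interior_mass_def
      by (simp only: Bochner_Integration.integral_diff[OF 1 2] integral_mult_right_zero integral_divide_zero)
  qed
  finally show ?thesis by (cases "i = j") (auto simp: axis_def abs_minus_commute)
qed

lemma second_moment_eq:
  assumes "0 < \<delta>"
  shows "second_moment \<delta> x = (\<Sum>i\<in>UNIV. (LINT y|M. kR \<delta> x y * ((y - x) $ i * (y - x) $ i)) / \<delta>\<^sup>2)"
proof -
  have "(dist x y)\<^sup>2 = (\<Sum>i\<in>UNIV. (y - x) $ i * (y - x) $ i)" for y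
    by (simp only: dist_norm norm_minus_commute[of x y] power2_norm_eq_inner inner_vec_def inner_real_def)
  then have "second_moment \<delta> x = (LINT y|M. (\<Sum>i\<in>UNIV. kR \<delta> x y * ((y - x) $ i * (y - x) $ i))) / \<delta>\<^sup>2"
    by (simp only: second_moment_def sum_distrib_left)
  also have "(LINT y|M. (\<Sum>i\<in>UNIV. kR \<delta> x y * ((y - x) $ i * (y - x) $ i))) = (\<Sum>i\<in>UNIV. (LINT y|M. kR \<delta> x y * ((y - x) $ i * (y - x) $ i)))"
    by (intro Bochner_Integration.integral_sum integrable_kR assms integrable_diff_M)
  finally show ?thesis by (simp only: sum_divide_distrib)
qed

text \<open>Summing the diagonal entries compares n times the interior mass with half the second
  moment. Errors proportional to the mass are thereby expressed in terms that the barrier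
  dominates.\<close>

lemma interior_mass_le:
  assumes \<delta>: "0 < \<delta>" and x: "x \<in> \<Omega>"
  shows "interior_mass \<delta> x \<le> second_moment \<delta> x + CARD('n) * (D * boundary_mass \<delta> x)"
proof -
  let ?I = "\<lambda>i. (LINT y|M. kR \<delta> x y * ((y - x) $ i * (y - x) $ i))"
  have B: "0 \<le> boundary_mass \<delta> x" by (rule boundary_mass_nonneg[OF \<delta>])
  have "interior_mass \<delta> x \<le> ?I i / (2 * \<delta>\<^sup>2) + D * boundary_mass \<delta> x" for i
    using second_moment_entries[OF \<delta> x, of i i] mult_right_mono[of "min (2 * \<delta>) D" D, OF _ B] by simp
  then have "(\<Sum>i\<in>(UNIV::'n set). interior_mass \<delta> x) \<le> (\<Sum>i\<in>UNIV. ?I i / (2 * \<delta>\<^sup>2) + D * boundary_mass \<delta> x)"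
    by (rule sum_mono)
  also have "\<dots> = (\<Sum>i\<in>UNIV. ?I i / (2 * \<delta>\<^sup>2)) + CARD('n) * (D * boundary_mass \<delta> x)"
    by (simp only: sum.distrib sum_constant)
  also have "(\<Sum>i\<in>UNIV. ?I i / (2 * \<delta>\<^sup>2)) = second_moment \<delta> x / 2"
    unfolding second_moment_eq[OF \<delta>] sum_divide_distrib by (simp add: mult.commute)
  finally have "CARD('n) * interior_mass \<delta> x \<le> second_moment \<delta> x / 2 + CARD('n) * (D * boundary_mass \<delta> x)" by simp
  moreover have "1 * interior_mass \<delta> x \<le> CARD('n) * interior_mass \<delta> x"
    by (intro mult_right_mono interior_mass_nonneg[OF \<delta>]) (simp add: Suc_leI)
  moreover have "second_moment \<delta> x / 2 \<le> second_moment \<delta> x" using second_moment_nonneg[OF \<delta>] by simp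
  ultimately show ?thesis by linarith
qed

section \<open>Consistency, barrier and error estimate\<close>

text \<open>|y|^2 - |x|^2 is |x - y|^2 plus a linear term. The square gives the second moment; the
  linear term costs at most 4 n D B by \<open>first_moment_bound\<close>, exactly what the summand 2
  n D \<delta> earns from the penalty. D^2 compensates |x|^2, and 1 + \<delta> is the
  surplus.\<close>

lemma nonlocal_op_barrier:
  assumes \<delta>: "0 < \<delta>" and x: "x \<in> \<Omega>"
  shows "second_moment \<delta> x + 2 * boundary_mass \<delta> x * (1 + \<delta>) / \<delta>
     \<le> nonlocal_op \<delta> (\<lambda>y. D\<^sup>2 + 2 * CARD('n) * D * \<delta> + 1 + \<delta> - (norm y)\<^sup>2) x"
proof -
  let ?B = "boundary_mass \<delta> x"
  let ?\<kappa> = "D\<^sup>2 + 2 * CARD('n) * D * \<delta> + 1 + \<delta>"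
  let ?J = "\<lambda>i. (LINT y|M. kR \<delta> x y * (y - x) $ i)"
  have B: "0 \<le> ?B" by (rule boundary_mass_nonneg[OF \<delta>])
  have sq: "(norm y)\<^sup>2 - (norm x)\<^sup>2 = (dist x y)\<^sup>2 + (\<Sum>i\<in>UNIV. 2 * x $ i * (y - x) $ i)" for y :: "real^'n"
  proof -
    have "(norm y)\<^sup>2 = (norm (x + (y - x)))\<^sup>2" by simp
    also have "\<dots> = (norm x)\<^sup>2 + (norm (y - x))\<^sup>2 + 2 * (x \<bullet> (y - x))"
      by (simp only: power2_norm_eq_inner inner_add_left inner_add_right inner_commute[of "y - x" x])
    also have "2 * (x \<bullet> (y - x)) = (\<Sum>i\<in>UNIV. 2 * x $ i * (y - x) $ i)"
      unfolding inner_vec_def sum_distrib_left by (simp only: inner_real_def mult.assoc)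
    finally show ?thesis by (simp only: dist_norm norm_minus_commute[of x y])
  qed
  have "(LINT y|M. kR \<delta> x y * ((?\<kappa> - (norm x)\<^sup>2) - (?\<kappa> - (norm y)\<^sup>2)))
     = (LINT y|M. kR \<delta> x y * (dist x y)\<^sup>2 + (\<Sum>i\<in>UNIV. 2 * x $ i * (kR \<delta> x y * (y - x) $ i)))"
  proof (rule Bochner_Integration.integral_cong[OF refl])
    fix y
    have "(?\<kappa> - (norm x)\<^sup>2) - (?\<kappa> - (norm y)\<^sup>2) = (dist x y)\<^sup>2 + (\<Sum>i\<in>UNIV. 2 * x $ i * (y - x) $ i)"
      unfolding sq[symmetric] by simp
    then show "kR \<delta> x y * ((?\<kappa> - (norm x)\<^sup>2) - (?\<kappa> - (norm y)\<^sup>2)) = kR \<delta> x y * (dist x y)\<^sup>2 + (\<Sum>i\<in>UNIV. 2 * x $ i * (kR \<delta> x y * (y - x) $ i))"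
      by (simp only: distrib_left sum_distrib_left mult.left_commute[of "kR \<delta> x y"])
  qed
  also have "\<dots> = (LINT y|M. kR \<delta> x y * (dist x y)\<^sup>2) + (\<Sum>i\<in>UNIV. 2 * x $ i * ?J i)"
  proof -
    have i1: "integrable M (\<lambda>y. 2 * x $ i * (kR \<delta> x y * (y - x) $ i))" for i
      by (intro integrable_mult_right integrable_kR \<delta> integrable_diff_M)
    show ?thesis
      by (simp only: Bochner_Integration.integral_add[OF integrable_kR[OF \<delta> integrable_diff_M(3)] Bochner_Integration.integrable_sum[OF i1]]
          Bochner_Integration.integral_sum[OF i1] integral_mult_right_zero)
  qed
  finally have "nonlocal_op \<delta> (\<lambda>y. ?\<kappa> - (norm y)\<^sup>2) x =
     second_moment \<delta> x + (\<Sum>i\<in>UNIV. 2 * x $ i * ?J i) / \<delta>\<^sup>2 + 2 / \<delta> * ?B * (?\<kappa> - (norm x)\<^sup>2)"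
    unfolding nonlocal_op_def second_moment_def by (simp only: add_divide_distrib)
  moreover have "- (4 * CARD('n) * D * ?B) \<le> (\<Sum>i\<in>UNIV. 2 * x $ i * ?J i) / \<delta>\<^sup>2"
  proof -
    have "\<bar>\<Sum>i\<in>UNIV. 2 * x $ i * ?J i\<bar> \<le> (\<Sum>i\<in>UNIV. \<bar>2 * x $ i * ?J i\<bar>)" by (rule sum_abs)
    also have "\<dots> \<le> CARD('n) * (2 * D * (2 * \<delta>\<^sup>2 * ?B))"
    proof (rule sum_bounded_above)
      fix i
      have "\<bar>x $ i\<bar> \<le> D" using component_le_norm_cart[of x i] norm_le_D[OF x] by linarith
      then show "\<bar>2 * x $ i * ?J i\<bar> \<le> 2 * D * (2 * \<delta>\<^sup>2 * ?B)"
        using first_moment_bound[OF \<delta>, of x i] D_ge_1 unfolding abs_mult by (intro mult_mono) auto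
    qed
    finally have "- (\<Sum>i\<in>UNIV. 2 * x $ i * ?J i) \<le> (4 * CARD('n) * D * ?B) * \<delta>\<^sup>2" by (simp only: abs_le_iff) (simp add: mult_ac)
    then have "- (\<Sum>i\<in>UNIV. 2 * x $ i * ?J i) / \<delta>\<^sup>2 \<le> 4 * CARD('n) * D * ?B"
      using \<delta> by (subst pos_divide_le_eq) auto
    then show ?thesis by (simp only: minus_divide_left[symmetric])
  qed
  moreover have "4 * CARD('n) * D * ?B + 2 * ?B * (1 + \<delta>) / \<delta> \<le> 2 / \<delta> * ?B * (?\<kappa> - (norm x)\<^sup>2)"
  proof -
    have "(norm x)\<^sup>2 \<le> D\<^sup>2" using norm_le_D[OF x] by (intro power_mono) auto
    then have "2 / \<delta> * ?B * (2 * CARD('n) * D * \<delta> + 1 + \<delta>) \<le> 2 / \<delta> * ?B * (?\<kappa> - (norm x)\<^sup>2)"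
      using B \<delta> by (intro mult_left_mono) auto
    moreover have "2 / \<delta> * ?B * (2 * CARD('n) * D * \<delta> + 1 + \<delta>) = 4 * CARD('n) * D * ?B + 2 * ?B * (1 + \<delta>) / \<delta>"
      using \<delta> by (simp add: field_simps)
    ultimately show ?thesis by simp
  qed
  ultimately show ?thesis by linarith
qed

lemma nonlocal_op_linear:
  assumes \<delta>: "0 < \<delta>" and v: "integrable M v" "integrable M w"
    and x: "x \<in> \<Omega>"
  shows "nonlocal_op \<delta> (\<lambda>y. a * v y + c * w y) x = a * nonlocal_op \<delta> v x + c * nonlocal_op \<delta> w x"
proof -
  interpret finite_measure M by (rule finite_measure_M)
  have 1: "integrable M (\<lambda>y. kR \<delta> x y * (v x - v y))" "integrable M (\<lambda>y. kR \<delta> x y * (w x - w y))"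
    using v by (auto intro!: integrable_kR \<delta>)
  have "(LINT y|M. kR \<delta> x y * (a * v x + c * w x - (a * v y + c * w y))) =
     (LINT y|M. a * (kR \<delta> x y * (v x - v y)) + c * (kR \<delta> x y * (w x - w y)))"
    by (rule Bochner_Integration.integral_cong) (auto simp: algebra_simps)
  also have "\<dots> = a * (LINT y|M. kR \<delta> x y * (v x - v y)) + c * (LINT y|M. kR \<delta> x y * (w x - w y))"
    using 1 by (subst Bochner_Integration.integral_add) auto
  finally show ?thesis unfolding nonlocal_op_def by (simp add: add_divide_distrib algebra_simps)
qed

text \<open>Of the three powers of the distance, one becomes the factor
  \<open>min (2 * \<delta>) D\<close> by the support of the kernel and the other two form the second
  moment.\<close>

lemma Taylor_expectation_bound:
  assumes \<delta>: "0 < \<delta>" and x: "x \<in> \<Omega>" and T: "0 \<le> T"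
    and mE: "integrable M E" and E: "\<And>y. y \<in> \<Omega> \<Longrightarrow> \<bar>E y\<bar> \<le> T * dist x y ^ 3"
  shows "\<bar>(LINT y|M. kR \<delta> x y * E y) / \<delta>\<^sup>2\<bar> \<le> T * (min (2 * \<delta>) D * second_moment \<delta> x)"
proof -
  have "\<bar>LINT y|M. kR \<delta> x y * E y\<bar> \<le> (LINT y|M. \<bar>kR \<delta> x y * E y\<bar>)"
    using integral_norm_bound[of M "\<lambda>y. kR \<delta> x y * E y"] by simp
  also have "\<dots> \<le> (LINT y|M. (T * min (2 * \<delta>) D) * (kR \<delta> x y * (dist x y)\<^sup>2))"
  proof (rule integral_mono)
    show "integrable M (\<lambda>y. \<bar>kR \<delta> x y * E y\<bar>)" using integrable_kR[OF \<delta> mE] by (rule integrable_abs)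
    show "integrable M (\<lambda>y. (T * min (2 * \<delta>) D) * (kR \<delta> x y * (dist x y)\<^sup>2))"
      using integrable_kR[OF \<delta> integrable_diff_M(3)] by (rule integrable_mult_right)
    fix y assume "y \<in> space M"
    then have y: "y \<in> \<Omega>" by (simp only: space_M)
    then have yc: "y \<in> closure \<Omega>" using closure_subset by blast
    have "\<bar>kR \<delta> x y * E y\<bar> \<le> kR \<delta> x y * (T * dist x y ^ 3)"
      using kernel_bounds(1)[OF \<delta>, of x y] E[OF y] by (simp add: abs_mult mult_left_mono)
    also have "\<dots> = (T * (dist x y)\<^sup>2) * (kR \<delta> x y * dist x y)"
      by (simp add: power2_eq_square power3_eq_cube)
    also have "\<dots> \<le> (T * (dist x y)\<^sup>2) * (kR \<delta> x y * min (2 * \<delta>) D)"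
      using T by (intro mult_left_mono kernel_dist_le \<delta> x yc) auto
    finally show "\<bar>kR \<delta> x y * E y\<bar> \<le> (T * min (2 * \<delta>) D) * (kR \<delta> x y * (dist x y)\<^sup>2)" by (simp only: mult_ac)
  qed
  also have "\<dots> = (T * min (2 * \<delta>) D) * (LINT y|M. kR \<delta> x y * (dist x y)\<^sup>2)"
    by (rule integral_mult_right_zero)
  finally have "\<bar>LINT y|M. kR \<delta> x y * E y\<bar> / \<delta>\<^sup>2 \<le> (T * min (2 * \<delta>) D) * (LINT y|M. kR \<delta> x y * (dist x y)\<^sup>2) / \<delta>\<^sup>2"
    by (rule divide_right_mono) simp
  then show ?thesis by (simp add: second_moment_def mult_ac)
qed

text \<open>The quadratic Taylor term is minus the interior mass times the Laplacian at x, up to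
  boundary terms; the integral of the Laplacian against the tail kernel contributes the same with
  the opposite sign. What is left is bounded term by term and involves \<open>B\<close> or an extra
  factor \<open>min (2 * \<delta>) D\<close>.\<close>

lemma consistency_bound:
  fixes u :: "real^'n \<Rightarrow> real"
  assumes T: "0 \<le> T"
    and u1: "\<And>x i. x \<in> \<Omega> \<Longrightarrow> \<bar>partial_deriv i u x\<bar> \<le> T"
    and u2: "\<And>x i j. x \<in> \<Omega> \<Longrightarrow> \<bar>partial_deriv j (partial_deriv i u) x\<bar> \<le> T"
    and lip: "\<And>x y. x \<in> \<Omega> \<Longrightarrow> y \<in> closure \<Omega> \<Longrightarrow> \<bar>u y - u x\<bar> \<le> T * dist x y"
    and lap: "\<And>x y. x \<in> \<Omega> \<Longrightarrow> y \<in> \<Omega> \<Longrightarrow> \<bar>laplacian u y - laplacian u x\<bar> \<le> T * dist x y"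
    and taylor: "\<And>x y. x \<in> \<Omega> \<Longrightarrow> y \<in> \<Omega> \<Longrightarrow> \<bar>u y - u x - (\<Sum>i\<in>UNIV. partial_deriv i u x * (y - x) $ i)
       - (\<Sum>i\<in>UNIV. \<Sum>j\<in>UNIV. partial_deriv j (partial_deriv i u) x * ((y - x) $ i * (y - x) $ j)) / 2\<bar> \<le> T * dist x y ^ 3"
    and int: "integrable M u" "integrable M (laplacian u)" and uN: "u \<in> borel_measurable N"
    and \<delta>: "0 < \<delta>" and x: "x \<in> \<Omega>"
  shows "\<bar>(LINT y|M. kR \<delta> x y * (u x - u y)) / \<delta>\<^sup>2 + 2 / \<delta> * (LINT y|N. kK \<delta> x y * (u x - u y))
      + (LINT y|M. kK \<delta> x y * laplacian u y)\<bar>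
    \<le> T * (2 * CARD('n) + CARD('n) * CARD('n) * D + 6 + CARD('n) * D * D) *
        (boundary_mass \<delta> x + min (2 * \<delta>) D * second_moment \<delta> x)"
proof -
  interpret M: finite_measure M by (rule finite_measure_M)
  interpret N: finite_measure N by (rule finite_measure_N)
  let ?n = "real CARD('n)"
  let ?A = "\<lambda>i. partial_deriv i u x" and ?H = "\<lambda>j i. partial_deriv j (partial_deriv i u) x"
  let ?P1 = "\<lambda>i. LINT y|M. kR \<delta> x y * (y - x) $ i"
  let ?P2 = "\<lambda>i j. LINT y|M. kR \<delta> x y * ((y - x) $ i * (y - x) $ j)"
  let ?Q1 = "\<lambda>y. \<Sum>i\<in>UNIV. ?A i * (kR \<delta> x y * (y - x) $ i)"
  let ?Q2 = "\<lambda>y. \<Sum>i\<in>UNIV. \<Sum>j\<in>UNIV. ?H j i * (kR \<delta> x y * ((y - x) $ i * (y - x) $ j))"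
  let ?U = "LINT y|M. kR \<delta> x y * (u x - u y)"
  let ?V = "LINT y|N. kK \<delta> x y * (u x - u y)"
  let ?W = "LINT y|M. kK \<delta> x y * laplacian u y"
  define B q m \<epsilon> where "B = boundary_mass \<delta> x" and "q = second_moment \<delta> x" and "m = interior_mass \<delta> x" and "\<epsilon> = min (2 * \<delta>) D"
  have nn: "B \<ge> 0" "q \<ge> 0" "m \<ge> 0" "\<epsilon> > 0" "\<epsilon> \<le> D" "\<epsilon> \<le> 2 * \<delta>" "?n \<ge> 0"
    using boundary_mass_nonneg[OF \<delta>] second_moment_nonneg[OF \<delta>] interior_mass_nonneg[OF \<delta>] \<delta> D_ge_1
    by (auto simp: B_def q_def m_def \<epsilon>_def)
  define J1 where "J1 i = ?P1 i / (2 * \<delta>\<^sup>2)" for i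
  define J2 where "J2 i j = ?P2 i j / (2 * \<delta>\<^sup>2)" for i j
  \<comment> \<open>\<open>e\<close> is the deviation of the normalised second moments from the
    interior mass times the identity matrix.\<close>
  define e where "e i j = J2 i j - (if i = j then m else 0)" for i j
  have J1: "\<bar>J1 i\<bar> \<le> B" for i
  proof -
    have "\<bar>J1 i\<bar> = \<bar>LINT y|M. kR \<delta> x y * (y - x) $ i\<bar> / (2 * \<delta>\<^sup>2)" by (simp only: J1_def abs_divide) simp
    also have "\<dots> \<le> B" using first_moment_bound[OF \<delta>, of x i] \<delta> by (subst pos_divide_le_eq) (auto simp: B_def mult_ac)
    finally show ?thesis .
  qed
  have e: "\<bar>e i j\<bar> \<le> \<epsilon> * B" for i j
    using second_moment_entries[OF \<delta> x, of i j] by (simp only: e_def J2_def m_def \<epsilon>_def B_def)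
  define E where "E y = u y - u x - (\<Sum>i\<in>UNIV. ?A i * (y - x) $ i) - (\<Sum>i\<in>UNIV. \<Sum>j\<in>UNIV. ?H j i * ((y - x) $ i * (y - x) $ j)) / 2" for y
  have iE: "integrable M E"
    unfolding E_def[abs_def]
    by (intro Bochner_Integration.integrable_diff integrable_divide_zero Bochner_Integration.integrable_sum integrable_mult_right int integrable_diff_M M.integrable_const)
  have E: "\<bar>(LINT y|M. kR \<delta> x y * E y) / \<delta>\<^sup>2\<bar> \<le> T * (\<epsilon> * q)"
    unfolding \<epsilon>_def q_def
    by (rule Taylor_expectation_bound[OF \<delta> x T iE]) (use taylor[OF x] in \<open>simp only: E_def\<close>)
  have "?U =
     (LINT y|M. - ?Q1 y - ?Q2 y / 2 - kR \<delta> x y * E y)"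
  proof (rule Bochner_Integration.integral_cong[OF refl])
    fix y
    let ?S1 = "\<Sum>i\<in>UNIV. ?A i * (y - x) $ i" and ?S2 = "\<Sum>i\<in>UNIV. \<Sum>j\<in>UNIV. ?H j i * ((y - x) $ i * (y - x) $ j)"
    have "?Q1 y = kR \<delta> x y * ?S1"
      by (simp only: sum_distrib_left mult.left_commute[of "kR \<delta> x y"])
    moreover have "?Q2 y = kR \<delta> x y * ?S2"
      by (simp only: sum_distrib_left mult.left_commute[of "kR \<delta> x y"])
    moreover have "u x - u y = - ?S1 - ?S2 / 2 - E y" by (simp only: E_def)
    then have "kR \<delta> x y * (u x - u y) = - (kR \<delta> x y * ?S1) - kR \<delta> x y * ?S2 / 2 - kR \<delta> x y * E y"
      by (simp only: right_diff_distrib mult_minus_right times_divide_eq_right)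
    ultimately show "kR \<delta> x y * (u x - u y) = - ?Q1 y - ?Q2 y / 2 - kR \<delta> x y * E y"
      by simp
  qed
  also have "\<dots> = - (\<Sum>i\<in>UNIV. ?A i * ?P1 i)
     - (\<Sum>i\<in>UNIV. \<Sum>j\<in>UNIV. ?H j i * ?P2 i j) / 2 - (LINT y|M. kR \<delta> x y * E y)"
  proof -
    have i1: "integrable M (\<lambda>y. ?A i * (kR \<delta> x y * (y - x) $ i))" for i
      by (intro integrable_mult_right integrable_kR \<delta> integrable_diff_M)
    have i2: "integrable M (\<lambda>y. ?H j i * (kR \<delta> x y * ((y - x) $ i * (y - x) $ j)))" for i j
      by (intro integrable_mult_right integrable_kR \<delta> integrable_diff_M)
    have s1: "integrable M (\<lambda>y. - ?Q1 y)"
      by (intro Bochner_Integration.integrable_minus Bochner_Integration.integrable_sum i1)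
    have s2: "integrable M (\<lambda>y. ?Q2 y / 2)"
      by (intro integrable_divide_zero Bochner_Integration.integrable_sum i2)
    have l1: "(LINT y|M. ?Q1 y) = (\<Sum>i\<in>UNIV. ?A i * ?P1 i)"
      by (subst Bochner_Integration.integral_sum[OF i1]) (simp only: integral_mult_right_zero)
    have l2: "(LINT y|M. ?Q2 y) = (\<Sum>i\<in>UNIV. \<Sum>j\<in>UNIV. ?H j i * ?P2 i j)"
      by (subst Bochner_Integration.integral_sum[OF Bochner_Integration.integrable_sum[OF i2]])
         (simp only: Bochner_Integration.integral_sum[OF i2] integral_mult_right_zero)
    show ?thesis
      by (simp only: Bochner_Integration.integral_diff[OF Bochner_Integration.integrable_diff[OF s1 s2] integrable_kR[OF \<delta> iE]]
          Bochner_Integration.integral_diff[OF s1 s2] Bochner_Integration.integral_minus integral_divide_zero l1 l2)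
  qed
  finally have I: "?U = - (\<Sum>i\<in>UNIV. ?A i * ?P1 i)
     - (\<Sum>i\<in>UNIV. \<Sum>j\<in>UNIV. ?H j i * ?P2 i j) / 2 - (LINT y|M. kR \<delta> x y * E y)" .
  have scale: "a / (2 * \<delta>\<^sup>2) = a / \<delta>\<^sup>2 / 2" for a by simp
  have I1: "(\<Sum>i\<in>UNIV. ?A i * f i) / \<delta>\<^sup>2 = 2 * (\<Sum>i\<in>UNIV. ?A i * (f i / (2 * \<delta>\<^sup>2)))" for f :: "'n \<Rightarrow> real"
    by (simp only: scale times_divide_eq_right sum_divide_distrib[symmetric]) simp
  have I2: "(\<Sum>i\<in>UNIV. \<Sum>j\<in>UNIV. ?H j i * f i j) / 2 / \<delta>\<^sup>2 = (\<Sum>i\<in>UNIV. \<Sum>j\<in>UNIV. ?H j i * (f i j / (2 * \<delta>\<^sup>2)))" for f :: "'n \<Rightarrow> 'n \<Rightarrow> real"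
    by (simp only: times_divide_eq_right sum_divide_distrib[symmetric] divide_divide_eq_left)
  have J2_eq: "J2 i j = (if i = j then m else 0) + e i j" for i j by (simp only: e_def)
  \<comment> \<open>The diagonal part of the second moments picks the trace of the Hessian, that is,
    the Laplacian.\<close>
  have trace: "(\<Sum>j\<in>UNIV. ?H j i * (if i = j then m else 0)) = ?H i i * m" for i
    by (subst sum.remove[of UNIV i]) auto
  have "(\<Sum>i\<in>UNIV. \<Sum>j\<in>UNIV. ?H j i * J2 i j) = laplacian u x * m + (\<Sum>i\<in>UNIV. \<Sum>j\<in>UNIV. ?H j i * e i j)"
    by (simp only: J2_eq distrib_left sum.distrib trace laplacian_def sum_distrib_right)
  then have main: "?U / \<delta>\<^sup>2 = - 2 * (\<Sum>i\<in>UNIV. ?A i * J1 i)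
     - (m * laplacian u x + (\<Sum>i\<in>UNIV. \<Sum>j\<in>UNIV. ?H j i * e i j)) - (LINT y|M. kR \<delta> x y * E y) / \<delta>\<^sup>2"
    by (simp only: I diff_divide_distrib minus_divide_left[symmetric] I1 I2 J1_def[symmetric] J2_def[symmetric]
        mult_minus_left mult.commute[of _ m])
  have b1: "\<bar>\<Sum>i\<in>UNIV. ?A i * J1 i\<bar> \<le> ?n * (T * B)"
  proof -
    have "\<bar>\<Sum>i\<in>UNIV. ?A i * J1 i\<bar> \<le> (\<Sum>i\<in>UNIV. \<bar>?A i * J1 i\<bar>)" by (rule sum_abs)
    also have "\<dots> \<le> ?n * (T * B)"
      by (rule sum_bounded_above, unfold abs_mult, intro mult_mono u1[OF x] J1 T abs_ge_zero)
    finally show ?thesis .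
  qed
  have b2: "\<bar>\<Sum>i\<in>UNIV. \<Sum>j\<in>UNIV. ?H j i * e i j\<bar> \<le> ?n * (?n * (T * (\<epsilon> * B)))"
  proof -
    have "\<bar>\<Sum>i\<in>UNIV. \<Sum>j\<in>UNIV. ?H j i * e i j\<bar> \<le> (\<Sum>i\<in>UNIV. \<Sum>j\<in>UNIV. \<bar>?H j i * e i j\<bar>)"
      by (rule order_trans[OF sum_abs]) (intro sum_mono sum_abs)
    also have "\<dots> \<le> ?n * (?n * (T * (\<epsilon> * B)))"
      by (rule sum_bounded_above, rule sum_bounded_above, unfold abs_mult, intro mult_mono u2[OF x] e T abs_ge_zero)
    finally show ?thesis .
  qed
  \<comment> \<open>The Lipschitz bound on u supplies a factor 2\<delta> that cancels the penalty
    weight, so the boundary term is of order \<open>B\<close>.\<close>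
  have b3: "\<bar>2 / \<delta> * ?V\<bar> \<le> 4 * T * B"
  proof -
    have "\<bar>?V\<bar> \<le> T * (min (2 * \<delta>) D * boundary_mass \<delta> x)"
      using uN lip[OF x frontier_subset] T by (intro integral_kK_dist_N[OF \<delta> x]) (auto simp: abs_minus_commute)
    also have "\<dots> \<le> T * (2 * \<delta> * B)" using nn T by (intro mult_left_mono mult_mono) (auto simp: B_def)
    finally have "2 / \<delta> * \<bar>?V\<bar> \<le> 2 / \<delta> * (T * (2 * \<delta> * B))"
      using \<delta> by (intro mult_left_mono) auto
    then show ?thesis using \<delta> by (simp add: abs_mult)
  qed
  have b4: "\<bar>?W - m * laplacian u x\<bar> \<le> T * (\<epsilon> * m)"
  proof -
    have iK: "integrable M (\<lambda>y. kK \<delta> x y)" using integrable_kK[OF \<delta>, of "\<lambda>_. 1"] by simp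
    have "?W - m * laplacian u x = (LINT y|M. kK \<delta> x y * laplacian u y - kK \<delta> x y * laplacian u x)"
      using integrable_kK[OF \<delta> int(2)] iK by (subst Bochner_Integration.integral_diff) (auto simp: m_def interior_mass_def)
    also have "\<dots> = (LINT y|M. kK \<delta> x y * (laplacian u y - laplacian u x))" by (simp only: right_diff_distrib)
    also have "\<bar>\<dots>\<bar> \<le> (LINT y|M. \<bar>kK \<delta> x y * (laplacian u y - laplacian u x)\<bar>)"
      using integral_norm_bound[of M "\<lambda>y. kK \<delta> x y * (laplacian u y - laplacian u x)"] by simp
    also have "\<dots> \<le> (LINT y|M. (T * \<epsilon>) * kK \<delta> x y)"
    proof (rule integral_mono)
      show "integrable M (\<lambda>y. \<bar>kK \<delta> x y * (laplacian u y - laplacian u x)\<bar>)"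
        by (intro integrable_abs integrable_kK \<delta> Bochner_Integration.integrable_diff int M.integrable_const)
      fix y assume "y \<in> space M"
      then have y: "y \<in> \<Omega>" by (simp only: space_M)
      then have yc: "y \<in> closure \<Omega>" using closure_subset by blast
      have "\<bar>kK \<delta> x y * (laplacian u y - laplacian u x)\<bar> \<le> kK \<delta> x y * (T * dist x y)"
        using kernel_bounds(2)[OF \<delta>, of x y] lap[OF x y] by (simp add: abs_mult mult_left_mono)
      also have "\<dots> = T * (kK \<delta> x y * dist x y)" by simp
      also have "\<dots> \<le> T * (kK \<delta> x y * \<epsilon>)" unfolding \<epsilon>_def by (intro mult_left_mono T kernel_dist_le \<delta> x yc)
      finally show "\<bar>kK \<delta> x y * (laplacian u y - laplacian u x)\<bar> \<le> (T * \<epsilon>) * kK \<delta> x y" by (simp only: mult_ac)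
    qed (use iK in auto)
    finally show ?thesis by (simp add: m_def interior_mass_def)
  qed
  \<comment> \<open>The oscillation of the Laplacian was weighted by the interior mass; here it is
    traded for the second moment and the boundary mass.\<close>
  have b5: "T * (\<epsilon> * m) \<le> T * (\<epsilon> * q) + T * (?n * D * D * B)"
  proof -
    have "m \<le> q + ?n * (D * B)" using interior_mass_le[OF \<delta> x] by (simp only: m_def q_def B_def)
    then have "\<epsilon> * m \<le> \<epsilon> * (q + ?n * (D * B))" using nn by (intro mult_left_mono) auto
    also have "\<dots> = \<epsilon> * q + \<epsilon> * (?n * (D * B))" by (rule distrib_left)
    also have "\<epsilon> * (?n * (D * B)) \<le> D * (?n * (D * B))"
      using nn D_ge_1 by (intro mult_right_mono mult_nonneg_nonneg) auto
    finally have "T * (\<epsilon> * m) \<le> T * (\<epsilon> * q + D * (?n * (D * B)))" using T by (intro mult_left_mono) auto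
    then show ?thesis by (simp add: algebra_simps)
  qed
  have b6: "?n * (?n * (T * (\<epsilon> * B))) \<le> ?n * (?n * (T * (D * B)))"
    using nn T by (intro mult_left_mono mult_right_mono mult_nonneg_nonneg) auto
  have "\<bar>?U / \<delta>\<^sup>2 + 2 / \<delta> * ?V + ?W\<bar>
     \<le> 2 * (?n * (T * B)) + ?n * (?n * (T * (D * B))) + T * (\<epsilon> * q) + 4 * T * B + (T * (\<epsilon> * q) + T * (?n * D * D * B))"
    using main b1 b2 b3 b4 b5 b6 E by linarith
  also have "\<dots> = T * (2 * ?n + ?n * ?n * D + 4 + ?n * D * D) * B + T * 2 * (\<epsilon> * q)"
    by (simp add: algebra_simps)
  \<comment> \<open>The 4 from the boundary term and the coefficient 2 of \<epsilon> q are both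
    below 6, which leaves a common factor.\<close>
  also have "\<dots> \<le> T * (2 * ?n + ?n * ?n * D + 6 + ?n * D * D) * B + T * (2 * ?n + ?n * ?n * D + 6 + ?n * D * D) * (\<epsilon> * q)"
    using nn T D_ge_1 by (intro add_mono mult_right_mono mult_left_mono) auto
  also have "\<dots> = T * (2 * ?n + ?n * ?n * D + 6 + ?n * D * D) * (B + \<epsilon> * q)" by (simp only: distrib_left)
  finally show ?thesis by (simp only: B_def q_def \<epsilon>_def of_nat_mult of_nat_add of_nat_numeral)
qed

end

context nonlocal_domain
begin

section \<open>Comparison and the error bound\<close>

text \<open>The minimum principle demands a strict inequality, and the second moment provides it.
  The lower bound on R makes the integrand nonzero on a punctured ball around x, which is not
  negligible.\<close>

lemma second_moment_pos:
  assumes \<gamma>: "\<gamma>\<^sub>0 > 0" "\<And>r. 0 \<le> r \<Longrightarrow> r \<le> 1/2 \<Longrightarrow> R r \<ge> \<gamma>\<^sub>0"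
    and \<delta>: "0 < \<delta>" and x: "x \<in> \<Omega>"
  shows "0 < second_moment \<delta> x"
proof (rule ccontr)
  let ?f = "\<lambda>y. kR \<delta> x y * (dist x y)\<^sup>2"
  assume "\<not> 0 < second_moment \<delta> x"
  then have "second_moment \<delta> x = 0" using second_moment_nonneg[OF \<delta>, of x] by linarith
  then have "(LINT y|M. ?f y) = 0" using \<delta> by (simp add: second_moment_def)
  then have "AE y in M. ?f y = 0"
    using kernel_bounds(1)[OF \<delta>]
    by (subst (asm) integral_nonneg_eq_0_iff_AE[OF integrable_kR[OF \<delta> integrable_diff_M(3)]]) auto
  then have ae: "AE y in lebesgue. y \<in> \<Omega> \<longrightarrow> ?f y = 0"
    using open_domain by (subst (asm) AE_restrict_space_iff) auto
  obtain r where r: "r > 0" "ball x r \<subseteq> \<Omega>" using open_domain x open_contains_ball by blast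
  \<comment> \<open>Within this radius points stay in \<Omega> and the argument of R is at most
    1/4.\<close>
  define s where "s = min r \<delta>"
  have s: "s > 0" "s \<le> r" "s \<le> \<delta>" using r \<delta> by (auto simp: s_def)
  have f_pos: "?f y \<noteq> 0" if y: "y \<in> ball x s" "y \<noteq> x" for y
  proof -
    have "(norm (x - y))\<^sup>2 \<le> \<delta>\<^sup>2" using y(1) s(3) by (intro power_mono) (auto simp: dist_norm)
    then have "(norm (x - y))\<^sup>2 / (4 * \<delta>\<^sup>2) \<le> \<delta>\<^sup>2 / (4 * \<delta>\<^sup>2)" by (rule divide_right_mono) simp
    also have "\<dots> \<le> 1/2" using \<delta> by simp
    finally have "(norm (x - y))\<^sup>2 / (4 * \<delta>\<^sup>2) \<le> 1/2" .
    from \<gamma>(2)[OF _ this] have "R ((norm (x - y))\<^sup>2 / (4 * \<delta>\<^sup>2)) \<noteq> 0" using \<gamma>(1) by fastforce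
    then show ?thesis using \<alpha>_pos \<delta> y(2) by (simp add: scaled_kernel_def)
  qed
  obtain Z where Z: "negligible Z" "{y. \<not> (y \<in> \<Omega> \<longrightarrow> ?f y = 0)} \<subseteq> Z"
    using ae unfolding eventually_ae_filter_negligible by blast
  then have "negligible {y. \<not> (y \<in> \<Omega> \<longrightarrow> ?f y = 0)}" by (rule negligible_subset)
  then have "negligible (insert x {y. \<not> (y \<in> \<Omega> \<longrightarrow> ?f y = 0)})" by (simp add: negligible_insert)
  moreover have "ball x s \<subseteq> insert x {y. \<not> (y \<in> \<Omega> \<longrightarrow> ?f y = 0)}"
    using f_pos r(2) s(2) by (auto simp: subset_iff)
  ultimately have "negligible (ball x s)" by (rule negligible_subset)
  then show False using open_not_negligible[OF open_ball, of x s] s(1) by auto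
qed

lemma nonlocal_comparison:
  assumes \<delta>: "0 < \<delta>" and h: "integrable M h"
    and pos: "\<And>x. x \<in> \<Omega> \<Longrightarrow> 0 < nonlocal_op \<delta> h x" and x: "x \<in> \<Omega>"
  shows "0 \<le> h x"
proof (rule nonlocal_minimum_principle[of M "\<lambda>x y. kR \<delta> x y / \<delta>\<^sup>2" "\<alpha> / \<delta> ^ CARD('n) * b / \<delta>\<^sup>2" h "\<lambda>x. 2 / \<delta> * boundary_mass \<delta> x"])
  have id: "(\<lambda>y. y) \<in> borel_measurable M" by (intro measurable_M continuous_intros)
  have "(\<lambda>z. kR \<delta> (fst z) (snd z)) \<in> borel_measurable (M \<Otimes>\<^sub>M M)"
    by (rule borel_measurable_scaled_kernel(1))
       (rule measurable_compose[OF measurable_fst id], rule measurable_compose[OF measurable_snd id])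
  then show "(\<lambda>(x, y). kR \<delta> x y / \<delta>\<^sup>2) \<in> borel_measurable (M \<Otimes>\<^sub>M M)"
    by (simp add: case_prod_unfold)
  show "kR \<delta> x y / \<delta>\<^sup>2 = kR \<delta> y x / \<delta>\<^sup>2" for x y
    by (simp add: scaled_kernel_def norm_minus_commute)
  show "kR \<delta> x y / \<delta>\<^sup>2 \<le> \<alpha> / \<delta> ^ CARD('n) * b / \<delta>\<^sup>2" for x y
    by (rule divide_right_mono[OF kernel_bounds(3)[OF \<delta>]]) simp
  fix x assume "x \<in> space M"
  then have "x \<in> \<Omega>" by (simp only: space_M)
  then show "0 < (LINT y|M. kR \<delta> x y / \<delta>\<^sup>2 * (h x - h y)) + 2 / \<delta> * boundary_mass \<delta> x * h x"
    using pos[of x] by (simp add: nonlocal_op_def)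
  show "0 \<le> 2 / \<delta> * boundary_mass \<delta> x" using \<delta> boundary_mass_nonneg[OF \<delta>] by simp
qed (use finite_measure_M h x kernel_bounds[OF \<delta>] \<delta> in auto)

text \<open>The multiple \<open>A\<close> of the barrier produces T + 1 times the quantity of which
  the residual is at most T times. The spare copy is positive and gives the strictness for the
  comparison.\<close>

lemma nonlocal_error_bound:
  fixes u v :: "real^'n \<Rightarrow> real"
  assumes \<gamma>: "\<gamma>\<^sub>0 > 0" "\<And>r. 0 \<le> r \<Longrightarrow> r \<le> 1/2 \<Longrightarrow> R r \<ge> \<gamma>\<^sub>0"
    and T: "0 \<le> T"
    and res: "\<And>x. x \<in> \<Omega> \<Longrightarrow> \<bar>nonlocal_op \<delta> (\<lambda>y. u y - v y) x\<bar>
        \<le> T * (boundary_mass \<delta> x + min (2 * \<delta>) D * second_moment \<delta> x)"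
    and int: "integrable M u" "integrable M v"
    and \<delta>: "0 < \<delta>" and x: "x \<in> \<Omega>"
  shows "\<bar>u x - v x\<bar> \<le> (T + 1) * (2 * D) * (D\<^sup>2 + 2 * CARD('n) * D + 1) * 2 * \<delta>"
proof -
  interpret M: finite_measure M by (rule finite_measure_M)
  define w where "w y = D\<^sup>2 + 2 * CARD('n) * D * \<delta> + 1 + \<delta> - (norm y)\<^sup>2" for y :: "real^'n"
  \<comment> \<open>Chosen to meet three demands for all \<delta>: \<open>a\<close> dominates
    \<open>min (2 * \<delta>) D\<close>, a times 2 (1 + \<delta>) / \<delta> is at least 1, and a (1
    + \<delta>) is still of order \<delta>.\<close>
  define a where "a = 2 * D * min 1 \<delta>"
  define A where "A = (T + 1) * a"
  have a: "a > 0" "min (2 * \<delta>) D \<le> a" "1 \<le> a * (2 * (1 + \<delta>) / \<delta>)"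
  proof -
    show "a > 0" using D_ge_1 \<delta> by (simp add: a_def)
    show "min (2 * \<delta>) D \<le> a"
    proof (cases "\<delta> \<le> 1")
      case True
      have "1 * (2 * \<delta>) \<le> D * (2 * \<delta>)" using D_ge_1 \<delta> by (intro mult_right_mono) auto
      then show ?thesis using True by (simp add: a_def min_def)
    qed (use D_ge_1 in \<open>auto simp: a_def min_def\<close>)
    have "1 * 1 \<le> (2 * 2 * D) * (min 1 \<delta> * (1 + \<delta>) / \<delta>)"
    proof (rule mult_mono)
      show "1 \<le> min 1 \<delta> * (1 + \<delta>) / \<delta>" using \<delta> by (cases "\<delta> \<le> 1") (auto simp: min_def)
    qed (use D_ge_1 in auto)
    then show "1 \<le> a * (2 * (1 + \<delta>) / \<delta>)" by (simp only: a_def times_divide_eq_right mult_ac mult_1_left)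
  qed
  have "integrable M w"
  proof (rule integrable_bounded_M)
    show "w \<in> borel_measurable M" unfolding w_def by (intro measurable_M continuous_intros)
    fix y assume "y \<in> \<Omega>"
    then have "(norm y)\<^sup>2 \<le> D\<^sup>2" using norm_le_D by (intro power_mono) auto
    moreover have "0 \<le> 2 * CARD('n) * D * \<delta>" using D_ge_1 \<delta> by simp
    ultimately show "\<bar>w y\<bar> \<le> D\<^sup>2 + 2 * CARD('n) * D * \<delta> + 1 + \<delta> + D\<^sup>2"
      using zero_le_power2[of "norm y"] zero_le_power2[of D] \<delta> unfolding w_def by linarith
  qed
  note iw = this
  have ie: "integrable M (\<lambda>y. u y - v y)" using int by auto
  have barrier: "(T + 1) * (boundary_mass \<delta> z + min (2 * \<delta>) D * second_moment \<delta> z) \<le> A * nonlocal_op \<delta> w z" if z: "z \<in> \<Omega>" for z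
  proof -
    let ?B = "boundary_mass \<delta> z" and ?q = "second_moment \<delta> z"
    have nn: "0 \<le> ?B" "0 \<le> ?q" using boundary_mass_nonneg second_moment_nonneg \<delta> by auto
    have "1 * ?B + min (2 * \<delta>) D * ?q \<le> a * (2 * (1 + \<delta>) / \<delta>) * ?B + a * ?q"
      using a nn by (intro add_mono mult_right_mono) auto
    also have "\<dots> = a * (?q + 2 * ?B * (1 + \<delta>) / \<delta>)" by (simp add: algebra_simps)
    also have "\<dots> \<le> a * nonlocal_op \<delta> w z"
      using a nonlocal_op_barrier[OF \<delta> z] unfolding w_def by (intro mult_left_mono) auto
    finally have "(T + 1) * (1 * ?B + min (2 * \<delta>) D * ?q) \<le> (T + 1) * (a * nonlocal_op \<delta> w z)"
      using T by (intro mult_left_mono) auto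
    then show ?thesis by (simp add: A_def mult.assoc)
  qed
  \<comment> \<open>Comparison for both signs of the error gives the two-sided estimate.\<close>
  have bound: "0 \<le> A * w x + \<sigma> * (u x - v x)" if \<sigma>: "\<sigma> \<in> {1, -1}" for \<sigma> :: real
  proof (rule nonlocal_comparison[OF \<delta> _ _ x])
    show "integrable M (\<lambda>x. A * w x + \<sigma> * (u x - v x))" using iw ie by auto
    fix z assume z: "z \<in> \<Omega>"
    let ?s = "boundary_mass \<delta> z + min (2 * \<delta>) D * second_moment \<delta> z"
    have "0 < min (2 * \<delta>) D * second_moment \<delta> z"
      using second_moment_pos[OF \<gamma> \<delta> z] \<delta> D_ge_1 by (intro mult_pos_pos) auto
    then have "0 < ?s" using boundary_mass_nonneg[OF \<delta>, of z] by linarith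
    moreover have "nonlocal_op \<delta> (\<lambda>x. A * w x + \<sigma> * (u x - v x)) z = A * nonlocal_op \<delta> w z + \<sigma> * nonlocal_op \<delta> (\<lambda>y. u y - v y) z"
      by (rule nonlocal_op_linear[OF \<delta> iw ie z])
    moreover have "\<sigma> * nonlocal_op \<delta> (\<lambda>y. u y - v y) z \<ge> - (T * ?s)" using res[OF z] \<sigma> by auto
    ultimately show "0 < nonlocal_op \<delta> (\<lambda>x. A * w x + \<sigma> * (u x - v x)) z"
      using barrier[OF z] by (simp only: distrib_right mult_1_left)
  qed
  have "\<bar>u x - v x\<bar> \<le> A * w x" using bound[of 1] bound[of "-1"] by auto
  also have "\<dots> \<le> A * ((D\<^sup>2 + 2 * CARD('n) * D + 1) * (1 + \<delta>))"
  proof (rule mult_left_mono)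
    have "0 \<le> D\<^sup>2 * \<delta>" "0 \<le> 2 * CARD('n) * D" using D_ge_1 \<delta> by auto
    then show "w x \<le> (D\<^sup>2 + 2 * CARD('n) * D + 1) * (1 + \<delta>)"
      using zero_le_power2[of "norm x"] unfolding w_def by (simp add: algebra_simps)
  qed (use T a in \<open>simp add: A_def\<close>)
  also have "\<dots> = (T + 1) * (2 * D) * (D\<^sup>2 + 2 * CARD('n) * D + 1) * (min 1 \<delta> * (1 + \<delta>))"
    by (simp only: A_def a_def mult_ac)
  also have "\<dots> \<le> (T + 1) * (2 * D) * (D\<^sup>2 + 2 * CARD('n) * D + 1) * (2 * \<delta>)"
  proof (rule mult_left_mono)
    show "min 1 \<delta> * (1 + \<delta>) \<le> 2 * \<delta>"
      using \<delta> mult_left_le[of \<delta> \<delta>] by (cases "\<delta> \<le> 1") (auto simp: min_def algebra_simps)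
    show "0 \<le> (T + 1) * (2 * D) * (D\<^sup>2 + 2 * CARD('n) * D + 1)"
      using T D_ge_1 by (intro mult_nonneg_nonneg add_nonneg_nonneg) auto
  qed
  finally show ?thesis by simp
qed

end

text \<open>Approximating a boundary point by points of \<Omega> carries the Lipschitz bound to the
  boundary values, as the boundary integral of u(x) - u(y) requires.\<close>

lemma lipschitz_extends_to_closure:
  fixes u :: "'a::metric_space \<Rightarrow> real"
  assumes "continuous_on (closure \<Omega>) u" "\<And>y. y \<in> \<Omega> \<Longrightarrow> \<bar>u y - u x\<bar> \<le> T * dist x y" "y \<in> closure \<Omega>"
  shows "\<bar>u y - u x\<bar> \<le> T * dist x y"
proof -
  obtain s where s: "\<And>n. s n \<in> \<Omega>" "s \<longlonglongrightarrow> y" using assms(3) unfolding closure_sequential by blast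
  have "(\<lambda>n. u (s n)) \<longlonglongrightarrow> u y"
    using assms(1,3) s closure_subset unfolding continuous_on_sequentially comp_def by blast
  then have "(\<lambda>n. \<bar>u (s n) - u x\<bar>) \<longlonglongrightarrow> \<bar>u y - u x\<bar>" by (intro tendsto_intros)
  moreover have "(\<lambda>n. T * dist x (s n)) \<longlonglongrightarrow> T * dist x y" by (intro tendsto_intros s)
  ultimately show ?thesis by (rule LIMSEQ_le) (use assms(2) s in auto)
qed

theorem theorem2p4:
  fixes \<Omega> :: "(real^'n::finite) set"
    and S :: "(real^'n) measure"
    and R R' :: "real \<Rightarrow> real"
    and \<gamma>\<^sub>0 \<alpha> :: real
    and u f g :: "real^'n \<Rightarrow> real"
  assumes "open \<Omega>" and "bounded \<Omega>" and "connected \<Omega>" and "smooth_boundary \<Omega>"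
    and "is_surface_measure \<Omega> S"
    and "\<And>r. 0 \<le> r \<Longrightarrow> r \<le> 1 \<Longrightarrow> (R has_real_derivative R' r) (at r within {0..1})"
    and "continuous_on {0..1} R'"
    and "\<And>r. 0 \<le> r \<Longrightarrow> R r \<ge> 0"
    and "\<And>r. r > 1 \<Longrightarrow> R r = 0"
    and "\<gamma>\<^sub>0 > 0" and "\<And>r. 0 \<le> r \<Longrightarrow> r \<le> 1/2 \<Longrightarrow> R r \<ge> \<gamma>\<^sub>0"
    and "\<alpha> > 0"
    and "\<And>\<delta> (x::real^'n). \<delta> > 0 \<Longrightarrow>
           (LINT y|lebesgue. scaled_kernel \<alpha> (tail_integral R) \<delta> x y) = 1"
    and "\<And>x. x \<in> \<Omega> \<Longrightarrow> - laplacian u x = f x"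
    and "\<And>x. x \<in> frontier \<Omega> \<Longrightarrow> u x = g x"
    and "Ck_closure 4 \<Omega> u"
  shows "\<exists>C>0. \<forall>\<delta>>0. \<forall>u\<^sub>\<delta>. nonlocal_solution \<Omega> S \<alpha> R f g \<delta> u\<^sub>\<delta> \<longrightarrow>
           (\<forall>x\<in>\<Omega>. \<bar>u x - u\<^sub>\<delta> x\<bar> \<le> C * \<delta>)"
proof -
  note \<Omega> = assms(1,2,4) and S = assms(5)
  have contR: "continuous_on {0..1} R"
    unfolding continuous_on_eq_continuous_within
    by (rule ballI, rule DERIV_continuous[OF assms(6)]) auto
  have "bounded (R ` {0..1})" by (intro compact_imp_bounded compact_continuous_image contR compact_Icc)
  then obtain b where b: "b > 0" "\<forall>r\<in>R ` {0..1}. norm r \<le> b" unfolding bounded_pos by blast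
  have Rb: "R r \<le> b" if "0 \<le> r" for r
  proof (cases "r \<le> 1")
    case True
    then show ?thesis using b(2) that by (auto simp: abs_le_iff)
  qed (use assms(9)[of r] b(1) in auto)
  obtain e where "\<forall>x\<in>closure \<Omega>. norm x \<le> e"
    using bounded_closure[OF assms(2)] unfolding bounded_iff by blast
  then have norm_e: "norm x \<le> e" if "x \<in> closure \<Omega>" for x using that by blast
  \<comment> \<open>Twice the bound on the norms bounds all distances.\<close>
  define D where "D = max 1 (2 * e)"
  interpret nonlocal_domain R b \<Omega> S \<alpha> D
  proof
    show "norm x \<le> D" if "x \<in> \<Omega>" for x
      using norm_e[of x] that closure_subset[of \<Omega>] norm_ge_zero[of x] unfolding D_def by force
    show "dist x y \<le> D" if "x \<in> closure \<Omega>" "y \<in> closure \<Omega>" for x y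
      using norm_e[OF that(1)] norm_e[OF that(2)] norm_triangle_ineq4[of x y] by (simp add: D_def dist_norm)
  qed (use contR assms Rb in \<open>auto simp: D_def\<close>)
  obtain T where T: "T \<ge> 0"
    "\<And>x i. x \<in> \<Omega> \<Longrightarrow> \<bar>partial_deriv i u x\<bar> \<le> T"
    "\<And>x i j. x \<in> \<Omega> \<Longrightarrow> \<bar>partial_deriv j (partial_deriv i u) x\<bar> \<le> T"
    "\<And>x y. x \<in> \<Omega> \<Longrightarrow> y \<in> \<Omega> \<Longrightarrow> \<bar>u y - u x\<bar> \<le> T * dist x y"
    "\<And>x y. x \<in> \<Omega> \<Longrightarrow> y \<in> \<Omega> \<Longrightarrow> \<bar>laplacian u y - laplacian u x\<bar> \<le> T * dist x y"
    "\<And>x y. x \<in> \<Omega> \<Longrightarrow> y \<in> \<Omega> \<Longrightarrow> \<bar>u y - u x - (\<Sum>i\<in>UNIV. partial_deriv i u x * (y - x) $ i)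
       - (\<Sum>i\<in>UNIV. \<Sum>j\<in>UNIV. partial_deriv j (partial_deriv i u) x * ((y - x) $ i * (y - x) $ j)) / 2\<bar> \<le> T * dist x y ^ 3"
    using Taylor_bounds_closure[OF \<Omega> assms(16)] by blast
  have cu: "continuous_on (closure \<Omega>) u" using assms(16) by (simp add: Ck_closure_def)
  have lip: "\<bar>u y - u x\<bar> \<le> T * dist x y" if "x \<in> \<Omega>" "y \<in> closure \<Omega>" for x y
    by (rule lipschitz_extends_to_closure[OF cu T(4)[OF that(1)] that(2)])
  obtain U where U: "\<And>y. y \<in> closure \<Omega> \<Longrightarrow> \<bar>u y\<bar> \<le> U"
  proof -
    have "bounded (u ` closure \<Omega>)" using assms(2) by (intro compact_imp_bounded compact_continuous_image cu) auto
    then show ?thesis using that unfolding bounded_iff by auto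
  qed
  have sub: "\<Omega> \<subseteq> closure \<Omega>" "frontier \<Omega> \<subseteq> closure \<Omega>" using closure_subset frontier_subset by auto
  have iu: "integrable M u"
    by (rule integrable_bounded_M[OF measurable_M[OF continuous_on_subset[OF cu sub(1)]]]) (use U sub in blast)
  have uN: "u \<in> borel_measurable N" by (rule measurable_N[OF continuous_on_subset[OF cu sub(2)]])
  have ilap: "integrable M (laplacian u)"
  proof (rule integrable_bounded_M)
    have "Ck_on 4 \<Omega> u" using assms(16) by (simp add: Ck_closure_def)
    then have "continuous_on \<Omega> (iter_partial [i, i] u)" for i
      unfolding Ck_on_def by (elim conjE allE[of _ "[i, i]"]) simp
    then have "continuous_on \<Omega> (\<lambda>x. \<Sum>i\<in>UNIV. partial_deriv i (partial_deriv i u) x)"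
      by (intro continuous_on_sum) simp
    then show "laplacian u \<in> borel_measurable M" unfolding laplacian_def[abs_def] by (rule measurable_M)
    show "\<bar>laplacian u y\<bar> \<le> CARD('n) * T" if "y \<in> \<Omega>" for y
      unfolding laplacian_def by (rule order_trans[OF sum_abs]) (rule sum_bounded_above, rule T(3)[OF that])
  qed
  define C0 where "C0 = T * (2 * CARD('n) + CARD('n) * CARD('n) * D + 6 + CARD('n) * D * D)"
  define C where "C = (C0 + 1) * (2 * D) * (D\<^sup>2 + 2 * CARD('n) * D + 1) * 2"
  have D1: "D \<ge> 1" by (simp add: D_def)
  have C0: "C0 \<ge> 0" unfolding C0_def using T(1) D1 by (intro mult_nonneg_nonneg add_nonneg_nonneg) auto
  have "C > 0" unfolding C_def using C0 D1 by (intro mult_pos_pos add_nonneg_pos) auto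
  moreover have "\<bar>u x - v x\<bar> \<le> C * \<delta>" if \<delta>: "\<delta> > 0" and v: "nonlocal_solution \<Omega> S \<alpha> R f g \<delta> v" and x: "x \<in> \<Omega>" for \<delta> v x
    unfolding C_def
  proof (rule nonlocal_error_bound[OF assms(10,11) C0 _ iu _ \<delta> x])
    interpret M: finite_measure M by (rule finite_measure_M)
    interpret N: finite_measure N by (rule finite_measure_N)
    have \<Omega>_leb: "\<Omega> \<inter> space lebesgue \<in> sets lebesgue" using \<Omega>(1) by (simp add: borel_open)
    have set_M: "(LINT y:\<Omega>|lebesgue. h y) = (LINT y|M. h y)" for h :: "real^'n \<Rightarrow> real"
      using integral_restrict_space[OF \<Omega>_leb, of h] by (simp add: set_lebesgue_integral_def)
    have sS: "sets S = sets borel" using S by (simp add: is_surface_measure_def)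
    then have fr: "frontier \<Omega> \<inter> space S \<in> sets S"
      using sets_eq_imp_space_eq[OF sS] by (simp add: borel_closed frontier_closed)
    have set_N: "(LINT y:frontier \<Omega>|S. h y) = (LINT y|N. h y)" for h :: "real^'n \<Rightarrow> real"
      using integral_restrict_space[OF fr, of h] by (simp add: set_lebesgue_integral_def)
    have sq: "square_integrable_on v \<Omega>" using v by (simp add: nonlocal_solution_def)
    show iv: "integrable M v"
    proof (rule Bochner_Integration.integrable_bound)
      have "integrable M (\<lambda>y. (v y)\<^sup>2)"
        using sq integrable_restrict_space[OF \<Omega>_leb, of "\<lambda>y. (v y)\<^sup>2"] by (simp add: square_integrable_on_def set_integrable_def)
      then show "integrable M (\<lambda>y. 1 + (v y)\<^sup>2)" by simp
      show "v \<in> borel_measurable M"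
        using sq borel_measurable_restrict_space_iff[OF \<Omega>_leb, of v] by (simp add: square_integrable_on_def set_borel_measurable_def)
      \<comment> \<open>On a finite measure space square integrable functions are integrable; 1 +
        t^2 is the majorant.\<close>
      have "\<bar>t\<bar> \<le> \<bar>1 + t\<^sup>2\<bar>" for t :: real
        using zero_le_power2[of "\<bar>t\<bar> - 1"] zero_le_power2[of t] by (simp add: power2_diff)
      then show "AE y in M. norm (v y) \<le> norm (1 + (v y)\<^sup>2)" by simp
    qed
    fix z assume z: "z \<in> \<Omega>"
    have eq: "(LINT y|M. kR \<delta> z y * (v z - v y)) / \<delta>\<^sup>2 + 2 / \<delta> * (LINT y|N. kK \<delta> z y * (v z - g y)) = (LINT y|M. kK \<delta> z y * f y)"
      using v z unfolding nonlocal_solution_def set_M set_N by auto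
    \<comment> \<open>On the boundary g equals u, so both equations carry the same data and these
      drop out of the difference.\<close>
    have gN: "(LINT y|N. kK \<delta> z y * (v z - g y)) = (LINT y|N. kK \<delta> z y * (v z - u y))"
      by (rule Bochner_Integration.integral_cong[OF refl]) (simp only: space_N assms(15))
    have fM: "(LINT y|M. kK \<delta> z y * f y) = - (LINT y|M. kK \<delta> z y * laplacian u y)"
    proof -
      have "(LINT y|M. kK \<delta> z y * f y) = (LINT y|M. - (kK \<delta> z y * laplacian u y))"
        by (rule Bochner_Integration.integral_cong[OF refl]) (simp add: assms(14)[symmetric])
      then show ?thesis by simp
    qed
    have iK: "integrable N (\<lambda>y. kK \<delta> z y * 1)" by (rule integrable_kK_N[OF \<delta>, of _ 1]) auto
    have iKu: "integrable N (\<lambda>y. kK \<delta> z y * u y)" using U sub by (intro integrable_kK_N[OF \<delta> uN]) auto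
    have splitN: "(LINT y|N. kK \<delta> z y * (c - u y)) = boundary_mass \<delta> z * c - (LINT y|N. kK \<delta> z y * u y)" for c
      using iK iKu by (simp add: right_diff_distrib boundary_mass_def)
    have "nonlocal_op \<delta> (\<lambda>y. 1 * u y + (-1) * v y) z = 1 * nonlocal_op \<delta> u z + (-1) * nonlocal_op \<delta> v z"
      by (rule nonlocal_op_linear[OF \<delta> iu iv z])
    then have "nonlocal_op \<delta> (\<lambda>y. u y - v y) z = nonlocal_op \<delta> u z - nonlocal_op \<delta> v z" by simp
    \<comment> \<open>Subtracting the model equation turns the operator applied to u - v into the
      truncation error of u, with f replaced by minus the Laplacian.\<close>
    also have "\<dots> = (LINT y|M. kR \<delta> z y * (u z - u y)) / \<delta>\<^sup>2 + 2 / \<delta> * (LINT y|N. kK \<delta> z y * (u z - u y))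
      + (LINT y|M. kK \<delta> z y * laplacian u y)"
    proof -
      have distrib: "2 / \<delta> * (B * c - X) = 2 / \<delta> * B * c - 2 / \<delta> * X" for B c X by (simp only: right_diff_distrib mult.assoc)
      show ?thesis using eq unfolding gN fM splitN nonlocal_op_def distrib by linarith
    qed
    finally have op_eq: "nonlocal_op \<delta> (\<lambda>y. u y - v y) z = (LINT y|M. kR \<delta> z y * (u z - u y)) / \<delta>\<^sup>2
      + 2 / \<delta> * (LINT y|N. kK \<delta> z y * (u z - u y)) + (LINT y|M. kK \<delta> z y * laplacian u y)" .
    show "\<bar>nonlocal_op \<delta> (\<lambda>y. u y - v y) z\<bar> \<le> C0 * (boundary_mass \<delta> z + min (2 * \<delta>) D * second_moment \<delta> z)"
      unfolding C0_def op_eq by (rule consistency_bound[OF T(1-3) lip T(5,6) iu ilap uN \<delta> z])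
  qed
  ultimately show ?thesis by blast
qed

end
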